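(* Let $F$ be a form of degree $6$ in $4$ variables over $\mathbb{C}$, with a non-redundant decomposition $A\subset\mathbb{P}^3$ of length $18$. Assume that $A$ satisfies the following properties: \begin{itemize} \item[(i)] $A$ is in General Position; \item[(ii)] for all subsets $A'\subset A$ of length $17$, the linear system of cubic surfaces through $A'$ has base locus of dimension $0$; \item[(iii)] the base locus of the pencil of cubic surfaces through $A$ is an irreducible curve $C$. \end{itemize} Then $A$ is minimal (i.e. $F$ has Waring rank $18$), and any other decomposition $B$ of length $18$ of $F$ (if any) is disjoint from $A$, and $Z=A\cup B$ is a complete intersection of surfaces of degrees $3,3,4$.
   Context: All polynomials are over $\mathbb{C}$. Linear forms in $4$ variables, up to scalar, are regarded as points of a projective space $\mathbb{P}^3$, and forms of degree $6$ in $4$ variables, up to scalar, as points of $\mathbb{P}^{83}$; $v_6:\mathbb{P}^3\to\mathbb{P}^{83}$, $L\mapsto L^6$, is the $6$-Veronese map. The length $\ell(A)$ of a finite set $A$ is its cardinality. A decomposition of $F$ of length $r$ is a finite set $A=\{L_1,\dots,L_r\}\subset\mathbb{P}^3$ such that $F=\sum_{i=1}^r a_iL_i^6$ for some $a_i\in\mathbb{C}$, i.e. $F$ belongs to the linear span $\langle v_6(A)\rangle$. It is non-redundant if the powers $L_1^6,\dots,L_r^6$ are linearly independent and no coefficient $a_i$ is $0$; equivalently, $F\notin\langle v_6(A')\rangle$ for every proper subset $A'\subsetneq A$. The Waring rank of $F$ is the minimal length of a decomposition of $F$; a decomposition is minimal if its length equals the Waring rank. A finite set $A\subset\mathbb{P}^3$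 is in General Position if every subset $A'\subseteq A$ has maximal Hilbert function, i.e. $h_{A'}(i)=\min\{\ell(A'),\binom{i+3}{3}\}$ for all $i\ge 0$. "Other decomposition" means a decomposition $B\neq A$ as a set. *)

theory Defs
  imports "HOL-Analysis.Analysis" "HOL-Library.Poly_Mapping"
    "HOL-Library.Function_Algebras" "HOL-Library.Numeral_Type"
begin

section \<open>Projective space\<close>

definition proportional :: "complex ^ 'n \<Rightarrow> complex ^ 'n \<Rightarrow> bool" where
  "proportional v w \<longleftrightarrow> v \<noteq> 0 \<and> w \<noteq> 0 \<and> (\<exists>c. c \<noteq> 0 \<and> w = c *s v)"

text \<open>The type \<open>'n proj\<close> is the projective space of dimension \<open>CARD('n) - 1\<close>. A point is a class of
  proportional nonzero vectors, \<open>abs_proj v\<close> is the class of \<open>v\<close>, and \<open>rep_proj x\<close> is a choice of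
  homogeneous coordinates for \<open>x\<close>.\<close>

quotient_type 'n proj = "complex ^ 'n::finite" / partial: proportional
proof (rule part_equivpI)
  show "\<exists>v :: complex ^ 'n. proportional v v"
  proof
    have "axis i (1 :: complex) \<noteq> 0" for i :: 'n
      by (simp add: axis_eq_0_iff)
    then show "proportional (axis undefined 1) (axis undefined (1 :: complex) :: complex ^ 'n)"
      unfolding proportional_def by (auto intro!: exI[of _ 1])
  qed
  show "symp (proportional :: complex ^ 'n \<Rightarrow> _)"
  proof (rule sympI)
    fix v w :: "complex ^ 'n"
    assume "proportional v w"
    then obtain c where c: "v \<noteq> 0" "w \<noteq> 0" "c \<noteq> 0" "w = c *s v"
      unfolding proportional_def by auto
    then have "v = inverse c *s w" by simp
    with c show "proportional w v"
      unfolding proportional_def by (metis inverse_nonzero_iff_nonzero)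
  qed
  show "transp (proportional :: complex ^ 'n \<Rightarrow> _)"
  proof (rule transpI)
    fix u v w :: "complex ^ 'n"
    assume "proportional u v" "proportional v w"
    then obtain c d where "u \<noteq> 0" "w \<noteq> 0" "c \<noteq> 0" "v = c *s u" "d \<noteq> 0" "w = d *s v"
      unfolding proportional_def by auto
    then show "proportional u w"
      unfolding proportional_def by (auto intro!: exI[of _ "d * c"])
  qed
qed


section \<open>Polynomials over the complex numbers with variables indexed by a finite type\<close>

type_synonym 'n cpoly = "('n \<Rightarrow>\<^sub>0 nat) \<Rightarrow>\<^sub>0 complex"

definition poly_scale :: "complex \<Rightarrow> 'n cpoly \<Rightarrow> 'n cpoly" where
  "poly_scale c p = Poly_Mapping.single 0 c * p"

global_interpretation cpoly: vector_space "poly_scale :: complex \<Rightarrow> 'n cpoly \<Rightarrow> 'n cpoly"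
proof
  fix a b :: complex and p q :: "'n cpoly"
  show "poly_scale a (p + q) = poly_scale a p + poly_scale a q"
    by (simp add: poly_scale_def distrib_left)
  show "poly_scale (a + b) p = poly_scale a p + poly_scale b p"
    by (simp add: poly_scale_def single_add distrib_right)
  show "poly_scale a (poly_scale b p) = poly_scale (a * b) p"
    by (simp add: poly_scale_def mult_single flip: mult.assoc)
  show "poly_scale 1 p = p"
    by (simp add: poly_scale_def)
qed

definition poly_eval :: "'n::finite cpoly \<Rightarrow> complex ^ 'n \<Rightarrow> complex" where
  "poly_eval p v = (\<Sum>m\<in>Poly_Mapping.keys p.
     Poly_Mapping.lookup p m * (\<Prod>i\<in>UNIV. v $ i ^ Poly_Mapping.lookup m i))"

text \<open>The zero polynomial is homogeneous of every degree, so \<open>{p. homogeneous d p}\<close> is a vector space.\<close>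

definition homogeneous :: "nat \<Rightarrow> 'n::finite cpoly \<Rightarrow> bool" where
  "homogeneous d p \<longleftrightarrow>
     (\<forall>m\<in>Poly_Mapping.keys p. (\<Sum>i\<in>UNIV. Poly_Mapping.lookup m i) = d)"

definition vanishes_at :: "'n::finite cpoly \<Rightarrow> 'n proj \<Rightarrow> bool" where
  "vanishes_at p x \<longleftrightarrow> (\<forall>v. v \<noteq> 0 \<and> abs_proj v = x \<longrightarrow> poly_eval p v = 0)"


section \<open>Waring decompositions\<close>

text \<open>A point with homogeneous coordinates \<open>v\<close> is identified with the linear form with coefficient
  vector \<open>v\<close>, up to scalar.\<close>

definition linear_form :: "complex ^ 'n::finite \<Rightarrow> 'n cpoly" where
  "linear_form v = (\<Sum>i\<in>UNIV. Poly_Mapping.single (Poly_Mapping.single i 1) (v $ i))"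

text \<open>A polynomial representing the image of \<open>x\<close> under the Veronese map of degree \<open>d\<close>. Another choice of
  homogeneous coordinates multiplies it by a nonzero scalar, which affects none of the notions
  below.\<close>

definition veronese :: "nat \<Rightarrow> 'n::finite proj \<Rightarrow> 'n cpoly" where
  "veronese d x = linear_form (rep_proj x) ^ d"

definition decomposition :: "nat \<Rightarrow> 'n::finite cpoly \<Rightarrow> 'n proj set \<Rightarrow> bool" where
  "decomposition d F A \<longleftrightarrow>
     finite A \<and> (\<exists>a. F = (\<Sum>x\<in>A. poly_scale (a x) (veronese d x)))"

text \<open>Injectivity makes independence of the image set the same as independence of the family of
  powers indexed by \<open>A\<close>.\<close>

definition nonredundant_decomposition :: "nat \<Rightarrow> 'n::finite cpoly \<Rightarrow> 'n proj set \<Rightarrow> bool" where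
  "nonredundant_decomposition d F A \<longleftrightarrow>
     finite A \<and> inj_on (veronese d) A \<and> cpoly.independent (veronese d ` A) \<and>
     (\<exists>a. (\<forall>x\<in>A. a x \<noteq> 0) \<and> F = (\<Sum>x\<in>A. poly_scale (a x) (veronese d x)))"

text \<open>Only meaningful when \<open>F\<close> has a decomposition (true for every form of degree \<open>d\<close>).\<close>

definition waring_rank :: "nat \<Rightarrow> 'n::finite cpoly \<Rightarrow> nat" where
  "waring_rank d F = (LEAST r. \<exists>A. decomposition d F A \<and> card A = r)"

definition minimal_decomposition :: "nat \<Rightarrow> 'n::finite cpoly \<Rightarrow> 'n proj set \<Rightarrow> bool" where
  "minimal_decomposition d F A \<longleftrightarrow> decomposition d F A \<and> card A = waring_rank d F"


section \<open>Hilbert functions and General Position\<close>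

global_interpretation cfun: vector_space "\<lambda>(c :: complex) (f :: 'a \<Rightarrow> complex) x. c * f x"
  by unfold_locales (auto simp: algebra_simps fun_eq_iff)

text \<open>The rank of the evaluation map from forms of degree \<open>i\<close> to complex functions on \<open>Z\<close> (extended by
  zero outside \<open>Z\<close>); the rank does not depend on the homogeneous coordinates used.\<close>

definition hilbert_function :: "'n::finite proj set \<Rightarrow> nat \<Rightarrow> nat" where
  "hilbert_function Z i =
     cfun.dim ((\<lambda>p x. if x \<in> Z then poly_eval p (rep_proj x) else 0) ` {p. homogeneous i p})"

definition general_position :: "4 proj set \<Rightarrow> bool" where
  "general_position A \<longleftrightarrow>
     (\<forall>A'\<subseteq>A. \<forall>i. hilbert_function A' i = min (card A') ((i + 3) choose 3))"


section \<open>Zariski-closed sets and base loci\<close>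

definition zero_locus :: "'n::finite cpoly set \<Rightarrow> 'n proj set" where
  "zero_locus S = {x. \<forall>p\<in>S. vanishes_at p x}"

definition zariski_closed :: "'n::finite proj set \<Rightarrow> bool" where
  "zariski_closed Z \<longleftrightarrow> (\<exists>S. (\<forall>p\<in>S. \<exists>d. homogeneous d p) \<and> Z = zero_locus S)"

definition zariski_irreducible :: "'n::finite proj set \<Rightarrow> bool" where
  "zariski_irreducible Z \<longleftrightarrow> Z \<noteq> {} \<and>
     (\<forall>U V. zariski_closed U \<and> zariski_closed V \<and> Z \<subseteq> U \<union> V \<longrightarrow> Z \<subseteq> U \<or> Z \<subseteq> V)"

definition irreducible_chain :: "'n::finite proj set \<Rightarrow> nat \<Rightarrow> (nat \<Rightarrow> 'n proj set) \<Rightarrow> bool" where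
  "irreducible_chain Z n W \<longleftrightarrow>
     (\<forall>i\<le>n. zariski_closed (W i) \<and> zariski_irreducible (W i) \<and> W i \<subseteq> Z) \<and>
     (\<forall>i<n. W i \<subset> W (Suc i))"

text \<open>Krull dimension of a closed set, as a relation: the longest chains of irreducible closed subsets
  of \<open>Z\<close> have length \<open>d\<close>. The empty set has no dimension.\<close>

definition has_dimension :: "'n::finite proj set \<Rightarrow> nat \<Rightarrow> bool" where
  "has_dimension Z d \<longleftrightarrow>
     (\<exists>W. irreducible_chain Z d W) \<and> (\<forall>n W. irreducible_chain Z n W \<longrightarrow> n \<le> d)"

definition irreducible_curve :: "'n::finite proj set \<Rightarrow> bool" where
  "irreducible_curve C \<longleftrightarrow> zariski_closed C \<and> zariski_irreducible C \<and> has_dimension C 1"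

definition forms_through :: "nat \<Rightarrow> 'n::finite proj set \<Rightarrow> 'n cpoly set" where
  "forms_through d Z = {p. homogeneous d p \<and> (\<forall>x\<in>Z. vanishes_at p x)}"

text \<open>The base locus of the linear system of all hypersurfaces of degree \<open>d\<close> through \<open>Z\<close>.\<close>

definition base_locus :: "nat \<Rightarrow> 'n::finite proj set \<Rightarrow> 'n proj set" where
  "base_locus d Z = zero_locus (forms_through d Z)"


section \<open>Complete intersections\<close>

definition vanishing_ideal :: "'n::finite proj set \<Rightarrow> 'n cpoly set" where
  "vanishing_ideal Z = {p. \<forall>x\<in>Z. vanishes_at p x}"

text \<open>A reduced complete intersection of hypersurfaces of degrees \<open>ds\<close>: the vanishing ideal of \<open>Z\<close> is
  generated by forms of these degrees, as many as the codimension of \<open>Z\<close>. The span over the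
  multiplication of the polynomial ring is the generated ideal.\<close>

definition complete_intersection :: "'n::finite proj set \<Rightarrow> nat list \<Rightarrow> bool" where
  "complete_intersection Z ds \<longleftrightarrow>
     (\<exists>k. has_dimension Z k \<and> k + length ds = CARD('n) - 1) \<and>
     (\<exists>fs. list_all2 (\<lambda>d f. f \<noteq> 0 \<and> homogeneous d f) ds fs \<and>
        vanishing_ideal Z = module.span (*) (set fs))"

end

theory Submission
  imports Defs "HOL-Computational_Algebra.Fundamental_Theorem_Algebra"
    "HOL-Computational_Algebra.Polynomial_Factorial" "HOL-Computational_Algebra.Field_as_Ring"
begin

text \<open>Two decompositions give a linear relation between the evaluations of sextics at the points of
  \<open>A \<union> B\<close>. Multiplying cubics with cubics in this relation shows that cubics through \<open>B - A\<close> vanish on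
  \<open>A - B\<close>; since cubics separate the points of \<open>A\<close>, \<open>B\<close> has at least 18 points, and for 18 points the
  cubics through \<open>A - B\<close> and \<open>B - A\<close> agree.

  By General Position the pencil \<open>f, g\<close> of cubics through \<open>A\<close> has no common factor, so some line misses
  the curve \<open>C\<close>. Cutting with planes through this line yields the Hilbert function of \<open>(f, g)\<close>
  (\<open>9 d - 9\<close> for \<open>d \<ge> 3\<close>), and for every form \<open>h\<close> not vanishing on the irreducible curve \<open>C\<close> a plane \<open>l\<close> such
  that \<open>f, g, h, l\<close> is a regular sequence. If \<open>A\<close> and \<open>B\<close> meet, take for \<open>h\<close> a cubic through all points of
  \<open>A\<close> but a common one: the points of the symmetric difference lie on a complete intersection of type
  \<open>(3, 3, 3)\<close>, whose points are separated by sextics, which contradicts the relation. If \<open>A\<close> and \<open>B\<close> are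
  disjoint, multiplying quadrics with quartics in the relation gives a quartic \<open>q\<close> through \<open>A \<union> B\<close> outside
  \<open>(f, g)\<close>. It does not vanish on \<open>C\<close>, because otherwise the degree of the reduced curve would be at most
  4, whereas a cubic not containing \<open>C\<close> meets it in 17 points of \<open>A\<close>. So the quotient by \<open>(f, g, q)\<close> has
  Hilbert polynomial 36 and a linear nonzerodivisor, which forces \<open>(f, g, q)\<close> to be the ideal of \<open>A \<union> B\<close>.\<close>

text \<open>The ideal (f, g) of the pencil is not known to be prime or radical: irreducibility only
  concerns the point set C. So a form outside (f, g) may still vanish on C, and a form not vanishing
  on C is not obviously a nonzerodivisor. Both gaps are closed by counting dimensions in single
  degrees: adjoining a form of degree e lowers the Hilbert function by at most its own shift by e,
  and equality means that the form is a nonzerodivisor. Upper bounds from a line section meet lower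
  bounds from the degrees of f and g, so all inequalities become equalities. The numbers fit
  tightly. 6 = 3 + 3 is exactly the degree from which points on a complete intersection of type (3,
  3, 3) are separated. 6 = 2 + 4 yields the quartic: the 10 points of A separated by quadrics leave
  26 others, and 26 is just below 27, the value for (f, g) in degree 4. Finally 36 = 3 * 3 * 4 = 18
  + 18.\<close>

section \<open>Dimensions of subspaces\<close>

text \<open>\<open>dim\<close> is the cardinality of a basis, hence 0 on spaces without a finite
  basis. Polynomials form an infinite-dimensional space, so finiteness is tracked as a predicate on
  subsets.\<close>

definition (in vector_space) fin_dim :: "'b set \<Rightarrow> bool" where
  "fin_dim V \<longleftrightarrow> (\<exists>B. finite B \<and> V \<subseteq> span B)"

context vector_space
begin

lemma fin_dim_finite: "finite B \<Longrightarrow> fin_dim B"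
  unfolding fin_dim_def using span_superset by blast

lemma fin_dim_subset: "fin_dim W \<Longrightarrow> V \<subseteq> W \<Longrightarrow> fin_dim V"
  unfolding fin_dim_def by blast

lemma fin_dim_Un:
  assumes "fin_dim V" "fin_dim W"
  shows "fin_dim (V \<union> W)"
proof -
  obtain B C where "finite B" "V \<subseteq> span B" "finite C" "W \<subseteq> span C"
    using assms unfolding fin_dim_def by auto
  then show ?thesis
    unfolding fin_dim_def using span_mono[of B "B \<union> C"] span_mono[of C "B \<union> C"]
    by (intro exI[of _ "B \<union> C"]) auto
qed

lemma fin_dim_span: "fin_dim V \<Longrightarrow> fin_dim (span V)"
  unfolding fin_dim_def using span_minimal[OF _ subspace_span] by blast

lemma fin_dim_independent_finite:
  assumes "fin_dim V" "B \<subseteq> V" "independent B"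
  shows "finite B"
  using assms independent_span_bound unfolding fin_dim_def by (meson order_trans)

lemma fin_dim_basis:
  assumes "fin_dim V"
  obtains B where "B \<subseteq> V" "independent B" "V \<subseteq> span B" "card B = dim V" "finite B"
  using basis_exists[of V] fin_dim_independent_finite[OF assms] by metis

lemma fin_dim_dim_mono:
  assumes "fin_dim W" "V \<subseteq> span W"
  shows "dim V \<le> dim W"
  using fin_dim_basis[OF assms(1)] assms(2) by (metis dim_le_card span_minimal subspace_span order_trans)

lemma fin_dim_subspace_eq:
  assumes "fin_dim W" "subspace V" "V \<subseteq> W" "dim W \<le> dim V"
  shows "V = W"
proof -
  obtain B where B: "B \<subseteq> V" "independent B" "V \<subseteq> span B" "card B = dim V" "finite B"
    using fin_dim_basis[OF fin_dim_subset[OF assms(1,3)]] .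
  have "x \<in> span B" if "x \<in> W" for x
  proof (rule ccontr)
    assume x: "x \<notin> span B"
    then have i: "independent (insert x B)" using B by (simp add: independent_insertI)
    have "x \<notin> B" using x span_base by blast
    obtain C where C: "C \<subseteq> W" "W \<subseteq> span C" "card C = dim W" "finite C"
      using fin_dim_basis[OF assms(1)] by metis
    have "insert x B \<subseteq> span C" using that B assms(3) C by blast
    then have "card (insert x B) \<le> card C"
      using independent_span_bound[OF C(4) i] by simp
    then show False using B C assms(4) \<open>x \<notin> B\<close> by simp
  qed
  then have "W \<subseteq> V" using span_minimal[OF B(1) assms(2)] by blast
  then show ?thesis using assms(3) by simp
qed

lemma dim_insert_notin_span:
  assumes "fin_dim S" "a \<notin> span S"
  shows "dim (insert a S) = dim S + 1"
proof -
  obtain B where B: "B \<subseteq> S" "independent B" "S \<subseteq> span B" "card B = dim S" "finite B"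
    using fin_dim_basis[OF assms(1)] .
  have a: "a \<notin> span B" using assms(2) span_mono[OF B(1)] by blast
  then have "independent (insert a B)" using B by (simp add: independent_insertI)
  moreover have "insert a S \<subseteq> span (insert a B)"
    using B(3) span_mono[of B "insert a B"] span_base[of a "insert a B"] by auto
  moreover have "a \<notin> B" using a span_base by blast
  ultimately show ?thesis
    using B by (intro dim_unique[of "insert a B"]) auto
qed

lemma span_Un_image_expand:
  assumes "finite I" "subspace W" "x \<in> span (W \<union> u ` I)"
  shows "\<exists>w\<in>W. \<exists>c. x = w + (\<Sum>i\<in>I. scale (c i) (u i))"
  using assms(1,3)
proof (induction I arbitrary: x rule: finite_induct)
  case empty
  then have "x \<in> W" using assms(2) by (simp add: span_eq_iff[THEN iffD2])
  then show ?case by (intro bexI[of _ x]) simp_all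
next
  case (insert j I)
  then have "x \<in> span (insert (u j) (W \<union> u ` I))" by simp
  then obtain k where "x - scale k (u j) \<in> span (W \<union> u ` I)"
    unfolding span_breakdown_eq by auto
  then obtain w c where w: "w \<in> W" "x - scale k (u j) = w + (\<Sum>i\<in>I. scale (c i) (u i))"
    using insert.IH by blast
  have "(\<Sum>i\<in>I. scale ((c(j := k)) i) (u i)) = (\<Sum>i\<in>I. scale (c i) (u i))"
    using insert.hyps by (intro sum.cong) auto
  then have "x = w + (\<Sum>i\<in>insert j I. scale ((c(j := k)) i) (u i))"
    using w insert.hyps by (simp add: algebra_simps)
  then show ?case using w(1) by blast
qed

text \<open>The last hypothesis is independence of the family \<open>u\<close> modulo
  \<open>W\<close>. For a family, unlike a set, it also excludes repeated values.\<close>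

lemma dim_span_Un_image:
  assumes "finite I" "subspace W" "fin_dim W"
    and "\<And>c. (\<Sum>i\<in>I. scale (c i) (u i)) \<in> W \<Longrightarrow> \<forall>i\<in>I. c i = 0"
  shows "dim (span (W \<union> u ` I)) = dim W + card I"
  using assms(1,4)
proof (induction I rule: finite_induct)
  case empty
  then show ?case using assms(2) span_eq_iff[of W] by simp
next
  case (insert j I)
  have ext: "(\<Sum>i\<in>insert j I. scale ((c(j := k)) i) (u i)) = scale k (u j) + (\<Sum>i\<in>I. scale (c i) (u i))" for c k
  proof -
    have "(\<Sum>i\<in>I. scale ((c(j := k)) i) (u i)) = (\<Sum>i\<in>I. scale (c i) (u i))"
      using insert.hyps by (intro sum.cong) auto
    then show ?thesis using insert.hyps by simp
  qed
  have IH: "dim (span (W \<union> u ` I)) = dim W + card I"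
  proof (rule insert.IH)
    fix c assume "(\<Sum>i\<in>I. scale (c i) (u i)) \<in> W"
    then have "(\<Sum>i\<in>insert j I. scale ((c(j := 0)) i) (u i)) \<in> W" unfolding ext by simp
    then have "\<forall>i\<in>insert j I. (c(j := 0)) i = 0" by (rule insert.prems)
    then show "\<forall>i\<in>I. c i = 0" using insert.hyps by (metis fun_upd_other insertCI)
  qed
  have fd: "fin_dim (W \<union> u ` I)"
    using insert.hyps by (intro fin_dim_Un assms(3) fin_dim_finite) auto
  have "u j \<notin> span (W \<union> u ` I)"
  proof
    assume "u j \<in> span (W \<union> u ` I)"
    then obtain w c where w: "w \<in> W" "u j = w + (\<Sum>i\<in>I. scale (c i) (u i))"
      using span_Un_image_expand[OF insert.hyps(1) assms(2)] by blast
    have "(\<Sum>i\<in>insert j I. scale ((c(j := -1)) i) (u i)) = - w"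
      unfolding ext using w(2) by simp
    then have "(\<Sum>i\<in>insert j I. scale ((c(j := -1)) i) (u i)) \<in> W"
      using w(1) assms(2) by (simp add: subspace_neg)
    from insert.prems[OF this] have "(c(j := -1)) j = 0" by blast
    then show False by simp
  qed
  then have "dim (insert (u j) (W \<union> u ` I)) = dim (W \<union> u ` I) + 1"
    by (rule dim_insert_notin_span[OF fd])
  then show ?case using IH insert.hyps by simp
qed

text \<open>Pigeonhole in the quotient of \<open>V\<close> by \<open>W\<close>: more vectors than
  its dimension are dependent. All polynomial relations found by counting come from here.\<close>

lemma relation_modulo_subspace:
  assumes "finite I" "subspace V" "fin_dim V" "subspace W" "W \<subseteq> V" "u ` I \<subseteq> V"
    and "dim V < dim W + card I"
  shows "\<exists>c. (\<Sum>i\<in>I. scale (c i) (u i)) \<in> W \<and> (\<exists>i\<in>I. c i \<noteq> 0)"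
proof (rule ccontr)
  assume "\<not> ?thesis"
  then have "dim (span (W \<union> u ` I)) = dim W + card I"
    using assms fin_dim_subset[OF assms(3,5)] by (intro dim_span_Un_image) auto
  moreover have "dim (span (W \<union> u ` I)) \<le> dim V"
    using span_mono[of "W \<union> u ` I" V] assms by (intro fin_dim_dim_mono) auto
  ultimately show False using assms(7) by simp
qed

end

text \<open>Rank-nullity for \<open>f\<close> followed by the quotient map modulo \<open>W\<close>,
  expressed without quotients. It serves multiplication by a form, where \<open>W\<close> is a piece
  of an ideal, and evaluation at points, where \<open>W\<close> is zero.\<close>

lemma (in Vector_Spaces.linear) dim_preimage_plus_sum:
  assumes V: "vs1.subspace V" "vs1.fin_dim V" and W: "vs2.subspace W" "vs2.fin_dim W"
  shows "vs2.dim {w + f v |w v. w \<in> W \<and> v \<in> V} + vs1.dim {v \<in> V. f v \<in> W}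
    = vs2.dim W + vs1.dim V"
proof -
  let ?K = "{v \<in> V. f v \<in> W}"
  have K: "vs1.subspace ?K"
  proof (rule vs1.subspaceI)
    show "0 \<in> ?K" using vs1.subspace_0[OF V(1)] vs2.subspace_0[OF W(1)] zero by simp
    show "x + y \<in> ?K" if "x \<in> ?K" "y \<in> ?K" for x y
      using that vs1.subspace_add[OF V(1)] vs2.subspace_add[OF W(1)] add by simp
    show "s1 c x \<in> ?K" if "x \<in> ?K" for c x
      using that vs1.subspace_scale[OF V(1)] vs2.subspace_scale[OF W(1)] scale by simp
  qed
  have fK: "vs1.fin_dim ?K" by (rule vs1.fin_dim_subset[OF V(2)]) auto
  obtain B0 where B0: "B0 \<subseteq> ?K" "vs1.independent B0" "?K \<subseteq> vs1.span B0" "card B0 = vs1.dim ?K"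
    "finite B0" using vs1.fin_dim_basis[OF fK] .
  obtain B where B: "B0 \<subseteq> B" "B \<subseteq> V" "vs1.independent B" "V \<subseteq> vs1.span B"
  proof (rule vs1.maximal_independent_subset_extend[of B0 V])
    show "B0 \<subseteq> V" using B0(1) by auto
  qed (use B0 that in auto)
  have fB: "finite B" using vs1.fin_dim_independent_finite[OF V(2) B(2,3)] .
  have cB: "card B = vs1.dim V" using vs1.basis_card_eq_dim[OF B(2,4,3)] .
  let ?D = "B - B0"
  \<comment> \<open>The basis vectors of \<open>V\<close> outside the basis \<open>B0\<close> of the
    kernel have images independent modulo \<open>W\<close>: a dependency would put a combination of
    them into the kernel, against the independence of \<open>B\<close>.\<close>
  have "vs2.dim (vs2.span (W \<union> f ` ?D)) = vs2.dim W + card ?D"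
  proof (rule vs2.dim_span_Un_image)
    fix c assume "(\<Sum>i\<in>?D. s2 (c i) (f i)) \<in> W"
    then have fW: "f (\<Sum>i\<in>?D. s1 (c i) i) \<in> W" by (simp add: sum scale)
    have "(\<Sum>i\<in>?D. s1 (c i) i) \<in> V"
      using B(2) V(1) by (intro vs1.subspace_sum vs1.subspace_scale) auto
    then have "(\<Sum>i\<in>?D. s1 (c i) i) \<in> vs1.span B0" using fW B0(3) by blast
    then obtain e where e: "(\<Sum>i\<in>?D. s1 (c i) i) = (\<Sum>i\<in>B0. s1 (e i) i)"
      unfolding vs1.span_finite[OF B0(5)] by auto
    define a where "a i = (if i \<in> B0 then - e i else c i)" for i
    have "(\<Sum>i\<in>B. s1 (a i) i) = (\<Sum>i\<in>?D. s1 (a i) i) + (\<Sum>i\<in>B0. s1 (a i) i)"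
      using B(1) fB by (simp add: sum.subset_diff)
    also have "(\<Sum>i\<in>?D. s1 (a i) i) = (\<Sum>i\<in>?D. s1 (c i) i)"
      by (intro sum.cong) (auto simp: a_def)
    also have "(\<Sum>i\<in>B0. s1 (a i) i) = - (\<Sum>i\<in>B0. s1 (e i) i)"
      unfolding sum_negf[symmetric] by (intro sum.cong) (auto simp: a_def)
    finally have "(\<Sum>i\<in>B. s1 (a i) i) = 0" using e by simp
    then have "\<forall>i\<in>B. a i = 0"
      using B(3) fB unfolding vs1.independent_explicit_finite_subsets by blast
    then show "\<forall>i\<in>?D. c i = 0" by (auto simp: a_def split: if_splits)
  qed (use fB W in auto)
  moreover have "vs2.span (W \<union> f ` ?D) = {w + f v |w v. w \<in> W \<and> v \<in> V}" (is "_ = ?R")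
  proof
    have R: "vs2.subspace ?R"
    proof -
      have "vs2.subspace (f ` V)" using V(1) by (rule subspace_image)
      from vs2.subspace_sums[OF W(1) this] show ?thesis
        by (rule back_subst[of vs2.subspace]) auto
    qed
    have "W \<union> f ` ?D \<subseteq> ?R"
    proof (intro Un_least subsetI)
      fix w assume "w \<in> W" then show "w \<in> ?R" using V(1) vs1.subspace_0 zero by force
    next
      fix w assume "w \<in> f ` ?D" then show "w \<in> ?R" using W(1) vs2.subspace_0 B(2) by force
    qed
    then show "vs2.span (W \<union> f ` ?D) \<subseteq> ?R" using R by (rule vs2.span_minimal)
    have "f v \<in> vs2.span (W \<union> f ` ?D)" if "v \<in> V" for v
    proof -
      have "f v \<in> vs2.span (f ` B)"
        using that B(4) span_image[of B] by blast
      moreover have "f ` B \<subseteq> W \<union> f ` ?D" using B0(1) by auto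
      ultimately show ?thesis using vs2.span_mono by blast
    qed
    then show "?R \<subseteq> vs2.span (W \<union> f ` ?D)"
      using vs2.span_add vs2.span_base by fastforce
  qed
  moreover have "card B = card B0 + card ?D"
    using B(1) fB by (metis card_Diff_subset card_mono finite_subset le_add_diff_inverse)
  ultimately show ?thesis using cB B0(4) by simp
qed

section \<open>Forms and their values at points\<close>

hide_const (open) Poly_Mapping.degree

abbreviation forms :: "nat \<Rightarrow> 'n::finite cpoly set" where
  "forms d \<equiv> {p. homogeneous d p}"

abbreviation mdeg :: "('n::finite \<Rightarrow>\<^sub>0 nat) \<Rightarrow> nat" where
  "mdeg m \<equiv> \<Sum>i\<in>UNIV. Poly_Mapping.lookup m i"

definition Var :: "'n \<Rightarrow> 'n cpoly" where
  "Var i = Poly_Mapping.single (Poly_Mapping.single i 1) 1"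

lemma sum_single_lookup:
  fixes p :: "'a \<Rightarrow>\<^sub>0 'b::comm_monoid_add"
  shows "(\<Sum>m\<in>Poly_Mapping.keys p. Poly_Mapping.single m (Poly_Mapping.lookup p m)) = p"
proof (rule poly_mapping_eqI)
  fix k
  have "Poly_Mapping.lookup (\<Sum>m\<in>Poly_Mapping.keys p. Poly_Mapping.single m (Poly_Mapping.lookup p m)) k
      = (\<Sum>m\<in>Poly_Mapping.keys p. if m = k then Poly_Mapping.lookup p m else 0)"
    unfolding lookup_sum by (intro sum.cong) (auto simp: lookup_single when_def)
  also have "\<dots> = Poly_Mapping.lookup p k"
    by (simp add: in_keys_iff)
  finally show "Poly_Mapping.lookup (\<Sum>m\<in>Poly_Mapping.keys p. Poly_Mapping.single m (Poly_Mapping.lookup p m)) k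
    = Poly_Mapping.lookup p k" .
qed

lemma cpoly_induct [case_names zero add single]:
  fixes p :: "'n cpoly"
  assumes "P 0" "\<And>p q. P p \<Longrightarrow> P q \<Longrightarrow> P (p + q)" "\<And>m c. P (Poly_Mapping.single m c)"
  shows "P p"
proof -
  have "P (\<Sum>m\<in>K. Poly_Mapping.single m (Poly_Mapping.lookup p m))" if "finite K" for K
    using that by (induction K) (auto intro: assms)
  then show ?thesis using sum_single_lookup[of p] by (metis finite_keys)
qed

lemma mdeg_add: "mdeg (m + n) = mdeg m + mdeg n"
  by (simp add: lookup_add sum.distrib)

lemma mdeg_single: "mdeg (Poly_Mapping.single i k) = k"
  by (simp add: lookup_single when_def)

text \<open>One substitution homomorphism for three targets: complex numbers (evaluation),
  univariate polynomials (restriction to a line) and iterated polynomials (where factorization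
  theory is at hand).\<close>

locale coeff_hom =
  fixes h :: "complex \<Rightarrow> 'r::comm_ring_1"
  assumes h_add: "h (a + b) = h a + h b" and h_mult: "h (a * b) = h a * h b" and h_one: "h 1 = 1"
begin

lemma h_zero: "h 0 = 0"
  using h_add[of 0 0] by simp

definition insertion :: "('n::finite \<Rightarrow> 'r) \<Rightarrow> 'n cpoly \<Rightarrow> 'r" where
  "insertion X p = (\<Sum>m\<in>Poly_Mapping.keys p.
     h (Poly_Mapping.lookup p m) * (\<Prod>i\<in>UNIV. X i ^ Poly_Mapping.lookup m i))"

lemma insertion_superset:
  assumes "finite K" "Poly_Mapping.keys p \<subseteq> K"
  shows "insertion X p = (\<Sum>m\<in>K. h (Poly_Mapping.lookup p m) * (\<Prod>i\<in>UNIV. X i ^ Poly_Mapping.lookup m i))"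
  unfolding insertion_def using assms
  by (intro sum.mono_neutral_left) (auto simp: in_keys_iff h_zero)

lemma insertion_zero: "insertion X 0 = 0"
  by (simp add: insertion_def)

lemma insertion_single:
  "insertion X (Poly_Mapping.single m c) = h c * (\<Prod>i\<in>UNIV. X i ^ Poly_Mapping.lookup m i)"
  by (subst insertion_superset[of "{m}"]) auto

lemma insertion_add: "insertion X (p + q) = insertion X p + insertion X q"
proof -
  let ?K = "Poly_Mapping.keys p \<union> Poly_Mapping.keys q"
  have "Poly_Mapping.keys (p + q) \<subseteq> ?K" by (rule keys_add)
  then show ?thesis
    using insertion_superset[of ?K p X] insertion_superset[of ?K q X] insertion_superset[of ?K "p + q" X]
    by (simp add: lookup_add h_add algebra_simps sum.distrib)
qed

lemma insertion_mult: "insertion X (p * q) = insertion X p * insertion X q"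
proof (induction p rule: cpoly_induct)
  case (single m c)
  show ?case
  proof (induction q rule: cpoly_induct)
    case (single n d)
    show ?case
      by (simp add: mult_single insertion_single h_mult lookup_add power_add prod.distrib)
  qed (simp_all add: insertion_zero insertion_add distrib_left)
qed (simp_all add: insertion_zero insertion_add distrib_right)

lemma insertion_one: "insertion X 1 = 1"
  using insertion_single[of X 0 1] by (simp add: h_one)

lemma insertion_const: "insertion X (Poly_Mapping.single 0 c) = h c"
  by (simp add: insertion_single)

lemma insertion_scale: "insertion X (poly_scale c p) = h c * insertion X p"
  by (simp add: poly_scale_def insertion_mult insertion_const)

lemma insertion_uminus: "insertion X (- p) = - insertion X p"
  using insertion_add[of X p "- p"] by (simp add: insertion_zero eq_neg_iff_add_eq_0 add.commute)

lemma insertion_diff: "insertion X (p - q) = insertion X p - insertion X q"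
  using insertion_add[of X p "- q"] by (simp add: insertion_uminus)

lemma insertion_sum: "insertion X (\<Sum>i\<in>I. f i) = (\<Sum>i\<in>I. insertion X (f i))"
  by (induction I rule: infinite_finite_induct) (simp_all add: insertion_zero insertion_add)

lemma insertion_power: "insertion X (p ^ k) = insertion X p ^ k"
  by (induction k) (simp_all add: insertion_one insertion_mult)

lemma insertion_Var: "insertion X (Var i) = X i"
proof -
  have "(\<Prod>j\<in>UNIV. X j ^ Poly_Mapping.lookup (Poly_Mapping.single i 1) j) = (\<Prod>j\<in>UNIV. if j = i then X i else 1)"
    by (intro prod.cong) (auto simp: lookup_single when_def)
  then show ?thesis by (simp add: Var_def insertion_single h_one del: One_nat_def)
qed

end

interpretation id_hom: coeff_hom "\<lambda>a. a"
  by unfold_locales auto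

lemma poly_eval_insertion: "poly_eval p v = id_hom.insertion (($) v) p"
  by (simp add: poly_eval_def id_hom.insertion_def)

lemma poly_eval_zero [simp]: "poly_eval 0 v = 0"
  unfolding poly_eval_insertion by (rule id_hom.insertion_zero)

lemma poly_eval_one [simp]: "poly_eval 1 v = 1"
  unfolding poly_eval_insertion by (rule id_hom.insertion_one)

lemma poly_eval_add [simp]: "poly_eval (p + q) v = poly_eval p v + poly_eval q v"
  unfolding poly_eval_insertion by (rule id_hom.insertion_add)

lemma poly_eval_diff [simp]: "poly_eval (p - q) v = poly_eval p v - poly_eval q v"
  unfolding poly_eval_insertion by (rule id_hom.insertion_diff)

lemma poly_eval_mult [simp]: "poly_eval (p * q) v = poly_eval p v * poly_eval q v"
  unfolding poly_eval_insertion by (rule id_hom.insertion_mult)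

lemma poly_eval_power [simp]: "poly_eval (p ^ k) v = poly_eval p v ^ k"
  unfolding poly_eval_insertion by (rule id_hom.insertion_power)

lemma poly_eval_scale [simp]: "poly_eval (poly_scale c p) v = c * poly_eval p v"
  unfolding poly_eval_insertion by (rule id_hom.insertion_scale)

lemma poly_eval_const [simp]: "poly_eval (Poly_Mapping.single 0 c) v = c"
  unfolding poly_eval_insertion by (rule id_hom.insertion_const)

lemma poly_eval_Var [simp]: "poly_eval (Var i) v = v $ i"
  unfolding poly_eval_insertion by (rule id_hom.insertion_Var)

lemma poly_eval_sum: "poly_eval (\<Sum>i\<in>I. f i) v = (\<Sum>i\<in>I. poly_eval (f i) v)"
  unfolding poly_eval_insertion by (rule id_hom.insertion_sum)

lemma poly_eval_scale_vec:
  assumes "homogeneous d p"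
  shows "poly_eval p (c *s v) = c ^ d * poly_eval p v"
proof -
  have "(\<Prod>i\<in>UNIV. (c *s v) $ i ^ Poly_Mapping.lookup m i) = c ^ d * (\<Prod>i\<in>UNIV. v $ i ^ Poly_Mapping.lookup m i)"
    if "m \<in> Poly_Mapping.keys p" for m
    using assms that by (simp add: homogeneous_def power_mult_distrib prod.distrib flip: power_sum)
  then show ?thesis
    unfolding poly_eval_def sum_distrib_left by (intro sum.cong) (simp_all add: algebra_simps)
qed

lemma lookup_poly_scale: "Poly_Mapping.lookup (poly_scale c p) m = c * Poly_Mapping.lookup p m"
  unfolding poly_scale_def mult_map_scale_conv_mult[symmetric]
  by (simp add: Poly_Mapping.map.rep_eq when_def)

lemma mult_poly_scale: "p * poly_scale c q = poly_scale c (p * q)" "poly_scale c p * q = poly_scale c (p * q)"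
  by (simp_all add: poly_scale_def algebra_simps)

lemma homogeneous_zero [simp]: "homogeneous d 0"
  by (simp add: homogeneous_def)

lemma homogeneous_add: "homogeneous d p \<Longrightarrow> homogeneous d q \<Longrightarrow> homogeneous d (p + q)"
  unfolding homogeneous_def using keys_add[of p q] by (metis UnE subsetD)

lemma homogeneous_single: "mdeg m = d \<Longrightarrow> homogeneous d (Poly_Mapping.single m c)"
  by (simp add: homogeneous_def)

lemma homogeneous_mult: "homogeneous d p \<Longrightarrow> homogeneous e q \<Longrightarrow> homogeneous (d + e) (p * q)"
  unfolding homogeneous_def using keys_mult[of p q] by (fastforce simp: mdeg_add)

lemma homogeneous_const: "homogeneous 0 (Poly_Mapping.single 0 c)"
  by (simp add: homogeneous_single)

lemma homogeneous_one: "homogeneous 0 1"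
  using homogeneous_const[of 1] by simp

lemma homogeneous_Var: "homogeneous 1 (Var i)"
  unfolding Var_def by (rule homogeneous_single) (rule mdeg_single)

lemma homogeneous_scale: "homogeneous d p \<Longrightarrow> homogeneous d (poly_scale c p)"
  using homogeneous_mult[OF homogeneous_const] by (simp add: poly_scale_def)

lemma homogeneous_uminus: "homogeneous d p \<Longrightarrow> homogeneous d (- p)"
  by (simp add: homogeneous_def)

lemma homogeneous_diff: "homogeneous d p \<Longrightarrow> homogeneous d q \<Longrightarrow> homogeneous d (p - q)"
  using homogeneous_add[of d p "- q"] by (simp add: homogeneous_uminus)

lemma homogeneous_sum: "(\<And>i. i \<in> I \<Longrightarrow> homogeneous d (f i)) \<Longrightarrow> homogeneous d (\<Sum>i\<in>I. f i)"
  by (induction I rule: infinite_finite_induct) (simp_all add: homogeneous_add)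

lemma homogeneous_power: "homogeneous d p \<Longrightarrow> homogeneous (k * d) (p ^ k)"
  by (induction k) (simp_all add: homogeneous_one homogeneous_mult)

lemma homogeneous_power1: "homogeneous 1 p \<Longrightarrow> homogeneous k (p ^ k)"
  using homogeneous_power[of 1 p k] by simp

lemma homogeneous_0_const: "homogeneous 0 p \<Longrightarrow> p = Poly_Mapping.single 0 (Poly_Mapping.lookup p 0)"
proof (rule poly_mapping_eqI)
  fix k
  assume p: "homogeneous 0 p"
  show "Poly_Mapping.lookup p k = Poly_Mapping.lookup (Poly_Mapping.single 0 (Poly_Mapping.lookup p 0)) k"
  proof (cases "k = 0")
    case False
    then have "mdeg k \<noteq> 0"
      by (auto intro!: poly_mapping_eqI)
    then have "k \<notin> Poly_Mapping.keys p" using p unfolding homogeneous_def by metis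
    then show ?thesis using False by (simp add: in_keys_iff lookup_single)
  qed simp
qed

lemma subspace_forms: "cpoly.subspace (forms d)"
  by (rule cpoly.subspaceI) (simp_all add: homogeneous_add homogeneous_scale)

lemma span_monomials:
  "cpoly.span ((\<lambda>m. Poly_Mapping.single m 1) ` {m. mdeg m = d}) = (forms d :: 'n::finite cpoly set)"
  (is "?L = ?R")
proof
  show "?L \<subseteq> ?R"
    by (rule cpoly.span_minimal[OF _ subspace_forms]) (auto intro: homogeneous_single)
  show "?R \<subseteq> ?L"
  proof
    fix p
    assume p: "p \<in> ?R"
    have "(\<Sum>m\<in>Poly_Mapping.keys p. Poly_Mapping.single m (Poly_Mapping.lookup p m)) \<in> ?L"
    proof (rule cpoly.span_sum)
      fix m assume "m \<in> Poly_Mapping.keys p"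
      then have "Poly_Mapping.single m 1 \<in> (\<lambda>m. Poly_Mapping.single m (1::complex)) ` {m. mdeg m = d}"
        using p by (auto simp: homogeneous_def)
      from cpoly.span_scale[OF cpoly.span_base[OF this], of "Poly_Mapping.lookup p m"]
      show "Poly_Mapping.single m (Poly_Mapping.lookup p m) \<in> ?L"
        by (simp add: poly_scale_def mult_single)
    qed
    then show "p \<in> ?L"
      by (simp add: sum_single_lookup)
  qed
qed

lemma independent_monomials: "cpoly.independent ((\<lambda>m. Poly_Mapping.single m 1) ` M)"
  unfolding cpoly.independent_explicit_finite_subsets
proof (intro allI impI ballI)
  fix S u and v :: "'a cpoly"
  assume S: "S \<subseteq> (\<lambda>m. Poly_Mapping.single m 1) ` M" "finite S"
    and z: "(\<Sum>v\<in>S. poly_scale (u v) v) = 0" and v: "v \<in> S"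
  obtain m where m: "v = Poly_Mapping.single m 1" using S v by auto
  have "0 = (\<Sum>w\<in>S. u w * Poly_Mapping.lookup w m)"
    using arg_cong[OF z, of "\<lambda>p. Poly_Mapping.lookup p m"] by (simp add: lookup_sum lookup_poly_scale)
  also have "\<dots> = (\<Sum>w\<in>S. if w = v then u v else 0)"
  proof (intro sum.cong refl)
    fix w assume "w \<in> S"
    then obtain n where "w = Poly_Mapping.single n 1" using S(1) by auto
    then show "u w * Poly_Mapping.lookup w m = (if w = v then u v else 0)"
      unfolding m by (cases "n = m") (auto simp: lookup_single dest: arg_cong[where f = "\<lambda>p. Poly_Mapping.lookup p m"])
  qed
  also have "\<dots> = u v" using S(2) v by simp
  finally show "u v = 0" by simp
qed

lemma finite_monomials: "finite {m :: 'n::finite \<Rightarrow>\<^sub>0 nat. mdeg m = d}"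
proof -
  have "finite {f. \<forall>i. (i \<in> UNIV \<longrightarrow> f i \<in> {..d}) \<and> (i \<notin> (UNIV :: 'n set) \<longrightarrow> f i = 0)}"
    by (rule finite_set_of_finite_funs) auto
  moreover have "Poly_Mapping.lookup ` {m :: 'n \<Rightarrow>\<^sub>0 nat. mdeg m = d} \<subseteq>
      {f. \<forall>i. (i \<in> UNIV \<longrightarrow> f i \<in> {..d}) \<and> (i \<notin> (UNIV :: 'n set) \<longrightarrow> f i = 0)}"
    by (auto intro: member_le_sum)
  ultimately have "finite (Poly_Mapping.lookup ` {m :: 'n \<Rightarrow>\<^sub>0 nat. mdeg m = d})"
    by (rule finite_subset[rotated])
  then show ?thesis
    by (rule finite_imageD) (simp add: inj_on_def poly_mapping_eqI)
qed

lemma fin_dim_forms: "cpoly.fin_dim (forms d)"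
  unfolding span_monomials[symmetric]
  by (intro cpoly.fin_dim_span cpoly.fin_dim_finite) (simp add: finite_monomials)

lemma dim_forms_card: "cpoly.dim (forms d :: 'n::finite cpoly set) = card {m :: 'n \<Rightarrow>\<^sub>0 nat. mdeg m = d}"
proof -
  have "cpoly.dim (forms d :: 'n cpoly set) = card ((\<lambda>m :: 'n \<Rightarrow>\<^sub>0 nat. Poly_Mapping.single m (1::complex)) ` {m. mdeg m = d})"
    unfolding span_monomials[symmetric]
    by (rule cpoly.dim_span_eq_card_independent[OF independent_monomials])
  also have "\<dots> = card {m :: 'n \<Rightarrow>\<^sub>0 nat. mdeg m = d}"
  proof (rule card_image, rule inj_onI)
    fix m n :: "'n \<Rightarrow>\<^sub>0 nat"
    assume "Poly_Mapping.single m (1::complex) = Poly_Mapping.single n 1"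
    then have "Poly_Mapping.keys (Poly_Mapping.single m (1::complex)) = Poly_Mapping.keys (Poly_Mapping.single n (1::complex))"
      by simp
    then show "m = n" by simp
  qed
  finally show ?thesis .
qed

text \<open>Stars and bars: monomials of degree \<open>d\<close> are lists of four exponents with
  sum \<open>d\<close>.\<close>

lemma dim_forms: "cpoly.dim (forms d :: 4 cpoly set) = (d + 3) choose 3"
proof -
  have "bij_betw (\<lambda>m. map (Poly_Mapping.lookup m) [1,2,3,4]) {m :: 4 \<Rightarrow>\<^sub>0 nat. mdeg m = d}
    {l::nat list. length l = 4 \<and> sum_list l = d}"
  proof (rule bij_betwI')
    fix m n :: "4 \<Rightarrow>\<^sub>0 nat"
    show "(map (Poly_Mapping.lookup m) [1,2,3,4] = map (Poly_Mapping.lookup n) [1,2,3,4]) = (m = n)"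
      by (auto intro!: poly_mapping_eqI) (metis exhaust_4)
  next
    fix m :: "4 \<Rightarrow>\<^sub>0 nat"
    assume "m \<in> {m. mdeg m = d}"
    then show "map (Poly_Mapping.lookup m) [1,2,3,4] \<in> {l. length l = 4 \<and> sum_list l = d}"
      by (simp add: sum_4)
  next
    fix l :: "nat list"
    assume "l \<in> {l. length l = 4 \<and> sum_list l = d}"
    then obtain a b c e where l: "l = [a,b,c,e]" "a + b + c + e = d"
      by (auto simp: numeral_eq_Suc length_Suc_conv)
    define m :: "4 \<Rightarrow>\<^sub>0 nat" where "m = Poly_Mapping.single 1 a + Poly_Mapping.single 2 b
      + Poly_Mapping.single 3 c + Poly_Mapping.single 4 e"
    have "Poly_Mapping.lookup m 1 = a" "Poly_Mapping.lookup m 2 = b" "Poly_Mapping.lookup m 3 = c"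
      "Poly_Mapping.lookup m 4 = e"
      by (simp_all add: m_def lookup_add lookup_single when_def)
    then show "\<exists>m\<in>{m :: 4 \<Rightarrow>\<^sub>0 nat. mdeg m = d}. l = map (Poly_Mapping.lookup m) [1,2,3,4]"
      using l by (intro bexI[of _ m]) (simp_all add: sum_4)
  qed
  from bij_betw_same_card[OF this] show ?thesis
    unfolding dim_forms_card card_length_sum_list
    using binomial_symmetric[of d "d + 3"] by (simp add: numeral_eq_Suc)
qed

text \<open>Each monomial of positive degree is divisible by a variable. This drives the inductions
  on the degree of forms.\<close>

lemma forms_Suc:
  assumes "homogeneous (Suc d) p"
  shows "\<exists>q. (\<forall>i. homogeneous d (q i)) \<and> p = (\<Sum>i\<in>UNIV. Var i * q i)"
proof -
  let ?S = "{p :: 'a cpoly. \<exists>q. (\<forall>i. homogeneous d (q i)) \<and> p = (\<Sum>i\<in>UNIV. Var i * q i)}"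
  have S: "cpoly.subspace ?S"
  proof (rule cpoly.subspaceI)
    show "0 \<in> ?S" by (auto intro!: exI[of _ "\<lambda>_. 0"])
  next
    fix x y assume "x \<in> ?S" "y \<in> ?S"
    then obtain q r where "\<forall>i. homogeneous d (q i)" "x = (\<Sum>i\<in>UNIV. Var i * q i)"
      "\<forall>i. homogeneous d (r i)" "y = (\<Sum>i\<in>UNIV. Var i * r i)" by auto
    then show "x + y \<in> ?S"
      by (auto intro!: exI[of _ "\<lambda>i. q i + r i"] homogeneous_add simp: distrib_left sum.distrib)
  next
    fix c x assume "x \<in> ?S"
    then obtain q where "\<forall>i. homogeneous d (q i)" "x = (\<Sum>i\<in>UNIV. Var i * q i)" by auto
    then show "poly_scale c x \<in> ?S"
      by (auto intro!: exI[of _ "\<lambda>i. poly_scale c (q i)"] homogeneous_scale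
          simp: cpoly.scale_sum_right mult_poly_scale)
  qed
  have "Poly_Mapping.single m 1 \<in> ?S" if m: "mdeg m = Suc d" for m :: "'a \<Rightarrow>\<^sub>0 nat"
  proof -
    have "\<exists>i. Poly_Mapping.lookup m i \<noteq> 0"
    proof (rule ccontr)
      assume "\<not> ?thesis"
      then have "mdeg m = 0" by simp
      then show False using m by simp
    qed
    then obtain i where i: "Poly_Mapping.lookup m i \<noteq> 0" by blast
    define n where "n = m - Poly_Mapping.single i 1"
    have mn: "m = Poly_Mapping.single i 1 + n"
      using i by (intro poly_mapping_eqI) (auto simp: n_def lookup_add lookup_minus lookup_single when_def)
    then have "mdeg n = d" using m mdeg_add[of "Poly_Mapping.single i 1" n] by (simp add: mdeg_single)
    then have "homogeneous d (Poly_Mapping.single n 1)" by (rule homogeneous_single)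
    moreover have "(\<Sum>j\<in>UNIV. Var j * (if j = i then Poly_Mapping.single n 1 else 0)) = Poly_Mapping.single m (1::complex)"
      by (simp add: if_distrib[of "\<lambda>x. _ * x"] mult_single mn Var_def cong: if_cong del: One_nat_def)
    ultimately show ?thesis
      by (auto intro!: exI[of _ "\<lambda>j. if j = i then Poly_Mapping.single n 1 else 0"])
  qed
  then have "forms (Suc d) \<subseteq> ?S"
    unfolding span_monomials[symmetric] by (intro cpoly.span_minimal[OF _ S]) auto
  then show ?thesis using assms by auto
qed

section \<open>Homogeneous coordinates and forms that separate points\<close>

lemma reflp_proportional: "proportional v v \<longleftrightarrow> v \<noteq> 0"
  unfolding proportional_def by (auto intro: exI[of _ 1])

lemma rep_proj_nonzero: "rep_proj x \<noteq> 0"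
  using Quotient_rep_reflp[OF Quotient_proj, of x] by (simp add: reflp_proportional)

lemma abs_rep_proj: "abs_proj (rep_proj x) = x"
  using Quotient_abs_rep[OF Quotient_proj] .

lemma abs_proj_eq_iff: "v \<noteq> 0 \<Longrightarrow> w \<noteq> 0 \<Longrightarrow> abs_proj v = abs_proj w \<longleftrightarrow> proportional v w"
  using Quotient_rel[OF Quotient_proj, of v w] by (simp add: reflp_proportional)

lemma vanishes_at_iff:
  assumes "homogeneous d p"
  shows "vanishes_at p x \<longleftrightarrow> poly_eval p (rep_proj x) = 0"
proof
  assume "vanishes_at p x"
  then show "poly_eval p (rep_proj x) = 0"
    unfolding vanishes_at_def using rep_proj_nonzero abs_rep_proj by blast
next
  assume z: "poly_eval p (rep_proj x) = 0"
  show "vanishes_at p x"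
    unfolding vanishes_at_def
  proof (intro allI impI)
    fix v assume v: "v \<noteq> 0 \<and> abs_proj v = x"
    then have "proportional (rep_proj x) v"
      using abs_proj_eq_iff[of "rep_proj x" v] rep_proj_nonzero abs_rep_proj by metis
    then obtain c where "v = c *s rep_proj x" unfolding proportional_def by auto
    then show "poly_eval p v = 0" using poly_eval_scale_vec[OF assms] z by simp
  qed
qed

lemma forms_through_iff:
  "p \<in> forms_through d Z \<longleftrightarrow> homogeneous d p \<and> (\<forall>x\<in>Z. poly_eval p (rep_proj x) = 0)"
  unfolding forms_through_def using vanishes_at_iff by blast

text \<open>Nonproportional coordinate vectors have a nonzero 2 by 2 minor; replacing the
  coordinates of \<open>x\<close> in it by variables gives the form.\<close>

lemma separating_linear_form:
  assumes "x \<noteq> y"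
  shows "\<exists>l. homogeneous 1 l \<and> poly_eval l (rep_proj y) = 0 \<and> poly_eval l (rep_proj x) \<noteq> 0"
proof -
  let ?v = "rep_proj x" and ?w = "rep_proj y"
  have "\<exists>i j. ?w $ j * ?v $ i \<noteq> ?w $ i * ?v $ j"
  proof (rule ccontr)
    assume "\<not> ?thesis"
    then have eq: "?w $ j * ?v $ i = ?w $ i * ?v $ j" for i j by blast
    obtain j where j: "?w $ j \<noteq> 0" using rep_proj_nonzero[of y] by (auto simp: vec_eq_iff)
    define c where "c = ?v $ j / ?w $ j"
    have "?v = c *s ?w"
      using eq[of j] j by (auto simp: vec_eq_iff c_def field_simps)
    moreover from this have "c \<noteq> 0" using rep_proj_nonzero[of x] by auto
    ultimately have "proportional ?w ?v"
      unfolding proportional_def using rep_proj_nonzero by auto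
    then have "y = x"
      using abs_proj_eq_iff[of ?w ?v] rep_proj_nonzero abs_rep_proj by metis
    then show False using assms by simp
  qed
  then obtain i j where ij: "?w $ j * ?v $ i \<noteq> ?w $ i * ?v $ j" by blast
  let ?l = "poly_scale (?w $ j) (Var i) - poly_scale (?w $ i) (Var j)"
  have "homogeneous 1 ?l"
    by (intro homogeneous_diff homogeneous_scale homogeneous_Var)
  moreover have "poly_eval ?l ?w = 0" "poly_eval ?l ?v \<noteq> 0"
    using ij by simp_all
  ultimately show ?thesis by blast
qed

text \<open>A product of linear forms, one for each point of \<open>Z\<close>, padded to degree
  \<open>d\<close> with a power of a variable that is nonzero at \<open>x\<close>.\<close>

lemma separating_form:
  assumes "finite Z" "x \<notin> Z" "card Z \<le> d"
  shows "\<exists>p. p \<in> forms_through d Z \<and> poly_eval p (rep_proj x) \<noteq> 0"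
  using assms
proof (induction Z arbitrary: d rule: finite_induct)
  case empty
  obtain i where i: "rep_proj x $ i \<noteq> 0" using rep_proj_nonzero[of x] by (auto simp: vec_eq_iff)
  show ?case
    using i homogeneous_power1[OF homogeneous_Var, of d i]
    by (intro exI[of _ "Var i ^ d"]) (simp add: forms_through_iff)
next
  case (insert y Z)
  then obtain e where d: "d = Suc e" by (cases d) auto
  obtain p where p: "p \<in> forms_through e Z" "poly_eval p (rep_proj x) \<noteq> 0"
    using insert.IH[of e] insert.prems insert.hyps d by auto
  obtain l where l: "homogeneous 1 l" "poly_eval l (rep_proj y) = 0" "poly_eval l (rep_proj x) \<noteq> 0"
    using separating_linear_form[of x y] insert.prems by auto
  have "homogeneous (e + 1) (p * l)"
    using p l homogeneous_mult forms_through_iff by blast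
  then show ?case
    using p l d by (intro exI[of _ "p * l"]) (auto simp: forms_through_iff)
qed

section \<open>Graded ideals and Hilbert functions\<close>

text \<open>A homogeneous ideal is encoded as the family of its graded pieces. These are
  finite-dimensional, so an inclusion of ideals becomes an equality in a given degree as soon as the
  dimensions agree there.\<close>

definition graded_ideal :: "(nat \<Rightarrow> 'n::finite cpoly set) \<Rightarrow> bool" where
  "graded_ideal J \<longleftrightarrow> (\<forall>d. cpoly.subspace (J d) \<and> J d \<subseteq> forms d) \<and>
     (\<forall>d e a p. p \<in> J d \<longrightarrow> homogeneous e a \<longrightarrow> a * p \<in> J (d + e))"

definition hf :: "(nat \<Rightarrow> 'n::finite cpoly set) \<Rightarrow> nat \<Rightarrow> nat" where
  "hf J d = cpoly.dim (forms d :: 'n cpoly set) - cpoly.dim (J d)"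

text \<open>For \<open>d < e\<close> the truncated difference \<open>d - e\<close> is 0, and a
  constant \<open>r\<close> would slip in; the disjunction prevents this.\<close>

definition adjoin :: "(nat \<Rightarrow> 'n::finite cpoly set) \<Rightarrow> nat \<Rightarrow> 'n cpoly \<Rightarrow> nat \<Rightarrow> 'n cpoly set" where
  "adjoin J e p d = {j + r * p |j r. j \<in> J d \<and> homogeneous (d - e) r \<and> (e \<le> d \<or> r = 0)}"

definition colon :: "(nat \<Rightarrow> 'n::finite cpoly set) \<Rightarrow> nat \<Rightarrow> 'n cpoly \<Rightarrow> nat \<Rightarrow> 'n cpoly set" where
  "colon J e p d = {a. homogeneous d a \<and> a * p \<in> J (d + e)}"

definition nonzerodivisor :: "(nat \<Rightarrow> 'n::finite cpoly set) \<Rightarrow> nat \<Rightarrow> 'n cpoly \<Rightarrow> bool" where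
  "nonzerodivisor J e p \<longleftrightarrow> (\<forall>d. colon J e p d \<subseteq> J d)"

lemma adjoinI:
  "j \<in> J d \<Longrightarrow> homogeneous (d - e) r \<Longrightarrow> e \<le> d \<or> r = 0 \<Longrightarrow> x = j + r * p \<Longrightarrow> x \<in> adjoin J e p d"
  unfolding adjoin_def by blast

lemma adjoinE:
  assumes "x \<in> adjoin J e p d"
  obtains j r where "x = j + r * p" "j \<in> J d" "homogeneous (d - e) r" "e \<le> d \<or> r = 0"
  using assms unfolding adjoin_def by blast

lemma graded_idealI:
  assumes "\<And>d. cpoly.subspace (J d)" "\<And>d p. p \<in> J d \<Longrightarrow> homogeneous d p"
    and "\<And>d e a p. p \<in> J d \<Longrightarrow> homogeneous e a \<Longrightarrow> a * p \<in> J (d + e)"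
  shows "graded_ideal J"
  using assms unfolding graded_ideal_def by auto

context
  fixes J :: "nat \<Rightarrow> 'n::finite cpoly set"
  assumes J: "graded_ideal J"
begin

lemma gi_subspace: "cpoly.subspace (J d)"
  using J unfolding graded_ideal_def by blast

lemma gi_homogeneous: "p \<in> J d \<Longrightarrow> homogeneous d p"
  using J unfolding graded_ideal_def by blast

lemma gi_forms: "J d \<subseteq> forms d"
  by (auto dest: gi_homogeneous)

lemma gi_mult: "p \<in> J d \<Longrightarrow> homogeneous e a \<Longrightarrow> a * p \<in> J (d + e)"
  using J unfolding graded_ideal_def by blast

lemma gi_mult': "p \<in> J d \<Longrightarrow> homogeneous e a \<Longrightarrow> p * a \<in> J (d + e)"
  by (subst mult.commute) (rule gi_mult)

lemma gi_zero: "0 \<in> J d"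
  using cpoly.subspace_0[OF gi_subspace] .

lemma gi_add: "p \<in> J d \<Longrightarrow> q \<in> J d \<Longrightarrow> p + q \<in> J d"
  using cpoly.subspace_add[OF gi_subspace] .

lemma gi_diff: "p \<in> J d \<Longrightarrow> q \<in> J d \<Longrightarrow> p - q \<in> J d"
  using cpoly.subspace_diff[OF gi_subspace] .

lemma gi_scale: "p \<in> J d \<Longrightarrow> poly_scale c p \<in> J d"
  using cpoly.subspace_scale[OF gi_subspace] .

lemma gi_scale_iff: "c \<noteq> 0 \<Longrightarrow> poly_scale c p \<in> J d \<longleftrightarrow> p \<in> J d"
  using gi_scale[of p d c] gi_scale[of "poly_scale c p" d "inverse c"] by auto

lemma gi_sum: "(\<And>i. i \<in> I \<Longrightarrow> f i \<in> J d) \<Longrightarrow> (\<Sum>i\<in>I. f i) \<in> J d"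
  by (rule cpoly.subspace_sum[OF gi_subspace])

lemma gi_fin_dim: "cpoly.fin_dim (J d)"
  by (rule cpoly.fin_dim_subset[OF fin_dim_forms gi_forms])

lemma dim_add_hf: "cpoly.dim (J d) + hf J d = cpoly.dim (forms d :: 'n cpoly set)"
proof -
  have "cpoly.dim (J d) \<le> cpoly.dim (forms d :: 'n cpoly set)"
    by (rule cpoly.fin_dim_dim_mono[OF fin_dim_forms order_trans[OF gi_forms cpoly.span_superset]])
  then show ?thesis by (simp add: hf_def)
qed

lemma hf_eq_0_iff: "hf J d = 0 \<longleftrightarrow> J d = forms d"
proof
  assume "hf J d = 0"
  then show "J d = forms d"
    using dim_add_hf[of d]
    by (intro cpoly.fin_dim_subspace_eq[OF fin_dim_forms gi_subspace gi_forms]) simp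
qed (simp add: hf_def)

lemma relation_modulo_ideal:
  assumes "finite I" "\<And>i. i \<in> I \<Longrightarrow> homogeneous d (u i)" "hf J d < card I"
  shows "\<exists>c. (\<Sum>i\<in>I. poly_scale (c i) (u i)) \<in> J d \<and> (\<exists>i\<in>I. c i \<noteq> 0)"
  using assms dim_add_hf[of d]
  by (intro cpoly.relation_modulo_subspace[OF _ subspace_forms fin_dim_forms gi_subspace gi_forms]) auto

lemma graded_ideal_adjoin:
  assumes p: "homogeneous e p"
  shows "graded_ideal (adjoin J e p)"
proof (rule graded_idealI)
  show "cpoly.subspace (adjoin J e p d)" for d
  proof (rule cpoly.subspaceI)
    show "0 \<in> adjoin J e p d"
      unfolding adjoin_def by (auto intro!: exI[of _ 0] gi_zero)
  next
    fix x y assume "x \<in> adjoin J e p d" "y \<in> adjoin J e p d"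
    then obtain j r k s where "x = j + r * p" "j \<in> J d" "homogeneous (d - e) r" "e \<le> d \<or> r = 0"
      "y = k + s * p" "k \<in> J d" "homogeneous (d - e) s" "e \<le> d \<or> s = 0"
      by (elim adjoinE)
    then show "x + y \<in> adjoin J e p d"
      by (intro adjoinI[of "j + k" _ _ _ "r + s"]) (auto simp: algebra_simps gi_add homogeneous_add)
  next
    fix c x assume "x \<in> adjoin J e p d"
    then obtain j r where "x = j + r * p" "j \<in> J d" "homogeneous (d - e) r" "e \<le> d \<or> r = 0"
      by (rule adjoinE)
    then show "poly_scale c x \<in> adjoin J e p d"
      by (intro adjoinI[of "poly_scale c j" _ _ _ "poly_scale c r"])
        (auto simp: cpoly.scale_right_distrib mult_poly_scale gi_scale homogeneous_scale)
  qed
next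
  fix d q assume "q \<in> adjoin J e p d"
  then obtain j r where jr: "q = j + r * p" "j \<in> J d" "homogeneous (d - e) r" "e \<le> d \<or> r = 0"
    unfolding adjoin_def by blast
  then have "homogeneous d (r * p)" using homogeneous_mult[OF jr(3) p] by auto
  then show "homogeneous d q" using jr gi_homogeneous homogeneous_add by blast
next
  fix d k q and a :: "'n cpoly" assume "q \<in> adjoin J e p d" and a: "homogeneous k a"
  then obtain j r where jr: "q = j + r * p" "j \<in> J d" "homogeneous (d - e) r" "e \<le> d \<or> r = 0"
    unfolding adjoin_def by blast
  have "a * q = a * j + (a * r) * p" using jr(1) by (simp add: algebra_simps)
  moreover have "homogeneous (d + k - e) (a * r)"
    using jr(4) homogeneous_mult[OF a jr(3)] by (auto simp: add.commute)
  moreover have "a * j \<in> J (d + k)" using gi_mult[OF jr(2) a] .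
  moreover have "e \<le> d + k \<or> a * r = 0" using jr(4) by auto
  ultimately show "a * q \<in> adjoin J e p (d + k)"
    unfolding adjoin_def by blast
qed

lemma graded_ideal_colon:
  assumes p: "homogeneous e p"
  shows "graded_ideal (colon J e p)"
proof (rule graded_idealI)
  show "cpoly.subspace (colon J e p d)" for d
    by (rule cpoly.subspaceI)
      (auto simp: colon_def gi_zero homogeneous_add homogeneous_scale gi_add gi_scale mult_poly_scale distrib_right)
next
  fix d k q and a :: "'n cpoly" assume "q \<in> colon J e p d" "homogeneous k a"
  then show "a * q \<in> colon J e p (d + k)"
    using gi_mult[of "q * p" "d + e" k a] homogeneous_mult[of k a d q]
    by (simp add: colon_def ac_simps)
qed (simp add: colon_def)

lemma subset_adjoin: "J d \<subseteq> adjoin J e p d"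
proof
  fix j assume "j \<in> J d"
  then have "j = j + 0 * p \<and> j \<in> J d \<and> homogeneous (d - e) (0 :: 'n cpoly) \<and> (e \<le> d \<or> (0 :: 'n cpoly) = 0)" by simp
  then show "j \<in> adjoin J e p d" unfolding adjoin_def by blast
qed

lemma in_adjoin: "homogeneous k r \<Longrightarrow> r * p \<in> adjoin J e p (k + e)"
  unfolding adjoin_def using gi_zero by force

lemma generator_in_adjoin: "p \<in> adjoin J e p e"
  using in_adjoin[OF homogeneous_one, of p e] by simp

lemma subset_colon: "homogeneous e p \<Longrightarrow> J d \<subseteq> colon J e p d"
  unfolding colon_def using gi_mult' gi_homogeneous by blast

lemma adjoin_low: "d < e \<Longrightarrow> adjoin J e p d = J d"
  using subset_adjoin[of d e p] unfolding adjoin_def by auto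

lemma adjoin_subset:
  assumes "graded_ideal K" "\<And>d. J d \<subseteq> K d" "p \<in> K e"
  shows "adjoin J e p d \<subseteq> K d"
proof
  fix q assume "q \<in> adjoin J e p d"
  then obtain j r where jr: "q = j + r * p" "j \<in> J d" "homogeneous (d - e) r" "e \<le> d \<or> r = 0"
    unfolding adjoin_def by blast
  have "r * p \<in> K d"
    using jr(3,4) assms(1,3) unfolding graded_ideal_def cpoly.subspace_def
    by (metis le_add_diff_inverse mult_zero_left)
  then show "q \<in> K d"
    using jr(1,2) assms(1,2) unfolding graded_ideal_def cpoly.subspace_def by blast
qed

text \<open>The exact sequence 0 -> S/(J : p)(-e) -> S/J -> S/(J, p) -> 0, with S the polynomial
  ring, read in degree \<open>d + e\<close>.\<close>

lemma hf_split:
  assumes p: "homogeneous e p"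
  shows "hf J (d + e) = hf (adjoin J e p) (d + e) + hf (colon J e p) d"
proof -
  interpret L: Vector_Spaces.linear poly_scale poly_scale "\<lambda>a. a * p"
    unfolding Vector_Spaces.linear_iff
    using cpoly.vector_space_axioms by (auto simp: distrib_right mult_poly_scale)
  have "cpoly.dim {w + v * p |w v. w \<in> J (d + e) \<and> v \<in> forms d} + cpoly.dim {v \<in> forms d. v * p \<in> J (d + e)}
      = cpoly.dim (J (d + e)) + cpoly.dim (forms d :: 'n cpoly set)"
    by (rule L.dim_preimage_plus_sum[OF subspace_forms fin_dim_forms gi_subspace gi_fin_dim])
  moreover have "{w + v * p |w v. w \<in> J (d + e) \<and> v \<in> forms d} = adjoin J e p (d + e)"
    unfolding adjoin_def by auto
  moreover have "{v \<in> forms d. v * p \<in> J (d + e)} = colon J e p d"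
    unfolding colon_def by auto
  moreover have "cpoly.dim (adjoin J e p (d + e)) \<le> cpoly.dim (forms (d + e) :: 'n cpoly set)"
    "cpoly.dim (colon J e p d) \<le> cpoly.dim (forms d :: 'n cpoly set)"
    using graded_ideal_adjoin[OF p] graded_ideal_colon[OF p]
    unfolding graded_ideal_def
    by (auto intro!: cpoly.fin_dim_dim_mono[OF fin_dim_forms] order_trans[OF _ cpoly.span_superset])
  ultimately show ?thesis
    using dim_add_hf[of "d + e"] by (simp add: hf_def)
qed

lemma hf_antimono:
  assumes "graded_ideal K" "J d \<subseteq> K d"
  shows "hf K d \<le> hf J d"
proof -
  have "cpoly.fin_dim (K d)" 
    using assms(1) unfolding graded_ideal_def by (meson cpoly.fin_dim_subset fin_dim_forms)
  then have "cpoly.dim (J d) \<le> cpoly.dim (K d)"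
    using assms(2) cpoly.span_superset[of "K d"] by (intro cpoly.fin_dim_dim_mono) auto
  then show ?thesis by (simp add: hf_def)
qed

lemma hf_le_imp_eq:
  assumes K: "graded_ideal K" and "J d \<subseteq> K d" "hf J d \<le> hf K d"
  shows "J d = K d"
proof (rule cpoly.fin_dim_subspace_eq)
  show "cpoly.fin_dim (K d)"
    using K unfolding graded_ideal_def by (meson cpoly.fin_dim_subset fin_dim_forms)
  then have "cpoly.dim (K d) \<le> cpoly.dim (forms d :: 'n cpoly set)"
    using K cpoly.span_superset[of "forms d :: 'n cpoly set"] unfolding graded_ideal_def
    by (intro cpoly.fin_dim_dim_mono[OF fin_dim_forms]) blast
  then show "cpoly.dim (K d) \<le> cpoly.dim (J d)"
    using assms(3) dim_add_hf[of d] by (simp add: hf_def)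
qed (use assms gi_subspace in auto)

lemma hf_adjoin_le:
  assumes p: "homogeneous e p"
  shows "hf J (d + e) \<le> hf (adjoin J e p) (d + e) + hf J d"
  using hf_split[OF p] hf_antimono[OF graded_ideal_colon[OF p] subset_colon[OF p]] by simp

lemma hf_adjoin_nonzerodivisor:
  assumes p: "homogeneous e p" and "nonzerodivisor J e p"
  shows "hf J (d + e) = hf (adjoin J e p) (d + e) + hf J d"
proof -
  have "colon J e p d = J d"
    using assms subset_colon[OF p] unfolding nonzerodivisor_def by blast
  then show ?thesis using hf_split[OF p, of d] by (simp add: hf_def)
qed

text \<open>\<open>J\<close> lies in the colon ideal, and the assumed bound leaves no room for a
  difference in dimension. In this way nonzerodivisors are recognized from Hilbert functions
  alone.\<close>

lemma colon_eq_if_hf: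
  assumes p: "homogeneous e p" and "hf (adjoin J e p) (d + e) + hf J d \<le> hf J (d + e)"
  shows "colon J e p d = J d"
  using hf_le_imp_eq[OF graded_ideal_colon[OF p] subset_colon[OF p], of d] assms(2) hf_split[OF p, of d]
  by simp

end

text \<open>Lets the equations of a line be adjoined before the cubics, which turns a question about
  the curve into one about binary forms.\<close>

lemma adjoin_commute:
  fixes p q :: "'n::finite cpoly"
  shows "adjoin (adjoin J e p) e' q = adjoin (adjoin J e' q) e p"
proof -
  have "adjoin (adjoin J e p) e' q d \<subseteq> adjoin (adjoin J e' q) e p d" for e e' d and p q :: "'n cpoly"
  proof
    fix x assume "x \<in> adjoin (adjoin J e p) e' q d"
    then obtain j r s where jr: "x = j + r * p + s * q" "j \<in> J d" "homogeneous (d - e) r" "e \<le> d \<or> r = 0"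
      "homogeneous (d - e') s" "e' \<le> d \<or> s = 0"
      unfolding adjoin_def by blast
    then have "j + s * q \<in> adjoin J e' q d" unfolding adjoin_def by blast
    moreover have "x = (j + s * q) + r * p" using jr by simp
    ultimately show "x \<in> adjoin (adjoin J e' q) e p d"
      using jr(3,4) unfolding adjoin_def[of "adjoin J e' q"] by blast
  qed
  then show ?thesis by (intro ext subset_antisym) blast+
qed

lemma adjoin_mono: "J d \<subseteq> K d \<Longrightarrow> adjoin J e p d \<subseteq> adjoin K e p d"
  unfolding adjoin_def by blast

abbreviation zero_ideal :: "nat \<Rightarrow> 'n cpoly set" where
  "zero_ideal \<equiv> \<lambda>_. {0}"

lemma graded_ideal_zero: "graded_ideal (zero_ideal :: nat \<Rightarrow> 'n::finite cpoly set)"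
  by (rule graded_idealI) (auto simp: cpoly.subspace_def)

lemma hf_zero_ideal: "hf (zero_ideal :: nat \<Rightarrow> 4 cpoly set) d = (d + 3) choose 3"
proof -
  have "cpoly.dim {0 :: 4 cpoly} = 0"
    using cpoly.dim_le_card[of "{0}" "{}"] by simp
  then show ?thesis by (simp add: hf_def dim_forms)
qed

lemma graded_ideal_forms_through: "graded_ideal (\<lambda>d. forms_through d Z)"
proof (rule graded_idealI)
  show "cpoly.subspace (forms_through d Z)" for d
    by (rule cpoly.subspaceI) (auto simp: forms_through_iff homogeneous_add homogeneous_scale)
  show "homogeneous d p" if "p \<in> forms_through d Z" for d p
    using that by (simp add: forms_through_iff)
  show "a * p \<in> forms_through (d + e) Z" if "p \<in> forms_through d Z" "homogeneous e a" for d e a p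
    using that homogeneous_mult[of e a d p] by (simp add: forms_through_iff add.commute)
qed

section \<open>A Nullstellensatz for graded ideals with small Hilbert function\<close>

definition homogenize :: "'n::finite cpoly \<Rightarrow> 'n cpoly \<Rightarrow> nat \<Rightarrow> complex poly \<Rightarrow> 'n cpoly" where
  "homogenize x l N P = (\<Sum>n\<le>N. poly_scale (poly.coeff P n) (x ^ n * l ^ (N - n)))"

lemma homogenize_add: "homogenize x l N (P + Q) = homogenize x l N P + homogenize x l N Q"
  by (simp add: homogenize_def cpoly.scale_left_distrib sum.distrib)

lemma homogenize_smult: "homogenize x l N (smult c P) = poly_scale c (homogenize x l N P)"
  by (simp add: homogenize_def cpoly.scale_sum_right)

lemma homogenize_pCons_0: "homogenize x l (Suc N) (pCons 0 P) = x * homogenize x l N P"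
  unfolding homogenize_def sum.atMost_Suc_shift sum_distrib_left
  by (auto intro!: sum.cong simp: mult_poly_scale algebra_simps)

text \<open>\<open>homogenize x l N P\<close> is \<open>l ^ N * P (x / l)\<close> without
  denominators, so a larger \<open>N\<close> contributes only powers of \<open>l\<close>.\<close>

lemma homogenize_Suc:
  assumes "Polynomial.degree P \<le> N"
  shows "homogenize x l (Suc N) P = l * homogenize x l N P"
  unfolding homogenize_def sum_distrib_left
  using assms by (auto intro!: sum.cong simp: mult_poly_scale coeff_eq_0 Suc_diff_le algebra_simps)

lemma homogenize_power_mult:
  assumes "Polynomial.degree P \<le> N"
  shows "homogenize x l (N + k) P = l ^ k * homogenize x l N P"
  using assms by (induction k) (simp_all add: homogenize_Suc mult.assoc)

lemma homogenize_linear_factor: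
  assumes "Polynomial.degree P \<le> N"
  shows "homogenize x l (Suc N) ([:- a, 1:] * P) = (x - poly_scale a l) * homogenize x l N P"
proof -
  have "[:- a, 1:] * P = smult (- a) P + pCons 0 P" by simp
  then show ?thesis
    by (simp add: homogenize_add homogenize_smult homogenize_pCons_0 homogenize_Suc assms
        mult_poly_scale left_diff_distrib del: smult_minus_left)
qed

text \<open>\<open>P\<close> has a root \<open>a\<close> unless it is constant. Modulo
  \<open>J\<close> some \<open>l ^ k\<close> is a multiple of \<open>x - a l\<close>, so multiplying
  the homogenized cofactor by \<open>l ^ k\<close> lands in \<open>J\<close>: a root is traded for a
  power of \<open>l\<close>.\<close>

lemma homogenize_in_ideal:
  assumes J: "graded_ideal J" and l: "homogeneous 1 l" and x: "homogeneous 1 x"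
    and all: "\<And>c. \<exists>k. l ^ k \<in> adjoin J 1 (x - poly_scale c l) k"
  shows "P \<noteq> 0 \<Longrightarrow> Polynomial.degree P \<le> N \<Longrightarrow> homogenize x l N P \<in> J N \<Longrightarrow> \<exists>k. l ^ k \<in> J k"
proof (induction "Polynomial.degree P" arbitrary: P N)
  case 0
  then obtain c where c: "P = [:c:]" "c \<noteq> 0" by (metis degree_eq_zeroE pCons_0_0)
  have "homogenize x l N P = poly_scale c (l ^ N)"
    using homogenize_power_mult[of P 0 x l N] by (simp add: c homogenize_def mult_poly_scale)
  then show ?case using 0 c gi_scale_iff[OF J] by metis
next
  case (Suc m)
  then have "\<not> constant (poly P)" by (simp add: constant_degree)
  then obtain a where "poly P a = 0" using fundamental_theorem_of_algebra by blast
  then obtain Q where Q: "P = [:- a, 1:] * Q" unfolding poly_eq_0_iff_dvd by blast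
  then have Q0: "Q \<noteq> 0" using Suc.prems by auto
  then have deg: "Polynomial.degree P = Suc (Polynomial.degree Q)" using Q degree_mult_eq[of "[:- a, 1:]" Q] by simp
  then obtain M where N: "N = Suc M" using Suc.prems by (cases N) auto
  have dM: "Polynomial.degree Q \<le> M" using Suc.prems deg N by simp
  obtain k j r where k: "l ^ k = j + r * (x - poly_scale a l)" "j \<in> J k" "homogeneous (k - 1) r"
    "1 \<le> k \<or> r = 0"
    using all[of a] unfolding adjoin_def by blast
  have hom: "homogeneous M (homogenize x l M Q)"
    unfolding homogenize_def
    using homogeneous_mult[OF homogeneous_power1[OF x] homogeneous_power1[OF l]]
    by (auto intro!: homogeneous_sum homogeneous_scale) (metis le_add_diff_inverse)
  have "homogenize x l (M + k) Q = l ^ k * homogenize x l M Q"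
    using dM by (rule homogenize_power_mult)
  also have "\<dots> = homogenize x l M Q * j + r * homogenize x l N P"
    unfolding k(1) N Q homogenize_linear_factor[OF dM] by (simp add: algebra_simps)
  also have "\<dots> \<in> J (M + k)"
  proof (rule gi_add[OF J])
    show "homogenize x l M Q * j \<in> J (M + k)"
      using gi_mult[OF J k(2) hom] by (simp add: add.commute)
    show "r * homogenize x l N P \<in> J (M + k)"
      using k(3,4) gi_mult[OF J Suc.prems(3), of "k - 1" r] gi_zero[OF J] N by auto
  qed
  finally show ?case
    using Suc.hyps(1)[of Q "M + k"] Suc.hyps(2) deg Q0 dM by simp
qed

text \<open>The \<open>N + 1\<close> monomials of degree \<open>N\<close> in \<open>x\<close> and
  \<open>l\<close> are dependent modulo \<open>J\<close>. If every ratio \<open>c\<close> of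
  \<open>x\<close> to \<open>l\<close> were excluded, all roots of the resulting polynomial could be
  divided out, leaving a power of \<open>l\<close> in \<open>J\<close>.\<close>

lemma exists_point_step:
  assumes J: "graded_ideal J" and l: "homogeneous 1 l" and x: "homogeneous 1 x"
    and proper: "\<And>k. l ^ k \<notin> J k" and "hf J N \<le> N"
  shows "\<exists>c. \<forall>k. l ^ k \<notin> adjoin J 1 (x - poly_scale c l) k"
proof (rule ccontr)
  assume "\<not> ?thesis"
  then have all: "\<And>c. \<exists>k. l ^ k \<in> adjoin J 1 (x - poly_scale c l) k" by blast
  have "\<exists>c. (\<Sum>i\<in>{..N}. poly_scale (c i) (x ^ i * l ^ (N - i))) \<in> J N \<and> (\<exists>i\<in>{..N}. c i \<noteq> 0)"
  proof (rule relation_modulo_ideal[OF J])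
    show "homogeneous N (x ^ i * l ^ (N - i))" if "i \<in> {..N}" for i
      using homogeneous_mult[OF homogeneous_power1[OF x, of i] homogeneous_power1[OF l, of "N - i"]] that by simp
  qed (use assms in auto)
  then obtain c i where c: "(\<Sum>i\<le>N. poly_scale (c i) (x ^ i * l ^ (N - i))) \<in> J N" "i \<le> N" "c i \<noteq> 0"
    by auto
  define P where "P = (\<Sum>i\<le>N. Polynomial.monom (c i) i)"
  have coeff: "poly.coeff P n = (if n \<le> N then c n else 0)" for n
    by (simp add: P_def coeff_sum)
  have "Polynomial.degree P \<le> N" by (rule degree_le) (simp add: coeff)
  moreover have "P \<noteq> 0" using c coeff by (metis coeff_0)
  moreover have "homogenize x l N P \<in> J N" using c(1) by (simp add: homogenize_def coeff)
  ultimately show False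
    using homogenize_in_ideal[OF J l x all] proper by blast
qed

text \<open>The ratio of each variable to \<open>l\<close> is fixed in turn without absorbing a
  power of \<open>l\<close>; the ratios are the coordinates of a zero on \<open>l = 1\<close>. The
  bound in the single degree \<open>N\<close> stands in for finiteness of the zero set and persists
  when the ideal grows.\<close>

lemma exists_common_zero:
  fixes J :: "nat \<Rightarrow> 'n::finite cpoly set"
  assumes J: "graded_ideal J" and l: "homogeneous 1 l"
    and proper: "\<And>k. l ^ k \<notin> J k" and N: "hf J N \<le> N"
  shows "\<exists>v. poly_eval l v = 1 \<and> (\<forall>d. \<forall>p\<in>J d. poly_eval p v = 0)"
proof -
  have "\<exists>K. graded_ideal K \<and> (\<forall>d. J d \<subseteq> K d) \<and> (\<forall>k. l ^ k \<notin> K k) \<and>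
      (\<forall>i\<in>S. \<exists>c. Var i - poly_scale c l \<in> K 1)" if "finite S" for S :: "'n set"
    using that
  proof (induction S)
    case empty
    then show ?case using J proper by blast
  next
    case (insert i S)
    then obtain K where K: "graded_ideal K" "\<forall>d. J d \<subseteq> K d" "\<forall>k. l ^ k \<notin> K k"
      "\<forall>i\<in>S. \<exists>c. Var i - poly_scale c l \<in> K 1" by blast
    have "hf K N \<le> N" using hf_antimono[OF J K(1)] K(2) N by (meson order_trans)
    then obtain c where c: "\<forall>k. l ^ k \<notin> adjoin K 1 (Var i - poly_scale c l) k"
      using exists_point_step[OF K(1) l homogeneous_Var] K(3) by blast
    let ?K = "adjoin K 1 (Var i - poly_scale c l)"
    have h: "homogeneous 1 (Var i - poly_scale c l)"
      by (intro homogeneous_diff homogeneous_Var homogeneous_scale l)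
    show ?case
    proof (intro exI[of _ ?K] conjI)
      show "graded_ideal ?K" by (rule graded_ideal_adjoin[OF K(1) h])
      show "\<forall>d. J d \<subseteq> ?K d" using K(2) subset_adjoin[OF K(1)] by blast
      show "\<forall>j\<in>insert i S. \<exists>c. Var j - poly_scale c l \<in> ?K 1"
        using K(4) subset_adjoin[OF K(1)] generator_in_adjoin[OF K(1)] by blast
    qed (rule c)
  qed
  from this[of UNIV] obtain K a where K: "graded_ideal K" "\<And>d. J d \<subseteq> K d" "\<And>k. l ^ k \<notin> K k"
    and a: "\<And>i. Var i - poly_scale (a i) l \<in> K 1" by (auto simp: choice_iff)
  define v where "v = (\<chi> i. a i)"
  \<comment> \<open>Modulo \<open>K\<close> every variable is a multiple of \<open>l\<close>, so a
    form of degree \<open>d\<close> reduces to its value at \<open>v\<close> times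
    \<open>l ^ d\<close>.\<close>
  have red: "p - poly_scale (poly_eval p v) (l ^ d) \<in> K d" if "homogeneous d p" for p d
    using that
  proof (induction d arbitrary: p)
    case 0
    define c where "c = Poly_Mapping.lookup p 0"
    have "p = Poly_Mapping.single 0 c" unfolding c_def by (rule homogeneous_0_const[OF 0])
    then show ?case using gi_zero[OF K(1)] by (simp add: poly_scale_def)
  next
    case (Suc d)
    then obtain q where q: "\<And>i. homogeneous d (q i)" "p = (\<Sum>i\<in>UNIV. Var i * q i)"
      using forms_Suc by blast
    have "p - poly_scale (poly_eval p v) (l ^ Suc d) =
      (\<Sum>i\<in>UNIV. Var i * (q i - poly_scale (poly_eval (q i) v) (l ^ d)) +
        poly_scale (poly_eval (q i) v) ((Var i - poly_scale (a i) l) * l ^ d))"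
      unfolding q(2) poly_eval_sum cpoly.scale_sum_left sum_subtractf[symmetric]
      by (intro sum.cong refl)
        (simp add: v_def mult_poly_scale algebra_simps cpoly.scale_right_diff_distrib)
    also have "\<dots> \<in> K (Suc d)"
    proof (intro gi_sum[OF K(1)] gi_add[OF K(1)] gi_scale[OF K(1)])
      fix i
      show "Var i * (q i - poly_scale (poly_eval (q i) v) (l ^ d)) \<in> K (Suc d)"
        using gi_mult[OF K(1) Suc.IH[OF q(1)] homogeneous_Var] by simp
      show "(Var i - poly_scale (a i) l) * l ^ d \<in> K (Suc d)"
        using gi_mult'[OF K(1) a homogeneous_power1[OF l]] by simp
    qed
    finally show ?case .
  qed
  \<comment> \<open>The reduction applied to \<open>l\<close> itself; since \<open>l\<close> is not
    in \<open>K\<close>, the scalar must be 0.\<close>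
  have "poly_scale (1 - poly_eval l v) (l ^ 1) \<in> K 1"
    using red[OF l] by (simp add: cpoly.scale_left_diff_distrib)
  then have "poly_eval l v = 1"
    using gi_scale_iff[OF K(1)] K(3) by (metis right_minus_eq)
  moreover have "poly_eval p v = 0" if p: "p \<in> J d" for p d
  proof (rule ccontr)
    assume nz: "poly_eval p v \<noteq> 0"
    have "p - (p - poly_scale (poly_eval p v) (l ^ d)) \<in> K d"
      using p K(2) red[OF gi_homogeneous[OF J p]] gi_diff[OF K(1)] by blast
    then have "l ^ d \<in> K d" using nz gi_scale_iff[OF K(1)] by simp
    then show False using K(3) by blast
  qed
  ultimately show ?thesis by blast
qed

section \<open>Hilbert functions of the complete intersection of two cubics\<close>

lemma nonzerodivisorD: "nonzerodivisor J e p \<Longrightarrow> homogeneous d a \<Longrightarrow> a * p \<in> J (d + e) \<Longrightarrow> a \<in> J d"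
  unfolding nonzerodivisor_def colon_def by blast

lemma nonzerodivisorI:
  "(\<And>d a. homogeneous d a \<Longrightarrow> a * p \<in> J (d + e) \<Longrightarrow> a \<in> J d) \<Longrightarrow> nonzerodivisor J e p"
  unfolding nonzerodivisor_def colon_def by blast

lemma nonzerodivisor_power:
  assumes "nonzerodivisor J 1 l" and l: "homogeneous 1 l" and "homogeneous d a" "l ^ k * a \<in> J (d + k)"
  shows "a \<in> J d"
  using assms(4)
proof (induction k)
  case (Suc k)
  have "homogeneous (d + k) (l ^ k * a)"
    using homogeneous_mult[OF homogeneous_power1[OF l, of k] assms(3)] by (simp add: add.commute)
  moreover have "(l ^ k * a) * l \<in> J (d + k + 1)" using Suc.prems by (simp add: ac_simps)
  ultimately show ?case using nonzerodivisorD[OF assms(1)] Suc.IH by blast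
qed simp

text \<open>The regular sequence \<open>l, h\<close> on \<open>I\<close> is permuted to
  \<open>h, l\<close>. In the graded setting this is a descent on degrees: if \<open>a * h\<close>
  is in \<open>I\<close>, then \<open>a = j + r * l\<close> with \<open>r * h\<close> again in
  \<open>I\<close> and \<open>r\<close> of smaller degree.\<close>

lemma nonzerodivisor_lift:
  assumes I: "graded_ideal I" and l: "homogeneous 1 l" and h: "homogeneous e h"
    and nl: "nonzerodivisor I 1 l" and nh: "nonzerodivisor (adjoin I 1 l) e h"
  shows "nonzerodivisor I e h" "nonzerodivisor (adjoin I e h) 1 l"
proof -
  have "a \<in> I d" if "homogeneous d a" "a * h \<in> I (d + e)" for d a
    using that
  proof (induction d arbitrary: a)
    case 0
    then have "a \<in> adjoin I 1 l 0" using nonzerodivisorD[OF nh] subset_adjoin[OF I] by blast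
    then show ?case using adjoin_low[OF I, of 0 1] by simp
  next
    case (Suc d)
    then have "a \<in> adjoin I 1 l (Suc d)" using nonzerodivisorD[OF nh] subset_adjoin[OF I] by blast
    then obtain j r where jr: "a = j + r * l" "j \<in> I (Suc d)" "homogeneous (Suc d - 1) r"
      by (rule adjoinE)
    have "j * h \<in> I (Suc d + e)" using gi_mult'[OF I jr(2) h] .
    from gi_diff[OF I Suc.prems(2) this] have "(r * h) * l \<in> I (d + e + 1)"
      by (simp add: jr(1) algebra_simps)
    then have "r * h \<in> I (d + e)"
      using nonzerodivisorD[OF nl] homogeneous_mult[OF _ h, of d r] jr(3) by simp
    then have "r \<in> I d" using Suc.IH jr(3) by simp
    then have "r * l \<in> I (Suc d)" using gi_mult'[OF I _ l] by fastforce
    then show ?case using jr gi_add[OF I] by simp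
  qed
  then show "nonzerodivisor I e h" by (rule nonzerodivisorI)
  show "nonzerodivisor (adjoin I e h) 1 l"
  proof (rule nonzerodivisorI)
    fix d a assume a: "homogeneous d a" "a * l \<in> adjoin I e h (d + 1)"
    obtain j r where jr: "a * l = j + r * h" "j \<in> I (d + 1)" "homogeneous (d + 1 - e) r" "e \<le> d + 1 \<or> r = 0"
      using a(2) by (rule adjoinE)
    show "a \<in> adjoin I e h d"
    proof (cases "r = 0")
      case True
      then have "a \<in> I d" using nonzerodivisorD[OF nl a(1)] jr by simp
      then show ?thesis using subset_adjoin[OF I] by blast
    next
      case False
      then have e: "e \<le> d + 1" using jr by simp
      have "r * h = - j + a * l" using jr by simp
      moreover have "- j \<in> I (d + 1)" using jr(2) gi_diff[OF I gi_zero[OF I]] by fastforce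
      ultimately have "r * h \<in> adjoin I 1 l (d + 1 - e + e)"
        using e a(1) by (intro adjoinI[of "- j" _ _ _ a]) auto
      then have "r \<in> adjoin I 1 l (d + 1 - e)" by (rule nonzerodivisorD[OF nh jr(3)])
      then obtain j' s where s: "r = j' + s * l" "j' \<in> I (d + 1 - e)" "homogeneous (d + 1 - e - 1) s"
        "1 \<le> d + 1 - e \<or> s = 0" by (rule adjoinE)
      have sh: "homogeneous d (s * h)"
        using homogeneous_mult[OF s(3) h] s(4) e by auto
      have "j' * h \<in> I (d + 1)" using gi_mult'[OF I s(2) h] e by simp
      then have "j + j' * h \<in> I (d + 1)" using jr(2) gi_add[OF I] by blast
      moreover have "(a - s * h) * l = j + j' * h" using jr(1) s(1) by (simp add: algebra_simps)
      ultimately have "a - s * h \<in> I d"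
        using nonzerodivisorD[OF nl homogeneous_diff[OF a(1) sh]] by simp
      then show ?thesis
        using s(3,4) by (intro adjoinI[of "a - s * h" _ _ _ s]) (auto simp: diff_diff_add)
    qed
  qed
qed

text \<open>\<open>K\<close> stands for a plane section of the curve, 9 points with multiplicity.
  Without a common zero some power of \<open>l\<close> lies in \<open>(K, h)\<close>, hence so do
  all forms of high degree. There the colon ideal and \<open>K\<close> have the same Hilbert
  function 9, and cancelling powers of \<open>l\<close> settles low degrees.\<close>

lemma nonzerodivisor_if_no_common_zero:
  assumes K: "graded_ideal K" and l: "homogeneous 1 l" and h: "homogeneous e h"
    and nl: "nonzerodivisor K 1 l" and hfK: "\<And>d. 4 \<le> d \<Longrightarrow> hf K d = 9"
    and nz: "\<And>v. poly_eval l v = 1 \<Longrightarrow> (\<And>d p. p \<in> K d \<Longrightarrow> poly_eval p v = 0) \<Longrightarrow> poly_eval h v \<noteq> 0"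
  shows "nonzerodivisor K e h"
proof -
  let ?J = "adjoin K e h"
  have J: "graded_ideal ?J" using graded_ideal_adjoin[OF K h] .
  \<comment> \<open>In degree 9 the Hilbert function 9 no longer exceeds the degree, as
    \<open>exists_common_zero\<close> demands.\<close>
  have "hf ?J 9 \<le> 9" using hf_antimono[OF K J subset_adjoin[OF K], of 9] hfK[of 9] by simp
  have "\<exists>k. l ^ k \<in> ?J k"
  proof (rule ccontr)
    assume "\<not> ?thesis"
    then obtain v where "poly_eval l v = 1" "\<And>d p. p \<in> ?J d \<Longrightarrow> poly_eval p v = 0"
      using exists_common_zero[OF J l _ \<open>hf ?J 9 \<le> 9\<close>] by blast
    then show False using nz[of v] subset_adjoin[OF K] generator_in_adjoin[OF K] by blast
  qed
  then obtain k where k: "l ^ k \<in> ?J k" by blast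
  \<comment> \<open>A constant Hilbert function and a nonzerodivisor \<open>l\<close> leave nothing
    modulo \<open>(K, l)\<close>: from degree 5 on, every form is a multiple of \<open>l\<close>
    modulo \<open>K\<close>.\<close>
  have full: "forms (Suc d) = adjoin K 1 l (Suc d)" if "4 \<le> d" for d
    using hf_adjoin_nonzerodivisor[OF K l nl, of d] hfK[of d] hfK[of "Suc d"] that
      hf_eq_0_iff[OF graded_ideal_adjoin[OF K l]] by simp
  have red: "\<exists>\<kappa> r. \<kappa> \<in> K (4 + i + j) \<and> homogeneous (4 + i) r \<and> p = \<kappa> + r * l ^ j"
    if "homogeneous (4 + i + j) p" for i j p
    using that
  proof (induction j arbitrary: p)
    case 0
    then show ?case using gi_zero[OF K] by (intro exI[of _ 0] exI[of _ p]) simp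
  next
    case (Suc j)
    then have "p \<in> adjoin K 1 l (Suc (4 + i + j))" using full[of "4 + i + j"] by auto
    then obtain \<kappa> s where s: "p = \<kappa> + s * l" "\<kappa> \<in> K (Suc (4 + i + j))" "homogeneous (Suc (4 + i + j) - 1) s"
      by (rule adjoinE)
    then have "homogeneous (4 + i + j) s" by (simp only: diff_Suc_1)
    then obtain \<kappa>' r where r: "\<kappa>' \<in> K (4 + i + j)" "homogeneous (4 + i) r" "s = \<kappa>' + r * l ^ j"
      using Suc.IH[of s] by blast
    have "\<kappa> + \<kappa>' * l \<in> K (4 + i + Suc j)"
      using s(2) gi_mult'[OF K r(1) l] gi_add[OF K] by simp
    then show ?case
      using s r by (intro exI[of _ "\<kappa> + \<kappa>' * l"] exI[of _ r]) (simp add: algebra_simps)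
  qed
  have J0: "hf ?J d = 0" if that0: "4 + k \<le> d" for d
  proof -
    have "p \<in> ?J d" if hp: "homogeneous d p" for p
    proof -
      obtain i where d: "d = 4 + i + k" using that0 by (metis add.assoc add.commute le_Suc_ex)
      then obtain \<kappa> r where r: "\<kappa> \<in> K d" "homogeneous (4 + i) r" "p = \<kappa> + r * l ^ k"
        using red[of i k p] hp by blast
      have "r * l ^ k \<in> ?J d" using gi_mult[OF J k r(2)] d by (simp add: add.commute)
      then show ?thesis using r subset_adjoin[OF K] gi_add[OF J] by blast
    qed
    then show ?thesis using hf_eq_0_iff[OF J] gi_forms[OF J] by blast
  qed
  have big: "colon K e h d = K d" if "4 + k \<le> d" for d
    using that J0[of "d + e"] hfK by (intro colon_eq_if_hf[OF K h]) simp
  show ?thesis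
  proof (rule nonzerodivisorI)
    fix d a assume a: "homogeneous d a" "a * h \<in> K (d + e)"
    have "l ^ (4 + k) * a \<in> colon K e h (d + (4 + k))"
      using homogeneous_mult[OF homogeneous_power1[OF l, of "4 + k"] a(1)]
        gi_mult[OF K a(2) homogeneous_power1[OF l, of "4 + k"]]
      by (simp add: colon_def ac_simps)
    then show "a \<in> K d"
      using big[of "d + (4 + k)"] nonzerodivisor_power[OF nl l a(1)] by auto
  qed
qed

text \<open>All planes \<open>l - c l'\<close> contain the line \<open>l = l' = 0\<close>, so one
  bound on that line serves the whole pencil of planes.\<close>

lemma adjoin_change_generator:
  fixes J :: "nat \<Rightarrow> 'n::finite cpoly set"
  shows "adjoin (adjoin J 1 (l - poly_scale c l')) 1 l' = adjoin (adjoin J 1 l) 1 l'"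
proof -
  have "adjoin (adjoin J 1 (l - poly_scale c l')) 1 l' d \<subseteq> adjoin (adjoin J 1 l) 1 l' d" for c d and l l' :: "'n cpoly"
  proof
    fix x assume "x \<in> adjoin (adjoin J 1 (l - poly_scale c l')) 1 l' d"
    then obtain j r s where jr: "x = j + r * (l - poly_scale c l') + s * l'" "j \<in> J d"
      "homogeneous (d - 1) r" "1 \<le> d \<or> r = 0" "homogeneous (d - 1) s" "1 \<le> d \<or> s = 0"
      by (elim adjoinE) blast
    show "x \<in> adjoin (adjoin J 1 l) 1 l' d"
      using jr by (intro adjoinI[of "j + r * l" _ _ _ "s - poly_scale c r"] adjoinI[of j _ _ _ r])
        (auto intro!: homogeneous_diff homogeneous_scale simp: algebra_simps mult_poly_scale)
  qed
  from this[of l c l'] this[of "l - poly_scale c l'" "- c" l'] show ?thesis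
    by (intro ext subset_antisym) (simp_all add: cpoly.scale_minus_left)
qed

text \<open>The Hilbert function 1, 2, 3, 2, 1 of two coprime binary cubics. \<open>plane_hf\<close>
  and \<open>curve_hf\<close> are its first and second partial sums.\<close>

definition line_hf :: "nat \<Rightarrow> nat" where
  "line_hf d = (if d = 0 then 1 else if d = 1 then 2 else if d = 2 then 3 else if d = 3 then 2 else if d = 4 then 1 else 0)"

definition plane_hf :: "nat \<Rightarrow> nat" where
  "plane_hf d = (if d = 0 then 1 else if d = 1 then 3 else if d = 2 then 6 else if d = 3 then 8 else 9)"

definition curve_hf :: "nat \<Rightarrow> nat" where
  "curve_hf d = (if d = 0 then 1 else if d = 1 then 4 else if d = 2 then 10 else 9 * d - 9)"

lemma hf_le_sum_adjoin:
  assumes "graded_ideal J" "homogeneous 1 l" "\<And>d. hf (adjoin J 1 l) d \<le> a d"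
    and "b 0 = a 0" "\<And>d. b (Suc d) = a (Suc d) + b d"
  shows "hf J d \<le> (b d :: nat)"
proof (induction d)
  case 0
  have "hf J 0 = hf (adjoin J 1 l) 0" using adjoin_low[OF assms(1), of 0 1] by (simp add: hf_def)
  then show ?case using assms(3)[of 0] assms(4) by simp
next
  case (Suc d)
  then show ?case using hf_adjoin_le[OF assms(1,2), of d] assms(3)[of "Suc d"] assms(5)[of d] by simp
qed

lemma six_choose_three: "6 * ((n + 3) choose 3) = (n + 3) * (n + 2) * (n + 1)"
proof (induction n)
  case (Suc n)
  have "2 * ((m + 2) choose 2) = (m + 2) * (m + 1)" for m
    by (induction m) (simp_all add: numeral_eq_Suc)
  from this[of "Suc n"] have "2 * ((n + 3) choose 2) = (n + 3) * (n + 2)" by (simp add: numeral_eq_Suc)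
  moreover have "(Suc n + 3) choose 3 = ((n + 3) choose 2) + ((n + 3) choose 3)"
    by (simp add: numeral_eq_Suc)
  ultimately show ?case using Suc by (simp add: algebra_simps)
qed simp

lemma nonzerodivisor_zero_ideal:
  fixes f :: "4 cpoly"
  shows "f \<noteq> 0 \<Longrightarrow> nonzerodivisor zero_ideal e f"
  by (rule nonzerodivisorI) auto

text \<open>\<open>f\<close> is a nonzerodivisor, and adjoining \<open>g\<close> lowers the Hilbert
  function by at most its shift by 3. This alone yields the value of a complete intersection as a
  lower bound.\<close>

lemma curve_hf_le:
  fixes f g :: "4 cpoly"
  assumes f: "homogeneous 3 f" "f \<noteq> 0" and g: "homogeneous 3 g"
  shows "curve_hf d \<le> hf (adjoin (adjoin zero_ideal 3 f) 3 g) d"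
proof -
  let ?F = "adjoin zero_ideal 3 f" and ?I = "adjoin (adjoin zero_ideal 3 f) 3 g"
  let ?b = "\<lambda>d. (d + 3) choose 3 :: nat"
  have F: "graded_ideal ?F" using graded_ideal_adjoin[OF graded_ideal_zero f(1)] .
  have F3: "hf ?F (d + 3) + ?b d = ?b (d + 3)" for d
    using hf_adjoin_nonzerodivisor[OF graded_ideal_zero f(1) nonzerodivisor_zero_ideal[OF f(2)], of d]
    unfolding hf_zero_ideal by simp
  have Flow: "hf ?F d = ?b d" if "d < 3" for d
    using adjoin_low[OF graded_ideal_zero that, of f] by (simp add: hf_def flip: hf_zero_ideal)
  have I3: "hf ?F (d + 3) \<le> hf ?I (d + 3) + hf ?F d" for d
    using hf_adjoin_le[OF F g] .
  have Ilow: "hf ?I d = ?b d" if "d < 3" for d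
    using adjoin_low[OF F that, of g] Flow[OF that] by (simp add: hf_def)
  have num: "?b 0 = 1" "?b 1 = 4" "?b 2 = 10" "?b 3 = 20" "?b 4 = 35" "?b 5 = 56"
    by (simp_all add: numeral_eq_Suc)
  consider "d = 0" | "d = 1" | "d = 2" | "d = 3" | "d = 4" | "d = 5" | k where "d = k + 3 + 3"
  proof -
    have "d = 0 \<or> d = 1 \<or> d = 2 \<or> d = 3 \<or> d = 4 \<or> d = 5 \<or> d = (d - 6) + 3 + 3" by arith
    then show thesis using that by blast
  qed
  then show ?thesis
  proof cases
    case (7 k)
    have "6 * ?b (k + 3 + 3) = (k + 9) * (8 + k) * (7 + k)" "6 * ?b (k + 3) = (k + 6) * (5 + k) * (4 + k)"
      "6 * ?b k = (k + 3) * (k + 2) * (k + 1)"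
      using six_choose_three[of "k + 3 + 3"] six_choose_three[of "k + 3"] six_choose_three[of k]
      by (simp_all add: add.assoc)
    \<comment> \<open>The second difference with step 3 of the cubic polynomial
      \<open>6 * ?b\<close>; it is 6 times \<open>9 * d - 9\<close> for
      \<open>d = k + 6\<close>.\<close>
    then have "6 * ?b (k + 3 + 3) + 6 * ?b k = 12 * ?b (k + 3) + 54 * (k + 6) - 54"
      by (simp add: algebra_simps)
    moreover have "curve_hf d = 9 * (k + 6) - 9" using 7 by (simp add: curve_hf_def)
    ultimately show ?thesis
      using 7 F3[of "k + 3"] F3[of k] I3[of "k + 3"] by simp
  qed (use Ilow[of 0] Ilow[of 1] Ilow[of 2] I3[of 0] I3[of 1] I3[of 2] F3[of 0] F3[of 1] F3[of 2]
        Flow[of 0] Flow[of 1] Flow[of 2] num in \<open>auto simp: curve_hf_def numeral_eq_Suc\<close>)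
qed

text \<open>Summing \<open>line_hf\<close> bounds from above, \<open>curve_hf_le\<close> bounds from
  below, and the bounds coincide. So every inequality on the way is an equality, and both linear
  forms are nonzerodivisors.\<close>

lemma hilbert_functions_of_curve:
  fixes f g l l' :: "4 cpoly"
  defines "I \<equiv> adjoin (adjoin zero_ideal 3 f) 3 g"
  assumes f: "homogeneous 3 f" "f \<noteq> 0" and g: "homogeneous 3 g"
    and l: "homogeneous 1 l" and l': "homogeneous 1 l'"
    and line_hf: "\<And>d. hf (adjoin (adjoin I 1 l) 1 l') d \<le> line_hf d"
  shows "hf I d = curve_hf d" "hf (adjoin I 1 l) d = plane_hf d"
    "nonzerodivisor I 1 l" "nonzerodivisor (adjoin I 1 l) 1 l'"
proof -
  have I: "graded_ideal I"
    unfolding I_def by (intro graded_ideal_adjoin graded_ideal_zero f g)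
  have Il: "graded_ideal (adjoin I 1 l)" by (rule graded_ideal_adjoin[OF I l])
  have ple: "hf (adjoin I 1 l) d \<le> plane_hf d" for d
    by (rule hf_le_sum_adjoin[OF Il l' line_hf]) (simp_all add: line_hf_def plane_hf_def)
  have cle: "hf I d \<le> curve_hf d" for d
    by (rule hf_le_sum_adjoin[OF I l ple]) (simp_all add: plane_hf_def curve_hf_def)
  have I_eq: "hf I d = curve_hf d" for d
    using cle curve_hf_le[OF f g] by (simp add: I_def le_antisym)
  have Suc_c: "curve_hf (Suc d) = plane_hf (Suc d) + curve_hf d" for d
    by (simp add: plane_hf_def curve_hf_def)
  have Suc_p: "plane_hf (Suc d) = line_hf (Suc d) + plane_hf d" for d
    by (simp add: plane_hf_def line_hf_def)
  have Il_eq: "hf (adjoin I 1 l) d = plane_hf d" for d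
  proof (cases d)
    case 0
    have "hf I 0 = hf (adjoin I 1 l) 0" using adjoin_low[OF I, of 0 1] by (simp add: hf_def)
    then show ?thesis using I_eq[of 0] 0 by (simp add: plane_hf_def curve_hf_def)
  next
    case (Suc k)
    then show ?thesis
      using hf_adjoin_le[OF I l, of k] I_eq[of k] I_eq[of "Suc k"] Suc_c[of k] ple[of "Suc k"] by simp
  qed
  show "hf I d = curve_hf d" "hf (adjoin I 1 l) d = plane_hf d" by fact+
  have "colon I 1 l d = I d" for d
    using Il_eq[of "d + 1"] I_eq[of d] I_eq[of "d + 1"] Suc_c[of d] by (intro colon_eq_if_hf[OF I l]) simp
  then show "nonzerodivisor I 1 l" by (simp add: nonzerodivisor_def)
  have "colon (adjoin I 1 l) 1 l' d = adjoin I 1 l d" for d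
    using line_hf[of "d + 1"] Il_eq[of d] Il_eq[of "d + 1"] Suc_p[of d]
    by (intro colon_eq_if_hf[OF Il l']) simp
  then show "nonzerodivisor (adjoin I 1 l) 1 l'" by (simp add: nonzerodivisor_def)
qed

section \<open>Restriction to a line\<close>

interpretation const_poly: coeff_hom "\<lambda>c::complex. [:c:]"
  by unfold_locales simp_all

lemma homogenize_sum: "homogenize x l N (\<Sum>i\<in>I. F i) = (\<Sum>i\<in>I. homogenize x l N (F i))"
  by (induction I rule: infinite_finite_induct) (simp_all add: homogenize_add, simp_all add: homogenize_def)

lemma linear_form_expand:
  assumes "homogeneous 1 l"
  shows "\<exists>a. l = (\<Sum>i\<in>UNIV. poly_scale (a i) (Var i))"
proof -
  obtain q where q: "\<And>i. homogeneous 0 (q i)" "l = (\<Sum>i\<in>UNIV. Var i * q i)"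
    using forms_Suc[of 0 l] assms by auto
  have "Var i * q i = poly_scale (Poly_Mapping.lookup (q i) 0) (Var i)" for i
    by (subst homogeneous_0_const[OF q(1)[of i]]) (simp add: poly_scale_def mult.commute)
  then show ?thesis using q(2) by auto
qed

lemma linear_form_eval_combination:
  assumes "homogeneous 1 l"
  shows "poly_eval l (s *s v + w) = s * poly_eval l v + poly_eval l w"
  using linear_form_expand[OF assms]
  by (auto simp: poly_eval_sum algebra_simps sum.distrib sum_distrib_left)

text \<open>The line through \<open>P\<close> and \<open>Q\<close> has equations
  \<open>l1 = l2 = 0\<close> and coordinates \<open>x\<close>, \<open>y\<close> dual to
  \<open>P\<close>, \<open>Q\<close>; by \<open>Var_expand\<close> the four forms span all linear
  forms.\<close>

locale line_coordinates =
  fixes P Q :: "complex ^ 4" and x y l1 l2 :: "4 cpoly"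
  assumes linear: "homogeneous 1 x" "homogeneous 1 y" "homogeneous 1 l1" "homogeneous 1 l2"
    and at_P: "poly_eval x P = 1" "poly_eval y P = 0" "poly_eval l1 P = 0" "poly_eval l2 P = 0"
    and at_Q: "poly_eval x Q = 0" "poly_eval y Q = 1" "poly_eval l1 Q = 0" "poly_eval l2 Q = 0"
    and Var_expand: "\<And>i. \<exists>a b. Var i = poly_scale (P $ i) x + poly_scale (Q $ i) y
      + poly_scale a l1 + poly_scale b l2"
begin

text \<open>The parametrization \<open>s P + Q\<close> omits only the point \<open>P\<close> of the
  line, so forms become univariate polynomials, with \<open>y\<close> specialized to 1.\<close>

definition restrict :: "4 cpoly \<Rightarrow> complex poly" where
  "restrict = const_poly.insertion (\<lambda>i. [:Q $ i, P $ i:])"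

definition line_ideal :: "nat \<Rightarrow> 4 cpoly set" where
  "line_ideal = adjoin (adjoin zero_ideal 1 l1) 1 l2"

lemmas restrict_simps =
  const_poly.insertion_zero[of "\<lambda>i. [:Q $ i, P $ i:]", folded restrict_def]
  const_poly.insertion_one[of "\<lambda>i. [:Q $ i, P $ i:]", folded restrict_def]
  const_poly.insertion_add[of "\<lambda>i. [:Q $ i, P $ i:]", folded restrict_def]
  const_poly.insertion_diff[of "\<lambda>i. [:Q $ i, P $ i:]", folded restrict_def]
  const_poly.insertion_mult[of "\<lambda>i. [:Q $ i, P $ i:]", folded restrict_def]
  const_poly.insertion_power[of "\<lambda>i. [:Q $ i, P $ i:]", folded restrict_def]
  const_poly.insertion_sum[of "\<lambda>i. [:Q $ i, P $ i:]", folded restrict_def]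
  const_poly.insertion_scale[of "\<lambda>i. [:Q $ i, P $ i:]", folded restrict_def]

lemma poly_restrict: "poly (restrict p) s = poly_eval p (s *s P + Q)"
  by (simp add: restrict_def const_poly.insertion_def poly_eval_def poly_sum poly_prod add.commute)

lemma restrict_coordinates: "restrict x = [:0, 1:]" "restrict y = 1" "restrict l1 = 0" "restrict l2 = 0"
  by (auto simp: poly_eq_poly_eq_iff[symmetric] fun_eq_iff poly_restrict linear_form_eval_combination linear at_P at_Q
      simp del: One_nat_def)

lemma line_ideal: "graded_ideal line_ideal"
  unfolding line_ideal_def by (intro graded_ideal_adjoin graded_ideal_zero linear)

lemma line_ideal_cases:
  assumes "p \<in> line_ideal d"
  obtains r s where "p = r * l1 + s * l2"
  using assms unfolding line_ideal_def by (elim adjoinE) auto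

lemma restrict_line_ideal: "p \<in> line_ideal d \<Longrightarrow> restrict p = 0"
  by (elim line_ideal_cases) (simp add: restrict_simps restrict_coordinates)

lemma generators_in_line_ideal: "l1 \<in> line_ideal 1" "l2 \<in> line_ideal 1"
  unfolding line_ideal_def using generator_in_adjoin[OF graded_ideal_zero] subset_adjoin[OF graded_ideal_adjoin[OF graded_ideal_zero linear(3)]]
    generator_in_adjoin[OF graded_ideal_adjoin[OF graded_ideal_zero linear(3)]]
  by blast+

lemma homogeneous_homogenize: "homogeneous d (homogenize x y d c)"
proof -
  have "homogeneous d (x ^ i * y ^ (d - i))" if "i \<le> d" for i
    using homogeneous_mult[OF homogeneous_power1[OF linear(1), of i] homogeneous_power1[OF linear(2), of "d - i"]] that
    by simp
  then show ?thesis unfolding homogenize_def by (intro homogeneous_sum homogeneous_scale) auto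
qed

lemma restrict_homogenize:
  assumes "degree c \<le> d"
  shows "restrict (homogenize x y d c) = c"
proof -
  have "restrict (homogenize x y d c) = (\<Sum>i\<le>d. Polynomial.monom (poly.coeff c i) i)"
    unfolding homogenize_def restrict_simps restrict_coordinates
    by (intro sum.cong) (simp_all add: monom_altdef)
  then show ?thesis using poly_as_sum_of_monoms'[OF assms] by simp
qed

lemma homogenize_exists:
  "homogeneous d p \<Longrightarrow> \<exists>c. degree c \<le> d \<and> p - homogenize x y d c \<in> line_ideal d"
proof (induction d arbitrary: p)
  case 0
  define c where "c = Poly_Mapping.lookup p 0"
  have "p = Poly_Mapping.single 0 c" unfolding c_def by (rule homogeneous_0_const[OF 0])
  then have "p - homogenize x y 0 [:c:] = 0" by (simp add: homogenize_def poly_scale_def)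
  then show ?case using gi_zero[OF line_ideal] by (intro exI[of _ "[:c:]"]) simp
next
  case (Suc d)
  then obtain q where q: "\<And>i. homogeneous d (q i)" "p = (\<Sum>i\<in>UNIV. Var i * q i)"
    using forms_Suc by blast
  obtain c where c: "\<And>i. degree (c i) \<le> d" "\<And>i. q i - homogenize x y d (c i) \<in> line_ideal d"
    using Suc.IH[OF q(1)] by metis
  obtain a b where ab: "\<And>i. Var i = poly_scale (P $ i) x + poly_scale (Q $ i) y
      + poly_scale (a i) l1 + poly_scale (b i) l2" using Var_expand by metis
  let ?C = "\<lambda>i. smult (P $ i) (pCons 0 (c i)) + smult (Q $ i) (c i)"
  have "p - homogenize x y (Suc d) (\<Sum>i\<in>UNIV. ?C i) =
    (\<Sum>i\<in>UNIV. Var i * (q i - homogenize x y d (c i)) +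
      (poly_scale (a i) l1 + poly_scale (b i) l2) * homogenize x y d (c i))"
    unfolding q(2) homogenize_sum sum_subtractf[symmetric]
  proof (intro sum.cong refl)
    fix i
    have "homogenize x y (Suc d) (?C i) = (poly_scale (P $ i) x + poly_scale (Q $ i) y) * homogenize x y d (c i)"
      by (simp add: homogenize_add homogenize_smult homogenize_pCons_0 homogenize_Suc c(1) mult_poly_scale distrib_right)
    moreover have "poly_scale (P $ i) x + poly_scale (Q $ i) y
        = Var i - (poly_scale (a i) l1 + poly_scale (b i) l2)"
      by (subst ab) simp
    ultimately show "Var i * q i - homogenize x y (Suc d) (?C i) = Var i * (q i - homogenize x y d (c i)) +
      (poly_scale (a i) l1 + poly_scale (b i) l2) * homogenize x y d (c i)"
      by (simp add: algebra_simps)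
  qed
  also have "\<dots> \<in> line_ideal (Suc d)"
  proof (intro gi_sum[OF line_ideal] gi_add[OF line_ideal])
    fix i
    show "Var i * (q i - homogenize x y d (c i)) \<in> line_ideal (Suc d)"
      using gi_mult[OF line_ideal c(2) homogeneous_Var] by simp
    have "poly_scale (a i) l1 + poly_scale (b i) l2 \<in> line_ideal 1"
      using generators_in_line_ideal gi_add[OF line_ideal] gi_scale[OF line_ideal] by blast
    from gi_mult'[OF line_ideal this homogeneous_homogenize]
    show "(poly_scale (a i) l1 + poly_scale (b i) l2) * homogenize x y d (c i) \<in> line_ideal (Suc d)"
      by simp
  qed
  finally have "p - homogenize x y (Suc d) (\<Sum>i\<in>UNIV. ?C i) \<in> line_ideal (Suc d)" .
  moreover have "degree (\<Sum>i\<in>UNIV. ?C i) \<le> Suc d"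
  proof (rule degree_sum_le)
    fix i
    show "degree (?C i) \<le> Suc d"
      using c(1)[of i] degree_pCons_le[of 0 "c i"]
      by (intro degree_add_le order_trans[OF degree_smult_le]) simp_all
  qed simp
  ultimately show ?case by blast
qed

lemma restrict_form:
  assumes "homogeneous d p"
  shows "degree (restrict p) \<le> d" "p - homogenize x y d (restrict p) \<in> line_ideal d"
proof -
  obtain c where c: "degree c \<le> d" "p - homogenize x y d c \<in> line_ideal d"
    using homogenize_exists[OF assms] by blast
  have "restrict p = c"
    using restrict_line_ideal[OF c(2)] restrict_homogenize[OF c(1)] by (simp add: restrict_simps)
  then show "degree (restrict p) \<le> d" "p - homogenize x y d (restrict p) \<in> line_ideal d" using c by simp_all
qed

lemma line_ideal_iff:
  assumes "homogeneous d p"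
  shows "p \<in> line_ideal d \<longleftrightarrow> restrict p = 0"
  using restrict_form(2)[OF assms] restrict_line_ideal by (auto simp: homogenize_def)

text \<open>\<open>P\<close> is the point at infinity of the parametrization; a form that does not
  vanish there restricts to a polynomial of full degree.\<close>

lemma coeff_restrict:
  assumes "homogeneous d p"
  shows "poly.coeff (restrict p) d = poly_eval p P"
proof -
  have "poly_eval (p - homogenize x y d (restrict p)) P = 0"
    using restrict_form(2)[OF assms] by (elim line_ideal_cases) (simp add: at_P)
  moreover have "poly_eval (homogenize x y d (restrict p)) P = (\<Sum>i\<le>d. if i = d then poly.coeff (restrict p) d else 0)"
    unfolding homogenize_def poly_eval_sum by (intro sum.cong) (auto simp: at_P power_0_left)
  ultimately show ?thesis by simp
qed

lemma hf_line_ideal: "hf line_ideal d = d + 1"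
proof -
  let ?u = "\<lambda>i. x ^ i * y ^ (d - i)"
  have dim: "cpoly.dim (cpoly.span (line_ideal d \<union> ?u ` {..d})) = cpoly.dim (line_ideal d) + card {..d}"
  proof (rule cpoly.dim_span_Un_image[OF _ gi_subspace[OF line_ideal] gi_fin_dim[OF line_ideal]])
    fix c assume "(\<Sum>i\<in>{..d}. poly_scale (c i) (?u i)) \<in> line_ideal d"
    then have "restrict (\<Sum>i\<in>{..d}. poly_scale (c i) (?u i)) = 0" by (rule restrict_line_ideal)
    then have "(\<Sum>i\<in>{..d}. Polynomial.monom (c i) i) = 0"
      by (simp add: restrict_simps restrict_coordinates monom_altdef)
    then have "poly.coeff (\<Sum>i\<in>{..d}. Polynomial.monom (c i) i) j = 0" for j by simp
    then show "\<forall>i\<in>{..d}. c i = 0" by (simp add: coeff_sum) (metis atMost_iff)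
  qed simp
  have "cpoly.span (line_ideal d \<union> ?u ` {..d}) = forms d"
  proof
    have "homogeneous d (?u i)" if "i \<le> d" for i
      using homogeneous_mult[OF homogeneous_power1[OF linear(1), of i] homogeneous_power1[OF linear(2), of "d - i"]] that
      by simp
    then show "cpoly.span (line_ideal d \<union> ?u ` {..d}) \<subseteq> forms d"
      using gi_forms[OF line_ideal] by (intro cpoly.span_minimal[OF _ subspace_forms]) auto
    show "forms d \<subseteq> cpoly.span (line_ideal d \<union> ?u ` {..d})"
    proof
      fix p :: "4 cpoly" assume "p \<in> forms d"
      then have "p - homogenize x y d (restrict p) \<in> cpoly.span (line_ideal d \<union> ?u ` {..d})"
        using restrict_form(2) by (intro cpoly.span_base) simp
      moreover have "homogenize x y d (restrict p) \<in> cpoly.span (line_ideal d \<union> ?u ` {..d})"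
        unfolding homogenize_def by (intro cpoly.span_sum cpoly.span_scale cpoly.span_base) auto
      ultimately show "p \<in> cpoly.span (line_ideal d \<union> ?u ` {..d})"
        using cpoly.span_add by fastforce
    qed
  qed
  then show ?thesis using dim dim_add_hf[OF line_ideal, of d] by simp
qed

text \<open>Two coprime binary cubics form a regular sequence. The value of \<open>f\<close> at
  \<open>P\<close> excludes a common zero at infinity, which coprimality of the univariate
  restrictions cannot see.\<close>

lemma hf_line_ideal_adjoin_coprime:
  assumes f: "homogeneous 3 f" "poly_eval f P \<noteq> 0" and g: "homogeneous 3 g"
    and coprime: "coprime (restrict f) (restrict g)"
  shows "hf (adjoin (adjoin line_ideal 3 f) 3 g) d = line_hf d"
proof -
  let ?F = "adjoin line_ideal 3 f"
  have F: "graded_ideal ?F" using graded_ideal_adjoin[OF line_ideal f(1)] .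
  have c3: "poly.coeff (restrict f) 3 \<noteq> 0" using coeff_restrict[OF f(1)] f(2) by simp
  then have f0: "restrict f \<noteq> 0" by auto
  have deg: "degree (restrict f) = 3" using restrict_form(1)[OF f(1)] le_degree[OF c3] by simp
  have nf: "nonzerodivisor line_ideal 3 f"
  proof (rule nonzerodivisorI)
    fix d a assume "homogeneous d a" "a * f \<in> line_ideal (d + 3)"
    then show "a \<in> line_ideal d"
      using restrict_line_ideal[of "a * f"] f0 by (simp add: line_ideal_iff restrict_simps)
  qed
  have ng: "nonzerodivisor ?F 3 g"
  proof (rule nonzerodivisorI)
    fix d a assume a: "homogeneous d a" "a * g \<in> ?F (d + 3)"
    then obtain j b where b: "a * g = j + b * f" "j \<in> line_ideal (d + 3)" by (elim adjoinE) blast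
    then have "restrict a * restrict g = restrict b * restrict f"
      using restrict_line_ideal[OF b(2)] by (metis restrict_simps(3,5) add_0)
    then have "restrict f dvd restrict a * restrict g" by simp
    then have "restrict f dvd restrict a"
      using coprime by (simp add: coprime_dvd_mult_left_iff)
    then obtain c where c: "restrict a = restrict f * c" by (elim dvdE)
    show "a \<in> ?F d"
    proof (cases "c = 0")
      case True
      then show ?thesis using c line_ideal_iff[OF a(1)] subset_adjoin[OF line_ideal] by auto
    next
      case False
      \<comment> \<open>The restriction of \<open>f\<close> has degree exactly 3, so the cofactor
        \<open>c\<close> fits into degree \<open>d - 3\<close> and lifts to a form.\<close>
      have dc: "3 + degree c \<le> d"
        using restrict_form(1)[OF a(1)] degree_mult_eq[OF f0 False] c deg by simp
      let ?b = "homogenize x y (d - 3) c"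
      have "homogeneous d (?b * f)"
        using homogeneous_mult[OF homogeneous_homogenize f(1), of "d - 3" c] dc by simp
      then have "homogeneous d (a - ?b * f)" using a(1) by (intro homogeneous_diff)
      moreover have "restrict (a - ?b * f) = 0"
        using c dc by (simp add: restrict_simps restrict_homogenize)
      ultimately have "a - ?b * f \<in> line_ideal d" by (simp add: line_ideal_iff)
      then show ?thesis
        using dc homogeneous_homogenize by (intro adjoinI[of "a - ?b * f" _ _ _ ?b]) auto
    qed
  qed
  have F3: "hf ?F (d + 3) = 3" for d
    using hf_adjoin_nonzerodivisor[OF line_ideal f(1) nf, of d] by (simp add: hf_line_ideal)
  have Flow: "hf ?F d = d + 1" if "d < 3" for d
    using adjoin_low[OF line_ideal that, of f] hf_line_ideal[of d] by (simp add: hf_def)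
  have G3: "hf ?F (d + 3) = hf (adjoin ?F 3 g) (d + 3) + hf ?F d" for d
    using hf_adjoin_nonzerodivisor[OF F g ng] .
  have Glow: "hf (adjoin ?F 3 g) d = d + 1" if "d < 3" for d
    using adjoin_low[OF F that, of g] Flow[OF that] by (simp add: hf_def)
  have "d < 3 \<or> d = 0 + 3 \<or> d = 1 + 3 \<or> d = 2 + 3 \<or> d = (d - 6) + 3 + 3" by arith
  then show ?thesis
  proof (elim disjE)
    assume "d = (d - 6) + 3 + 3"
    then show ?thesis using F3[of "d - 6 + 3"] F3[of "d - 6"] G3[of "d - 6 + 3"] by (simp add: line_hf_def)
  qed (use Glow[of d] G3[of 0] G3[of 1] G3[of 2] F3[of 0] F3[of 1] F3[of 2] Flow[of 0] Flow[of 1] Flow[of 2]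
    in \<open>auto simp: line_hf_def\<close>)
qed

end

section \<open>A line missing the curve\<close>

text \<open>A substitute for the resultant: \<open>r\<close> is free of the main variable. Take a
  nonzero element of least degree in the ideal of \<open>f\<close> and \<open>g\<close>; by
  pseudo-division and Gauss's lemma its primitive part divides both, so it is a unit.\<close>

lemma coprime_imp_combination_const:
  fixes f g :: "'a::{factorial_ring_gcd,semiring_gcd_mult_normalize} poly"
  assumes "coprime f g" "f \<noteq> 0"
  shows "\<exists>a b r. r \<noteq> 0 \<and> a * f + b * g = [:r:]"
proof -
  define D where "D u \<longleftrightarrow> u \<noteq> 0 \<and> (\<exists>a b. u = a * f + b * g)" for u
  have "f = 1 * f + 0 * g" by simp
  then have "D f" unfolding D_def using assms(2) by blast
  then obtain u where u: "D u" "\<And>v. D v \<Longrightarrow> degree u \<le> degree v"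
    using ex_has_least_nat[of D f degree] by blast
  then obtain a b where ab: "u = a * f + b * g" and u0: "u \<noteq> 0" unfolding D_def by blast
  have dvd: "primitive_part u dvd h" if h: "h = a' * f + b' * g" for h a' b'
  proof -
    obtain q r where qr: "pseudo_divmod h u = (q, r)" by force
    define c where "c = poly.coeff u (degree u) ^ (Suc (degree h) - degree u)"
    have c0: "c \<noteq> 0" using u0 by (simp add: c_def)
    have r: "smult c h = u * q + r" "r = 0 \<or> degree r < degree u"
      using pseudo_divmod[OF u0 qr] by (simp_all add: c_def)
    have "r = (smult c a' - q * a) * f + (smult c b' - q * b) * g"
      using r(1) unfolding h ab by (simp add: algebra_simps smult_add_right)
    then have "r = 0 \<or> D r" unfolding D_def by blast
    then have "r = 0" using r(2) u(2) by fastforce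
    have "u * q = smult (content u) (primitive_part u) * q" by simp
    then have "smult c h = primitive_part u * smult (content u) q"
      using r(1) \<open>r = 0\<close> by (metis add.right_neutral mult_smult_left mult_smult_right)
    then have "primitive_part u dvd smult c h" by (rule dvdI)
    then have "fract_poly (primitive_part u) dvd fract_poly (smult c h)" by (rule fract_poly_dvd)
    then have "fract_poly (primitive_part u) dvd fract_poly h"
      using c0 by (simp add: dvd_smult_iff)
    then show ?thesis using u0 by (intro fract_poly_dvdD) simp_all
  qed
  have "primitive_part u dvd f" by (rule dvd[of _ 1 0]) simp
  moreover have "primitive_part u dvd g" by (rule dvd[of _ 0 1]) simp
  ultimately have "is_unit (primitive_part u)" using assms(1) by (rule coprime_common_divisor[rotated])
  then have "degree u = 0" by (metis degree_pCons_0 degree_primitive_part is_unit_poly_iff)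
  then obtain r where "u = [:r:]" by (rule degree_eq_zeroE)
  then show ?thesis using ab u0 by (intro exI[of _ a] exI[of _ b] exI[of _ r]) auto
qed

section \<open>Iterated univariate polynomials and projection from a point\<close>

type_synonym nested = "complex poly poly poly poly"

interpretation nested: coeff_hom "\<lambda>c. [:[:[:[:c:]:]:]:] :: nested"
  by unfold_locales (simp_all add: one_pCons)

text \<open>The first variable is outermost because it is the one to be eliminated; the other three
  live in the coefficients.\<close>

definition nested_Var :: "4 \<Rightarrow> nested" where
  "nested_Var i = (if i = 1 then [:0, 1:] else if i = 2 then [:[:0, 1:]:]
     else if i = 3 then [:[:[:0, 1:]:]:] else [:[:[:[:0, 1:]:]:]:])"

definition nested_eval :: "complex ^ 4 \<Rightarrow> nested \<Rightarrow> complex" where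
  "nested_eval v u = poly (poly (poly (poly u [:[:[:v $ 1:]:]:]) [:[:v $ 2:]:]) [:v $ 3:]) (v $ 4)"

lemma nested_eval_simps:
  "nested_eval v (u + u') = nested_eval v u + nested_eval v u'"
  "nested_eval v (u * u') = nested_eval v u * nested_eval v u'"
  "nested_eval v (u ^ k) = nested_eval v u ^ k"
  "nested_eval v [:[:[:[:c:]:]:]:] = c"
  "nested_eval v (nested_Var i) = v $ i"
  using exhaust_4[of i] by (auto simp: nested_eval_def nested_Var_def)

lemma nested_eval_sum: "nested_eval v (\<Sum>i\<in>I. u i) = (\<Sum>i\<in>I. nested_eval v (u i))"
  by (simp add: nested_eval_def poly_sum)

lemma nested_eval_prod: "nested_eval v (\<Prod>i\<in>I. u i) = (\<Prod>i\<in>I. nested_eval v (u i))"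
  by (simp add: nested_eval_def poly_prod)

lemma nested_eval_insertion:
  "nested_eval v (nested.insertion X p) = poly_eval p (\<chi> i. nested_eval v (X i))"
  unfolding nested.insertion_def poly_eval_def nested_eval_sum nested_eval_prod nested_eval_simps
  by simp

lemma nonroot_in_infinite_set:
  fixes p :: "'a::idom poly"
  assumes "p \<noteq> 0" "infinite (range h)"
  shows "\<exists>s. poly p (h s) \<noteq> 0"
proof (rule ccontr)
  assume "\<not> ?thesis"
  then have "range h \<subseteq> {x. poly p x = 0}" by auto
  then show False using poly_roots_finite[OF assms(1)] assms(2) finite_subset by blast
qed

lemma infinite_range_const:
  "infinite (range (\<lambda>c::complex. c))" "infinite (range (\<lambda>c::complex. [:c:]))"
  "infinite (range (\<lambda>c::complex. [:[:c:]:]))" "infinite (range (\<lambda>c::complex. [:[:[:c:]:]:]))"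
  using infinite_UNIV_char_0[where 'a = complex]
  by (auto dest!: finite_imageD simp: inj_on_def)

lemma exists_nonzero_nested_eval3:
  fixes r :: "complex poly poly poly"
  assumes "r \<noteq> 0"
  shows "\<exists>a b c. poly (poly (poly r [:[:a:]:]) [:b:]) c \<noteq> 0"
  using nonroot_in_infinite_set[OF assms infinite_range_const(3)]
    nonroot_in_infinite_set[OF _ infinite_range_const(2)] nonroot_in_infinite_set[OF _ infinite_range_const(1)]
  by metis

lemma exists_nonzero_nested_eval:
  assumes "u \<noteq> 0"
  shows "\<exists>v. nested_eval v u \<noteq> 0"
proof -
  obtain s where "poly u [:[:[:s:]:]:] \<noteq> 0"
    using nonroot_in_infinite_set[OF assms infinite_range_const(4)] by blast
  then obtain a b c where "poly (poly (poly (poly u [:[:[:s:]:]:]) [:[:a:]:]) [:b:]) c \<noteq> 0"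
    using exists_nonzero_nested_eval3 by blast
  then have "nested_eval (\<chi> i. if i = 1 then s else if i = 2 then a else if i = 3 then b else c) u \<noteq> 0"
    by (simp add: nested_eval_def)
  then show ?thesis by blast
qed

lemma coeff_nested_insertion:
  "poly.coeff (poly.coeff (poly.coeff (poly.coeff (nested.insertion nested_Var p)
     (Poly_Mapping.lookup m 1)) (Poly_Mapping.lookup m 2)) (Poly_Mapping.lookup m 3)) (Poly_Mapping.lookup m 4)
   = Poly_Mapping.lookup p m"
proof (induction p rule: cpoly_induct)
  case (single n c)
  have prod_4: "(\<Prod>i\<in>UNIV. u i) = u 1 * u 2 * u 3 * u 4" for u :: "4 \<Rightarrow> nested"
    unfolding UNIV_4 by (simp add: ac_simps)
  have *: "nested.insertion nested_Var (Poly_Mapping.single n c) =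
    Polynomial.monom (Polynomial.monom (Polynomial.monom (Polynomial.monom c (Poly_Mapping.lookup n 4))
      (Poly_Mapping.lookup n 3)) (Poly_Mapping.lookup n 2)) (Poly_Mapping.lookup n 1)"
    unfolding nested.insertion_single prod_4 nested_Var_def
    by (simp add: monom_altdef poly_const_pow)
  have "n = m \<longleftrightarrow> (\<forall>i. Poly_Mapping.lookup n i = Poly_Mapping.lookup m i)"
    by (auto intro: poly_mapping_eqI)
  also have "\<dots> \<longleftrightarrow> (Poly_Mapping.lookup n 1 = Poly_Mapping.lookup m 1 \<and> Poly_Mapping.lookup n 2 = Poly_Mapping.lookup m 2
     \<and> Poly_Mapping.lookup n 3 = Poly_Mapping.lookup m 3 \<and> Poly_Mapping.lookup n 4 = Poly_Mapping.lookup m 4)"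
    by (metis exhaust_4)
  finally show ?case unfolding * by (auto simp: lookup_single when_def)
qed (simp_all add: nested.insertion_zero nested.insertion_add lookup_add)

lemma exists_nonzero_poly_eval:
  fixes p :: "4 cpoly"
  assumes "p \<noteq> 0"
  shows "\<exists>v. poly_eval p v \<noteq> 0"
proof -
  have "nested.insertion nested_Var p \<noteq> 0"
  proof
    assume "nested.insertion nested_Var p = 0"
    then have "Poly_Mapping.lookup p m = 0" for m using coeff_nested_insertion[of p m] by simp
    then show False using assms by (auto intro: poly_mapping_eqI)
  qed
  then obtain v where "nested_eval v (nested.insertion nested_Var p) \<noteq> 0"
    using exists_nonzero_nested_eval by blast
  then show ?thesis unfolding nested_eval_insertion by blast
qed

text \<open>The coordinates adapted to the projection from a point \<open>P\<close> with first coordinate \<open>1\<close>.\<close>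

definition shift_Var :: "complex ^ 4 \<Rightarrow> 4 \<Rightarrow> nested" where
  "shift_Var P i = (if i = 1 then nested_Var 1 else [:[:[:[:P $ i:]:]:]:] * nested_Var 1 + nested_Var i)"

lemma nested_subring_UNIV:
  assumes const: "\<And>c. [:[:[:[:c:]:]:]:] \<in> S" and var: "\<And>i. nested_Var i \<in> S"
    and add: "\<And>a b. a \<in> S \<Longrightarrow> b \<in> S \<Longrightarrow> a + b \<in> S" and mult: "\<And>a b. a \<in> S \<Longrightarrow> b \<in> S \<Longrightarrow> a * b \<in> S"
  shows "u \<in> S"
proof -
  have v: "[:0, 1:] \<in> S" "[:[:0, 1:]:] \<in> S" "[:[:[:0, 1:]:]:] \<in> S" "[:[:[:[:0, 1:]:]:]:] \<in> S"
    using var[of 1] var[of 2] var[of 3] var[of 4] by (simp_all add: nested_Var_def)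
  have 1: "[:[:[:p:]:]:] \<in> S" for p
  proof (induction p)
    case 0
    show ?case using const[of 0] by simp
  next
    case (pCons c p)
    have "[:[:[:pCons c p:]:]:] = [:[:[:[:c:]:]:]:] + [:[:[:[:0, 1:]:]:]:] * [:[:[:p:]:]:]" by simp
    then show ?case using add[OF const mult[OF v(4) pCons(2)]] by simp
  qed
  have 2: "[:[:p:]:] \<in> S" for p
  proof (induction p)
    case 0
    show ?case using 1[of 0] by simp
  next
    case (pCons c p)
    have "[:[:pCons c p:]:] = [:[:[:c:]:]:] + [:[:[:0, 1:]:]:] * [:[:p:]:]" by simp
    then show ?case using add[OF 1 mult[OF v(3) pCons(2)]] by simp
  qed
  have 3: "[:p:] \<in> S" for p
  proof (induction p)
    case 0
    show ?case using 2[of 0] by simp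
  next
    case (pCons c p)
    have "[:pCons c p:] = [:[:c:]:] + [:[:0, 1:]:] * [:p:]" by simp
    then show ?case using add[OF 2 mult[OF v(2) pCons(2)]] by simp
  qed
  show ?thesis
  proof (induction u)
    case 0
    show ?case using 3[of 0] by simp
  next
    case (pCons c p)
    have "pCons c p = [:c:] + [:0, 1:] * p" by simp
    then show ?case using add[OF 3 mult[OF v(1) pCons(2)]] by simp
  qed
qed

text \<open>A common factor in the iterated ring has to be pulled back to a common factor of
  \<open>f\<close> and \<open>g\<close>, so the substitution must be bijective.\<close>

lemma shift_insertion_surj: "\<exists>p. nested.insertion (shift_Var P) p = u"
proof -
  let ?S = "range (nested.insertion (shift_Var P))"
  have const: "[:[:[:[:c:]:]:]:] \<in> ?S" for c
    using nested.insertion_const[of "shift_Var P" c] by (metis rangeI)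
  have add: "a + b \<in> ?S" if ab: "a \<in> ?S" "b \<in> ?S" for a b
  proof -
    obtain p q where "a = nested.insertion (shift_Var P) p" "b = nested.insertion (shift_Var P) q"
      using ab by blast
    then have "a + b = nested.insertion (shift_Var P) (p + q)" by (simp only: nested.insertion_add)
    then show ?thesis by blast
  qed
  have mult: "a * b \<in> ?S" if ab: "a \<in> ?S" "b \<in> ?S" for a b
  proof -
    obtain p q where "a = nested.insertion (shift_Var P) p" "b = nested.insertion (shift_Var P) q"
      using ab by blast
    then have "a * b = nested.insertion (shift_Var P) (p * q)" by (simp only: nested.insertion_mult)
    then show ?thesis by blast
  qed
  have sv: "shift_Var P i \<in> ?S" for i
    using nested.insertion_Var[of "shift_Var P" i] by (metis rangeI)
  have 1: "nested_Var 1 \<in> ?S" using sv[of 1] by (simp add: shift_Var_def)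
  have var: "nested_Var i \<in> ?S" for i
  proof (cases "i = 1")
    case False
    then have "nested_Var i = shift_Var P i + [:[:[:[:- P $ i:]:]:]:] * nested_Var 1"
    proof -
      have n: "[:[:[:[:- P $ i:]:]:]:] = - [:[:[:[:P $ i:]:]:]:]" by simp
      show ?thesis unfolding n shift_Var_def using False by (simp del: mult_pCons_left minus_pCons)
    qed
    then show ?thesis using add[OF sv mult[OF const 1]] by simp
  qed (use 1 in simp)
  have "u \<in> ?S" by (rule nested_subring_UNIV[of ?S, OF const var add mult])
  then show ?thesis by blast
qed

lemma nested_eval_shift_insertion:
  assumes "P $ 1 = 1"
  shows "nested_eval v (nested.insertion (shift_Var P) p)
    = poly_eval p (v $ 1 *s P + (\<chi> i. if i = 1 then 0 else v $ i))"
proof -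
  have "(\<chi> i. nested_eval v (shift_Var P i)) = v $ 1 *s P + (\<chi> i. if i = 1 then 0 else v $ i)"
    unfolding vec_eq_iff shift_Var_def if_distrib[of "nested_eval v"] nested_eval_simps
    using assms by (simp add: mult.commute)
  then show ?thesis unfolding nested_eval_insertion by simp
qed

text \<open>Values determine a polynomial, and the linear change of coordinates reaches every
  vector.\<close>

lemma shift_insertion_inj:
  assumes P: "P $ 1 = 1" and "nested.insertion (shift_Var P) p = nested.insertion (shift_Var P) q"
  shows "p = q"
proof (rule ccontr)
  assume "p \<noteq> q"
  then obtain v where v: "poly_eval (p - q) v \<noteq> 0" using exists_nonzero_poly_eval[of "p - q"] by auto
  define w where "w = (\<chi> i. if i = 1 then v $ 1 else v $ i - v $ 1 * P $ i)"
  have "w $ 1 *s P + (\<chi> i. if i = 1 then 0 else w $ i) = v"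
    using P by (auto simp: vec_eq_iff w_def)
  then have "nested_eval w (nested.insertion (shift_Var P) r) = poly_eval r v" for r
    using nested_eval_shift_insertion[OF P, of w r] by simp
  from this[of p] this[of q] show False using assms(2) v by simp
qed

lemma coprime_if_no_common_root:
  fixes p q :: "complex poly"
  assumes "p \<noteq> 0" "\<And>s. poly p s = 0 \<Longrightarrow> poly q s \<noteq> 0"
  shows "coprime p q"
proof (rule coprimeI)
  fix c assume c: "c dvd p" "c dvd q"
  have "c \<noteq> 0" using c(1) assms(1) by auto
  have "degree c = 0"
  proof (rule ccontr)
    assume "degree c \<noteq> 0"
    then have "\<not> constant (poly c)" by (simp add: constant_degree)
    then obtain s where "poly c s = 0" using fundamental_theorem_of_algebra by blast
    then show False using c assms(2) by (metis dvdE mult_zero_left poly_mult)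
  qed
  then show "is_unit c" using \<open>c \<noteq> 0\<close> by (simp add: is_unit_iff_degree)
qed

text \<open>Eliminating the direction of \<open>P\<close> gives a cone \<open>r = 0\<close> with
  vertex \<open>P\<close> that contains all common zeros of \<open>f\<close> and \<open>g\<close>. A
  line joining \<open>P\<close> to a point \<open>Q\<close> off this cone misses them.\<close>

lemma exists_line_coordinates:
  fixes f g :: "4 cpoly"
  assumes f: "homogeneous 3 f" "f \<noteq> 0" and g: "homogeneous 3 g"
    and no_factor: "\<And>p a b. f = p * a \<Longrightarrow> g = p * b \<Longrightarrow> homogeneous 0 p"
  shows "\<exists>P Q x y l1 l2. line_coordinates P Q x y l1 l2 \<and> poly_eval f P \<noteq> 0 \<and>
    coprime (line_coordinates.restrict P Q f) (line_coordinates.restrict P Q g)"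
proof -
  have "poly_eval (Var 1 :: 4 cpoly) (\<chi> i. 1) = 1" by (simp del: One_nat_def)
  then have "Var 1 \<noteq> (0 :: 4 cpoly)" by (metis poly_eval_zero zero_neq_one)
  \<comment> \<open>The factor \<open>Var 1\<close> yields a point off \<open>f = 0\<close> whose
    first coordinate can be normalized to 1.\<close>
  then have "Var 1 * f \<noteq> 0" using f(2) by simp
  then obtain v where v: "poly_eval (Var 1 * f) v \<noteq> 0" using exists_nonzero_poly_eval by blast
  then have v1: "v $ 1 \<noteq> 0" and fv: "poly_eval f v \<noteq> 0" by auto
  define P where "P = inverse (v $ 1) *s v"
  have P1: "P $ 1 = 1" using v1 by (simp add: P_def)
  have fP: "poly_eval f P \<noteq> 0" using poly_eval_scale_vec[OF f(1)] fv v1 by (simp add: P_def)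
  let ?\<Phi> = "nested.insertion (shift_Var P)"
  have f0: "?\<Phi> f \<noteq> 0" using shift_insertion_inj[OF P1, of f 0] f(2) by (auto simp: nested.insertion_zero)
  have "coprime (?\<Phi> f) (?\<Phi> g)"
  proof (rule coprimeI)
    fix u assume "u dvd ?\<Phi> f" "u dvd ?\<Phi> g"
    then obtain a b where ab: "?\<Phi> f = u * a" "?\<Phi> g = u * b" by (auto elim!: dvdE)
    obtain p a' b' where p: "u = ?\<Phi> p" "a = ?\<Phi> a'" "b = ?\<Phi> b'" using shift_insertion_surj by metis
    have "f = p * a'" "g = p * b'"
      using ab unfolding p nested.insertion_mult[symmetric] by (auto dest: shift_insertion_inj[OF P1])
    then have "homogeneous 0 p" by (rule no_factor)
    then have "p = Poly_Mapping.single 0 (Poly_Mapping.lookup p 0)" by (rule homogeneous_0_const)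
    then obtain c where c: "p = Poly_Mapping.single 0 c" by blast
    have u: "u = [:[:[:[:c:]:]:]:]" unfolding p c by (rule nested.insertion_const)
    have "c \<noteq> 0" using u ab(1) f0 by auto
    then have "[:[:[:[:c:]:]:]:] * [:[:[:[:inverse c:]:]:]:] = (1 :: nested)" by (simp add: one_pCons)
    then show "is_unit u" unfolding u by (metis dvdI)
  qed
  then obtain A B r where r: "r \<noteq> 0" "A * ?\<Phi> f + B * ?\<Phi> g = [:r:]"
    using coprime_imp_combination_const[OF _ f0] by blast
  \<comment> \<open>The extra factor is the second variable; it forces \<open>a\<close> to be
    nonzero, as needed for the division in \<open>y\<close>.\<close>
  have "r * [:0, 1:] \<noteq> 0" using r(1) by simp
  then obtain a b c where abc: "poly (poly (poly (r * [:0, 1:]) [:[:a:]:]) [:b:]) c \<noteq> 0"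
    using exists_nonzero_nested_eval3 by blast
  then have a0: "a \<noteq> 0" and rabc: "poly (poly (poly r [:[:a:]:]) [:b:]) c \<noteq> 0" by auto
  define Q :: "complex ^ 4" where "Q = (\<chi> i. if i = 1 then 0 else if i = 2 then a else if i = 3 then b else c)"
  define x :: "4 cpoly" where "x = Var 1"
  define y :: "4 cpoly" where "y = poly_scale (inverse a) (Var 2 - poly_scale (P $ 2) x)"
  define l1 :: "4 cpoly" where "l1 = Var 3 - poly_scale (P $ 3) x - poly_scale b y"
  define l2 :: "4 cpoly" where "l2 = Var 4 - poly_scale (P $ 4) x - poly_scale c y"
  have Q: "Q $ 1 = 0" "Q $ 2 = a" "Q $ 3 = b" "Q $ 4 = c" by (simp_all add: Q_def)
  have L: "line_coordinates P Q x y l1 l2"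
  proof
    show lin: "homogeneous 1 x" "homogeneous 1 y" unfolding x_def y_def
      by (intro homogeneous_scale homogeneous_diff homogeneous_Var)+
    show "homogeneous 1 l1" "homogeneous 1 l2" unfolding l1_def l2_def
      by (intro homogeneous_scale homogeneous_diff homogeneous_Var lin)+
    show "\<exists>a b. Var i = poly_scale (P $ i) x + poly_scale (Q $ i) y + poly_scale a l1 + poly_scale b l2" for i
    proof -
      consider "i = 1" | "i = 2" | "i = 3" | "i = 4" using exhaust_4 by blast
      then show ?thesis
      proof cases
        case 1
        then show ?thesis by (intro exI[of _ 0]) (simp add: P1 Q x_def)
      next
        case 2
        then show ?thesis using a0 by (intro exI[of _ 0]) (simp add: Q y_def)
      next
        case 3
        then show ?thesis by (intro exI[of _ 1] exI[of _ 0]) (simp add: Q l1_def)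
      next
        case 4
        then show ?thesis by (intro exI[of _ 0] exI[of _ 1]) (simp add: Q l2_def)
      qed
    qed
  qed (simp_all add: x_def y_def l1_def l2_def P1 Q a0)
  interpret L: line_coordinates P Q x y l1 l2 by (rule L)
  have ev: "nested_eval (\<chi> i. if i = 1 then s else Q $ i) (?\<Phi> p) = poly (L.restrict p) s" for s p
  proof -
    have "(\<chi> i. if i = 1 then 0 else (\<chi> i. if i = 1 then s else Q $ i) $ i) = Q"
      by (simp add: vec_eq_iff Q)
    then show ?thesis
      unfolding nested_eval_shift_insertion[OF P1] L.poly_restrict by simp
  qed
  have "L.restrict f \<noteq> 0"
    using L.coeff_restrict[OF f(1)] fP by auto
  moreover have "poly (L.restrict g) s \<noteq> 0" if s: "poly (L.restrict f) s = 0" for s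
  proof
    \<comment> \<open>Both cubics vanish at \<open>s P + Q\<close>, hence so does their combination
      \<open>r\<close>; but its value there does not depend on \<open>s\<close> and is nonzero by
      the choice of \<open>Q\<close>.\<close>
    assume "poly (L.restrict g) s = 0"
    then have "nested_eval (\<chi> i. if i = 1 then s else Q $ i) (A * ?\<Phi> f + B * ?\<Phi> g) = 0"
      using s by (simp add: nested_eval_simps ev)
    then show False unfolding r(2) using rabc by (simp add: nested_eval_def Q)
  qed
  ultimately show ?thesis using coprime_if_no_common_root L fP by blast
qed

section \<open>Homogeneous factors of forms\<close>

definition hom_component :: "nat \<Rightarrow> 'n::finite cpoly \<Rightarrow> 'n cpoly" where
  "hom_component d p = (\<Sum>m\<in>{m \<in> Poly_Mapping.keys p. mdeg m = d}. Poly_Mapping.single m (Poly_Mapping.lookup p m))"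

lemma lookup_hom_component:
  "Poly_Mapping.lookup (hom_component d p) m = (if mdeg m = d then Poly_Mapping.lookup p m else 0)"
proof -
  have "Poly_Mapping.lookup (hom_component d p) m
      = (\<Sum>k\<in>{k \<in> Poly_Mapping.keys p. mdeg k = d}. if k = m then Poly_Mapping.lookup p m else 0)"
    unfolding hom_component_def lookup_sum by (intro sum.cong) (auto simp: lookup_single when_def)
  also have "\<dots> = (if mdeg m = d then Poly_Mapping.lookup p m else 0)"
    by (auto simp: in_keys_iff)
  finally show ?thesis .
qed

lemma homogeneous_hom_component: "homogeneous d (hom_component d p)"
  unfolding hom_component_def by (intro homogeneous_sum homogeneous_single) auto

lemma hom_component_homogeneous: "homogeneous d p \<Longrightarrow> hom_component e p = (if e = d then p else 0)"
  by (intro poly_mapping_eqI) (auto simp: lookup_hom_component homogeneous_def in_keys_iff)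

lemma top_component_mult:
  assumes p: "\<And>k. k \<in> Poly_Mapping.keys p \<Longrightarrow> mdeg k \<le> m" and q: "\<And>k. k \<in> Poly_Mapping.keys q \<Longrightarrow> mdeg k \<le> n"
  shows "hom_component (m + n) (p * q) = hom_component m p * hom_component n q"
proof (rule poly_mapping_eqI)
  fix k
  define p' where "p' = p - hom_component m p"
  define q' where "q' = q - hom_component n q"
  have p': "mdeg k < m" if "k \<in> Poly_Mapping.keys p'" for k
  proof -
    have "mdeg k \<noteq> m" "k \<in> Poly_Mapping.keys p"
      using that by (simp_all add: p'_def in_keys_iff lookup_minus lookup_hom_component split: if_splits)
    then show ?thesis using p[of k] by simp
  qed
  have q': "mdeg k < n" if "k \<in> Poly_Mapping.keys q'" for k
  proof -
    have "mdeg k \<noteq> n" "k \<in> Poly_Mapping.keys q"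
      using that by (simp_all add: q'_def in_keys_iff lookup_minus lookup_hom_component split: if_splits)
    then show ?thesis using q[of k] by simp
  qed
  have eq: "p * q = hom_component m p * hom_component n q + p' * q + hom_component m p * q'"
    by (simp add: p'_def q'_def algebra_simps)
  have 1: "mdeg k < m + n" if "k \<in> Poly_Mapping.keys (p' * q)" for k
    using keys_mult[of p' q] that by (fastforce simp: mdeg_add dest: p' q intro: add_less_le_mono)
  have 2: "mdeg k < m + n" if "k \<in> Poly_Mapping.keys (hom_component m p * q')" for k
    using keys_mult[of "hom_component m p" q'] that homogeneous_hom_component[of m p]
    by (fastforce simp: mdeg_add homogeneous_def dest: q')
  have h: "homogeneous (m + n) (hom_component m p * hom_component n q)"
    by (intro homogeneous_mult homogeneous_hom_component)
  show "Poly_Mapping.lookup (hom_component (m + n) (p * q)) k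
      = Poly_Mapping.lookup (hom_component m p * hom_component n q) k"
  proof (cases "mdeg k = m + n")
    case True
    then have "Poly_Mapping.lookup (p' * q) k = 0" "Poly_Mapping.lookup (hom_component m p * q') k = 0"
      using 1[of k] 2[of k] by (auto simp: in_keys_iff)
    then show ?thesis using True by (subst eq) (simp add: lookup_hom_component lookup_add)
  next
    case False
    then show ?thesis using h by (auto simp: lookup_hom_component homogeneous_def in_keys_iff)
  qed
qed

definition total_degree :: "'n::finite cpoly \<Rightarrow> nat" where
  "total_degree p = Max (mdeg ` Poly_Mapping.keys p)"

lemma total_degree_ge: "k \<in> Poly_Mapping.keys p \<Longrightarrow> mdeg k \<le> total_degree p"
  unfolding total_degree_def by (intro Max_ge) auto

lemma keys_eq_empty_iff: "Poly_Mapping.keys p = {} \<longleftrightarrow> p = 0"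
  by (auto intro!: poly_mapping_eqI simp: in_keys_iff)

lemma top_component_nonzero:
  assumes "p \<noteq> 0"
  shows "hom_component (total_degree p) p \<noteq> 0"
proof -
  have "total_degree p \<in> mdeg ` Poly_Mapping.keys p"
    unfolding total_degree_def using assms by (intro Max_in) (simp_all add: keys_eq_empty_iff)
  then obtain k where "k \<in> Poly_Mapping.keys p" "total_degree p = mdeg k" by auto
  then have "Poly_Mapping.lookup (hom_component (total_degree p) p) k \<noteq> 0"
    by (simp add: lookup_hom_component in_keys_iff)
  then show ?thesis by auto
qed

text \<open>Top components multiply, so an arbitrary factor of a form can be replaced by its top
  component, to which General Position applies.\<close>

lemma homogeneous_factor:
  fixes p a :: "4 cpoly"
  assumes f: "homogeneous d (p * a)" and nz: "p * a \<noteq> 0"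
  shows "\<exists>n a'. total_degree p + n = d \<and> homogeneous n a' \<and> p * a = hom_component (total_degree p) p * a'"
proof -
  have p: "p \<noteq> 0" and a: "a \<noteq> 0" using nz by auto
  have top: "hom_component (total_degree p + total_degree a) (p * a)
      = hom_component (total_degree p) p * hom_component (total_degree a) a"
    by (intro top_component_mult total_degree_ge)
  then have "hom_component (total_degree p + total_degree a) (p * a) \<noteq> 0"
    using top_component_nonzero[OF p] top_component_nonzero[OF a] by simp
  then have "total_degree p + total_degree a = d"
    using hom_component_homogeneous[OF f] by (metis (full_types))
  moreover from this have "p * a = hom_component (total_degree p) p * hom_component (total_degree a) a"
    using top hom_component_homogeneous[OF f, of d] by simp
  ultimately show ?thesis using homogeneous_hom_component by blast
qed

lemma total_degree_0: "total_degree p = 0 \<Longrightarrow> homogeneous 0 p"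
  unfolding homogeneous_def using total_degree_ge[of _ p] by fastforce

section \<open>Ideals of points\<close>

lemma lookup_single_mult_add:
  fixes q :: "'n cpoly"
  shows "Poly_Mapping.lookup (Poly_Mapping.single n c * q) (n + k) = c * Poly_Mapping.lookup q (k :: 'n \<Rightarrow>\<^sub>0 nat)"
proof (induction q rule: cpoly_induct)
  case (single m d)
  show ?case by (simp add: mult_single lookup_single when_def)
qed (simp_all add: distrib_left lookup_add)

lemma lookup_single_mult_0:
  fixes q :: "'n cpoly"
  assumes "\<nexists>k. m = n + k"
  shows "Poly_Mapping.lookup (Poly_Mapping.single n c * q) (m :: 'n \<Rightarrow>\<^sub>0 nat) = (0 :: complex)"
proof (induction q rule: cpoly_induct)
  case (single l d)
  show ?case using assms by (auto simp: mult_single lookup_single when_def)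
qed (simp_all add: distrib_left lookup_add)

abbreviation monomial_value :: "complex ^ 'n::finite \<Rightarrow> ('n \<Rightarrow>\<^sub>0 nat) \<Rightarrow> complex" where
  "monomial_value v m \<equiv> \<Prod>i\<in>UNIV. v $ i ^ Poly_Mapping.lookup m i"

lemma monomial_value_add: "monomial_value v (m + n) = monomial_value v m * monomial_value v n"
  by (simp add: lookup_add power_add prod.distrib)

lemma monomial_value_single: "monomial_value v (Poly_Mapping.single i k) = v $ i ^ k"
proof -
  have "monomial_value v (Poly_Mapping.single i k) = (\<Prod>j\<in>UNIV. if j = i then v $ i ^ k else 1)"
    by (intro prod.cong) (auto simp: lookup_single when_def)
  then show ?thesis by simp
qed

text \<open>\<open>k m\<close> is a multinomial coefficient, of which only the positivity matters.\<close>

lemma lookup_linear_form_power: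
  "\<exists>k :: ('n::finite \<Rightarrow>\<^sub>0 nat) \<Rightarrow> nat. (\<forall>m. mdeg m = d \<longrightarrow> k m > 0) \<and>
    (\<forall>v m. mdeg m = d \<longrightarrow> Poly_Mapping.lookup (linear_form v ^ d) m = of_nat (k m) * monomial_value v m)"
proof (induction d)
  case 0
  have "m = 0" if "mdeg m = 0" for m :: "'n \<Rightarrow>\<^sub>0 nat"
    using that by (auto intro!: poly_mapping_eqI)
  then show ?case by (intro exI[of _ "\<lambda>_. 1"]) (auto simp: lookup_one)
next
  case (Suc d)
  then obtain k :: "('n \<Rightarrow>\<^sub>0 nat) \<Rightarrow> nat" where k: "\<And>m. mdeg m = d \<Longrightarrow> k m > 0"
    "\<And>v m. mdeg m = d \<Longrightarrow> Poly_Mapping.lookup (linear_form v ^ d) m = of_nat (k m) * monomial_value v m"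
    by blast
  define e :: "'n \<Rightarrow> 'n \<Rightarrow>\<^sub>0 nat" where "e i = Poly_Mapping.single i 1" for i
  define k' where "k' m = (\<Sum>i\<in>UNIV. if Poly_Mapping.lookup m i > 0 then k (m - e i) else 0)" for m
  have split: "m = e i + (m - e i)" if "Poly_Mapping.lookup m i > 0" for m i
    using that by (intro poly_mapping_eqI) (auto simp: e_def lookup_add lookup_minus lookup_single when_def)
  have deg: "mdeg (m - e i) = d" if "mdeg m = Suc d" "Poly_Mapping.lookup m i > 0" for m i
  proof -
    have "mdeg m = mdeg (e i) + mdeg (m - e i)"
      unfolding mdeg_add[symmetric] using split[OF that(2)] by simp
    then show ?thesis using that(1) by (simp add: e_def mdeg_single)
  qed
  show ?case
  proof (intro exI[of _ k'] conjI allI impI)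
    fix m :: "'n \<Rightarrow>\<^sub>0 nat"
    assume m: "mdeg m = Suc d"
    have "\<exists>i. Poly_Mapping.lookup m i > 0"
    proof (rule ccontr)
      assume "\<not> ?thesis"
      then have "mdeg m = 0" by simp
      then show False using m by simp
    qed
    then obtain i where i: "Poly_Mapping.lookup m i > 0" by blast
    have "0 < k (m - e i)" using k(1) deg[OF m i] by blast
    also have "\<dots> \<le> k' m"
      unfolding k'_def using i member_le_sum[of i UNIV "\<lambda>i. if Poly_Mapping.lookup m i > 0 then k (m - e i) else 0"]
      by simp
    finally show "0 < k' m" .
  next
    fix v and m :: "'n \<Rightarrow>\<^sub>0 nat"
    assume m: "mdeg m = Suc d"
    have "Poly_Mapping.lookup (linear_form v ^ Suc d) m
        = (\<Sum>i\<in>UNIV. Poly_Mapping.lookup (Poly_Mapping.single (e i) (v $ i) * linear_form v ^ d) m)"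
      by (simp add: linear_form_def[of v] sum_distrib_right lookup_sum e_def)
    also have "\<dots> = (\<Sum>i\<in>UNIV. of_nat (if Poly_Mapping.lookup m i > 0 then k (m - e i) else 0) * monomial_value v m)"
    proof (intro sum.cong refl)
      fix i
      show "Poly_Mapping.lookup (Poly_Mapping.single (e i) (v $ i) * linear_form v ^ d) m =
          of_nat (if Poly_Mapping.lookup m i > 0 then k (m - e i) else 0) * monomial_value v m"
      proof (cases "Poly_Mapping.lookup m i > 0")
        case True
        have "Poly_Mapping.lookup (Poly_Mapping.single (e i) (v $ i) * linear_form v ^ d) m
            = v $ i * Poly_Mapping.lookup (linear_form v ^ d) (m - e i)"
          using lookup_single_mult_add[of "e i" "v $ i" "linear_form v ^ d" "m - e i"] split[OF True] by simp
        also have "\<dots> = v $ i * (of_nat (k (m - e i)) * monomial_value v (m - e i))"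
          using k(2)[OF deg[OF m True]] by simp
        also have "\<dots> = of_nat (k (m - e i)) * (monomial_value v (e i) * monomial_value v (m - e i))"
          by (simp add: e_def monomial_value_single del: One_nat_def)
        also have "monomial_value v (e i) * monomial_value v (m - e i) = monomial_value v m"
          unfolding monomial_value_add[symmetric] using split[OF True] by simp
        finally show ?thesis using True by simp
      next
        case False
        then have "\<nexists>k. m = e i + k" by (auto simp: e_def lookup_add)
        then show ?thesis using False lookup_single_mult_0 by auto
      qed
    qed
    also have "\<dots> = of_nat (k' m) * monomial_value v m"
      by (simp add: k'_def sum_distrib_right)
    finally show "Poly_Mapping.lookup (linear_form v ^ Suc d) m = of_nat (k' m) * monomial_value v m" .
  qed
qed

text \<open>Up to positive multinomial factors, the coefficients of a power of a linear form are the
  monomials evaluated at its coordinates. Comparing coefficients gives the claim for monomials,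
  hence for all forms.\<close>

lemma power_sum_relation:
  fixes Z :: "'n::finite proj set"
  assumes Z: "(\<Sum>x\<in>Z. poly_scale (c x) (veronese d x)) = 0" and p: "homogeneous d p"
  shows "(\<Sum>x\<in>Z. c x * poly_eval p (rep_proj x)) = 0"
proof -
  obtain k :: "('n \<Rightarrow>\<^sub>0 nat) \<Rightarrow> nat" where k: "\<And>m. mdeg m = d \<Longrightarrow> k m > 0"
    "\<And>v m. mdeg m = d \<Longrightarrow> Poly_Mapping.lookup (linear_form v ^ d) m = of_nat (k m) * monomial_value v m"
    using lookup_linear_form_power[of d] by blast
  have z: "(\<Sum>x\<in>Z. c x * monomial_value (rep_proj x) m) = 0" if "mdeg m = d" for m
  proof -
    have "0 = (\<Sum>x\<in>Z. c x * Poly_Mapping.lookup (linear_form (rep_proj x) ^ d) m)"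
      using arg_cong[OF Z, of "\<lambda>p. Poly_Mapping.lookup p m"]
      by (simp add: lookup_sum lookup_poly_scale veronese_def)
    also have "\<dots> = of_nat (k m) * (\<Sum>x\<in>Z. c x * monomial_value (rep_proj x) m)"
      unfolding sum_distrib_left using k(2)[OF that] by (intro sum.cong) (simp_all add: ac_simps)
    finally show ?thesis using k(1)[OF that] by simp
  qed
  have "(\<Sum>x\<in>Z. c x * poly_eval p (rep_proj x))
      = (\<Sum>m\<in>Poly_Mapping.keys p. Poly_Mapping.lookup p m * (\<Sum>x\<in>Z. c x * monomial_value (rep_proj x) m))"
    unfolding poly_eval_def sum_distrib_left
    by (subst sum.swap) (intro sum.cong refl, simp add: ac_simps)
  also have "\<dots> = 0"
    using z p by (intro sum.neutral) (simp add: homogeneous_def)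
  finally show ?thesis .
qed

abbreviation point_ideal :: "'n::finite proj set \<Rightarrow> nat \<Rightarrow> 'n cpoly set" where
  "point_ideal Z \<equiv> \<lambda>d. forms_through d Z"

lemma point_ideal_antimono: "Y \<subseteq> Z \<Longrightarrow> point_ideal Z d \<subseteq> point_ideal Y d"
  by (auto simp: forms_through_def)

text \<open>Rank-nullity for evaluation at the points, whose kernel consists of the forms through
  \<open>Z\<close>.\<close>

lemma hilbert_function_eq_hf: "hilbert_function Z d = hf (point_ideal Z) d"
proof -
  let ?E = "\<lambda>p x. if x \<in> Z then poly_eval p (rep_proj x) else 0"
  interpret L: Vector_Spaces.linear poly_scale "\<lambda>(c :: complex) (f :: 'a proj \<Rightarrow> complex) x. c * f x" ?E
    unfolding Vector_Spaces.linear_iff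
    using cpoly.vector_space_axioms cfun.vector_space_axioms by (auto simp: fun_eq_iff)
  have "cfun.dim {w + ?E v |w v. w \<in> {0} \<and> v \<in> forms d} + cpoly.dim {v \<in> forms d. ?E v \<in> {0}}
      = cfun.dim {0 :: 'a proj \<Rightarrow> complex} + cpoly.dim (forms d :: 'a cpoly set)"
    by (rule L.dim_preimage_plus_sum[OF subspace_forms fin_dim_forms])
      (simp_all add: cfun.fin_dim_finite)
  moreover have "{w + ?E v |w v. w \<in> {0} \<and> v \<in> forms d} = ?E ` forms d" by auto
  moreover have "{v \<in> forms d. ?E v \<in> {0}} = point_ideal Z d"
    by (auto simp: forms_through_iff fun_eq_iff)
  moreover have "cfun.dim {0 :: 'a proj \<Rightarrow> complex} = 0"
    using cfun.dim_le_card[of "{0}" "{}"] by simp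
  ultimately show ?thesis by (simp add: hilbert_function_def hf_def)
qed

lemma hf_points_le:
  assumes "finite Z"
  shows "hf (point_ideal Z) d \<le> card Z"
proof -
  let ?E = "\<lambda>p x. if x \<in> Z then poly_eval p (rep_proj x) else 0"
  let ?\<delta> = "\<lambda>(y :: 'a proj) (x :: 'a proj). if x = y then 1 else 0 :: complex"
  have "?E p \<in> cfun.span (?\<delta> ` Z)" for p
  proof -
    have sum_apply: "(\<Sum>y\<in>Z. F y) x = (\<Sum>y\<in>Z. F y x)" for F :: "'a proj \<Rightarrow> 'a proj \<Rightarrow> complex" and x
      by (induction Z rule: infinite_finite_induct) simp_all
    have "?E p = (\<Sum>y\<in>Z. (\<lambda>x. poly_eval p (rep_proj y) * ?\<delta> y x))"
      using assms by (auto simp: fun_eq_iff sum_apply if_distrib cong: if_cong)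
    also have "\<dots> \<in> cfun.span (?\<delta> ` Z)"
      by (intro cfun.span_sum cfun.span_scale cfun.span_base) auto
    finally show ?thesis .
  qed
  then have "hilbert_function Z d \<le> card (?\<delta> ` Z)"
    unfolding hilbert_function_def using assms by (intro cfun.dim_le_card) auto
  then show ?thesis
    unfolding hilbert_function_eq_hf using card_image_le[OF assms, of ?\<delta>] by simp
qed

lemma hf_points_ge:
  assumes "finite Z" "card Z \<le> d"
  shows "card Z \<le> hf (point_ideal Z) d"
  using assms
proof (induction Z rule: finite_induct)
  case (insert x Z)
  have sub: "point_ideal (insert x Z) d \<subseteq> point_ideal Z d" by (intro point_ideal_antimono) blast
  have "point_ideal (insert x Z) d \<noteq> point_ideal Z d"
    using separating_form[of Z x d] insert by (auto simp: forms_through_iff)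
  then have "hf (point_ideal Z) d < hf (point_ideal (insert x Z)) d"
    using hf_le_imp_eq[OF graded_ideal_forms_through graded_ideal_forms_through sub] by (metis not_le)
  then show ?case using insert by simp
qed simp

text \<open>When all points impose independent conditions, dropping one of them must admit a new
  form.\<close>

lemma separating_form_if_hf:
  assumes "finite Z" "hf (point_ideal Z) d = card Z" "x \<in> Z"
  shows "\<exists>p. p \<in> point_ideal (Z - {x}) d \<and> poly_eval p (rep_proj x) \<noteq> 0"
proof -
  have sub: "point_ideal Z d \<subseteq> point_ideal (Z - {x}) d" by (intro point_ideal_antimono) blast
  have "hf (point_ideal (Z - {x})) d < hf (point_ideal Z) d"
    using hf_points_le[of "Z - {x}" d] assms card_Diff1_less[OF assms(1,3)] by simp
  then have "point_ideal Z d \<noteq> point_ideal (Z - {x}) d" by (auto simp: hf_def)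
  then obtain p where "p \<in> point_ideal (Z - {x}) d" "p \<notin> point_ideal Z d"
    using sub by blast
  then show ?thesis using assms(3) by (auto simp: forms_through_iff)
qed

text \<open>Apolarity: apply the relation to the product of \<open>p\<close> with a form of degree \<open>i\<close> that separates one
  point of \<open>X\<close> from the others.\<close>

lemma vanishing_transfer:
  assumes W: "finite W" and rel: "\<And>p. homogeneous (i + j) p \<Longrightarrow> (\<Sum>x\<in>W. c x * poly_eval p (rep_proj x)) = 0"
    and X: "X \<subseteq> W" "hf (point_ideal X) i = card X" "\<And>x. x \<in> X \<Longrightarrow> c x \<noteq> 0"
    and p: "homogeneous j p" "\<And>x. x \<in> W - X \<Longrightarrow> c x \<noteq> 0 \<Longrightarrow> poly_eval p (rep_proj x) = 0"
  shows "p \<in> point_ideal X j"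
  unfolding forms_through_iff
proof (intro conjI ballI)
  fix x assume x: "x \<in> X"
  obtain q where q: "q \<in> point_ideal (X - {x}) i" "poly_eval q (rep_proj x) \<noteq> 0"
    using separating_form_if_hf[OF finite_subset[OF X(1) W] X(2) x] by blast
  have "homogeneous (i + j) (q * p)" using q(1) p(1) by (intro homogeneous_mult) (simp_all add: forms_through_iff)
  then have "0 = (\<Sum>y\<in>W. c y * poly_eval (q * p) (rep_proj y))" by (rule rel[symmetric])
  also have "\<dots> = (\<Sum>y\<in>W. if y = x then c x * poly_eval (q * p) (rep_proj x) else 0)"
  proof (intro sum.cong refl)
    fix y assume y: "y \<in> W"
    show "c y * poly_eval (q * p) (rep_proj y) = (if y = x then c x * poly_eval (q * p) (rep_proj x) else 0)"
    proof (cases "y \<in> X")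
      case True
      then show ?thesis using q(1) by (auto simp: forms_through_iff)
    next
      case False
      then show ?thesis using p(2)[of y] x y by auto
    qed
  qed
  also have "\<dots> = c x * poly_eval (q * p) (rep_proj x)" using x X(1) W by auto
  finally show "poly_eval p (rep_proj x) = 0" using q(2) X(3)[OF x] by simp
qed (rule p)

lemma vanishes_at_abs_proj:
  assumes "homogeneous d p" "v \<noteq> 0"
  shows "vanishes_at p (abs_proj v) \<longleftrightarrow> poly_eval p v = 0"
proof
  show "vanishes_at p (abs_proj v) \<Longrightarrow> poly_eval p v = 0" using assms(2) by (auto simp: vanishes_at_def)
  assume "poly_eval p v = 0"
  moreover have "\<exists>c. w = c *s v" if "w \<noteq> 0" "abs_proj w = abs_proj v" for w
    using that abs_proj_eq_iff[OF assms(2) that(1)] by (auto simp: proportional_def)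
  ultimately show "vanishes_at p (abs_proj v)"
    unfolding vanishes_at_def using poly_eval_scale_vec[OF assms(1)] by (metis mult_zero_right)
qed

lemma vanishes_at_mult:
  assumes "homogeneous d p" "homogeneous e q"
  shows "vanishes_at (p * q) x \<longleftrightarrow> vanishes_at p x \<or> vanishes_at q x"
  by (simp add: vanishes_at_iff[OF homogeneous_mult[OF assms]] vanishes_at_iff[OF assms(1)] vanishes_at_iff[OF assms(2)])

section \<open>Dimension and vanishing ideals of finite sets\<close>

lemma finite_zariski_closed:
  assumes "finite Z"
  shows "zariski_closed Z"
  unfolding zariski_closed_def
proof (intro exI[of _ "\<Union>d. forms_through d Z"] conjI)
  show "\<forall>p\<in>\<Union>d. forms_through d Z. \<exists>d. homogeneous d p" by (auto simp: forms_through_def)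
  have "x \<in> Z" if x: "x \<in> zero_locus (\<Union>d. forms_through d Z)" for x
  proof (rule ccontr)
    assume "x \<notin> Z"
    then obtain p where p: "p \<in> forms_through (card Z) Z" "poly_eval p (rep_proj x) \<noteq> 0"
      using separating_form[OF assms] by blast
    then show False using x vanishes_at_iff[of "card Z" p x]
      by (auto simp: zero_locus_def forms_through_iff)
  qed
  moreover have "x \<in> zero_locus (\<Union>d. forms_through d Z)" if "x \<in> Z" for x
    using that unfolding zero_locus_def forms_through_def by blast
  ultimately show "Z = zero_locus (\<Union>d. forms_through d Z)" by blast
qed

lemma has_dimension_finite:
  assumes "finite Z" "Z \<noteq> {}"
  shows "has_dimension Z 0"
  unfolding has_dimension_def
proof (intro conjI allI impI)
  obtain x where "x \<in> Z" using assms(2) by blast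
  then have "irreducible_chain Z 0 (\<lambda>_. {x})"
    unfolding irreducible_chain_def zariski_irreducible_def using finite_zariski_closed[of "{x}"] by auto
  then show "\<exists>W. irreducible_chain Z 0 W" by blast
next
  fix n W assume W: "irreducible_chain Z n W"
  show "n \<le> 0"
  proof (rule ccontr)
    assume "\<not> n \<le> 0"
    then have n: "0 < n" by simp
    have 0: "W 0 \<noteq> {}" "W 0 \<subset> W (Suc 0)" and 1: "zariski_irreducible (W (Suc 0))" "W (Suc 0) \<subseteq> Z"
      using W n unfolding irreducible_chain_def zariski_irreducible_def by auto
    have fin: "finite (W (Suc 0))" using 1(2) assms(1) finite_subset by blast
    \<comment> \<open>Finite sets are closed, so the larger member of the chain would split into two
      proper closed parts.\<close>
    have "W (Suc 0) \<subseteq> W 0 \<union> (W (Suc 0) - W 0)" by blast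
    moreover have "zariski_closed (W 0)" "zariski_closed (W (Suc 0) - W 0)"
      using fin 0 by (auto intro!: finite_zariski_closed intro: finite_subset)
    ultimately have "W (Suc 0) \<subseteq> W 0 \<or> W (Suc 0) \<subseteq> W (Suc 0) - W 0"
      using 1(1) unfolding zariski_irreducible_def by blast
    then show False using 0 by blast
  qed
qed

lemma sum_hom_components: "p = (\<Sum>e\<in>mdeg ` Poly_Mapping.keys p. hom_component e p)"
proof (rule poly_mapping_eqI)
  fix m
  have "Poly_Mapping.lookup (\<Sum>e\<in>mdeg ` Poly_Mapping.keys p. hom_component e p) m
      = (\<Sum>e\<in>mdeg ` Poly_Mapping.keys p. if e = mdeg m then Poly_Mapping.lookup p m else 0)"
    unfolding lookup_sum by (intro sum.cong) (auto simp: lookup_hom_component)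
  also have "\<dots> = Poly_Mapping.lookup p m"
    by (auto simp: in_keys_iff image_iff)
  finally show "Poly_Mapping.lookup p m = Poly_Mapping.lookup (\<Sum>e\<in>mdeg ` Poly_Mapping.keys p. hom_component e p) m"
    by simp
qed

text \<open>\<open>vanishing_ideal\<close> also contains inhomogeneous polynomials. Such a
  \<open>p\<close> vanishes at all nonzero multiples of the coordinate vector; as a polynomial in
  the scaling factor it is zero, and its coefficients are the values of the components.\<close>

lemma vanishes_at_hom_component:
  assumes "vanishes_at p x"
  shows "poly_eval (hom_component d p) (rep_proj x) = 0"
proof -
  let ?v = "rep_proj x" and ?D = "mdeg ` Poly_Mapping.keys p"
  define u where "u = (\<Sum>e\<in>?D. Polynomial.monom (poly_eval (hom_component e p) ?v) e)"
  have "poly_eval p (t *s ?v) = (\<Sum>e\<in>?D. poly_eval (hom_component e p) (t *s ?v))" for t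
    by (subst sum_hom_components[of p]) (rule poly_eval_sum)
  then have eval: "poly u t = poly_eval p (t *s ?v)" for t
    by (simp add: u_def poly_sum poly_monom poly_eval_scale_vec[OF homogeneous_hom_component] mult.commute)
  have "poly u t = 0" if "t \<noteq> 0" for t
  proof -
    have "t *s ?v \<noteq> 0" using that rep_proj_nonzero by simp
    moreover have "abs_proj (t *s ?v) = x"
      using that rep_proj_nonzero[of x] abs_proj_eq_iff[of ?v "t *s ?v"] abs_rep_proj[of x]
      by (auto simp: proportional_def)
    ultimately show ?thesis using assms by (simp add: eval vanishes_at_def)
  qed
  then have "UNIV - {0} \<subseteq> {t. poly u t = 0}" by auto
  then have "infinite {t. poly u t = 0}"
    using infinite_UNIV_char_0[where 'a = complex] by (metis finite_Diff2 finite_insert finite.emptyI finite_subset)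
  then have "u = 0" using poly_roots_finite by blast
  then have "poly.coeff u d = 0" by simp
  moreover have "poly.coeff u d = (if d \<in> ?D then poly_eval (hom_component d p) ?v else 0)"
    by (simp add: u_def coeff_sum)
  moreover have "hom_component d p = 0" if "d \<notin> ?D"
    using that by (intro poly_mapping_eqI) (auto simp: lookup_hom_component in_keys_iff)
  ultimately show ?thesis by (auto split: if_splits)
qed

section \<open>The irreducible curve cut out by a pencil of cubics\<close>

text \<open>\<open>line_hf\<close> is zero from degree 5 on, so its assumption says algebraically
  that the line \<open>l1 = l2 = 0\<close> misses the curve. The last assumption makes the
  homogeneous ideal of C prime.\<close>

locale irreducible_pencil =
  fixes f g l1 l2 :: "4 cpoly" and C :: "4 proj set"
  assumes f: "homogeneous 3 f" "f \<noteq> 0" and g: "homogeneous 3 g"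
    and l1: "homogeneous 1 l1" and l2: "homogeneous 1 l2"
    and line_hf: "\<And>d. hf (adjoin (adjoin (adjoin (adjoin zero_ideal 3 f) 3 g) 1 l1) 1 l2) d = line_hf d"
    and C_iff: "\<And>x. x \<in> C \<longleftrightarrow> vanishes_at f x \<and> vanishes_at g x"
    and irreducible: "\<And>d e p q. homogeneous d p \<Longrightarrow> homogeneous e q \<Longrightarrow>
      p * q \<in> point_ideal C (d + e) \<Longrightarrow> p \<in> point_ideal C d \<or> q \<in> point_ideal C e"
begin

definition I :: "nat \<Rightarrow> 4 cpoly set" where
  "I = adjoin (adjoin zero_ideal 3 f) 3 g"

lemma I: "graded_ideal I"
  unfolding I_def by (intro graded_ideal_adjoin graded_ideal_zero f g)

lemma generators_in_I: "f \<in> I 3" "g \<in> I 3"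
  unfolding I_def
  using generator_in_adjoin[OF graded_ideal_zero] generator_in_adjoin[OF graded_ideal_adjoin[OF graded_ideal_zero f(1)]]
    subset_adjoin[OF graded_ideal_adjoin[OF graded_ideal_zero f(1)]]
  by blast+

lemma I_cases:
  assumes "p \<in> I d"
  obtains r s where "p = r * f + s * g"
  using assms unfolding I_def by (elim adjoinE) auto

lemma I_subset:
  assumes "graded_ideal K" "f \<in> K 3" "g \<in> K 3"
  shows "I d \<subseteq> K d"
  unfolding I_def
proof (rule adjoin_subset[OF graded_ideal_adjoin[OF graded_ideal_zero f(1)] assms(1) _ assms(3)])
  show "adjoin zero_ideal 3 f d \<subseteq> K d" for d
    using gi_zero[OF assms(1)] by (intro adjoin_subset[OF graded_ideal_zero assms(1) _ assms(2)]) simp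
qed

lemma I_subset_C: "I d \<subseteq> point_ideal C d"
  using C_iff f g by (intro I_subset[OF graded_ideal_forms_through]) (auto simp: forms_through_def)

context
  fixes c :: complex
begin

lemma plane_section:
  "hf I d = curve_hf d" "hf (adjoin I 1 (l1 - poly_scale c l2)) d = plane_hf d"
  "nonzerodivisor I 1 (l1 - poly_scale c l2)"
  "nonzerodivisor (adjoin I 1 (l1 - poly_scale c l2)) 1 l2"
proof -
  let ?l = "l1 - poly_scale c l2"
  have l: "homogeneous 1 ?l" by (intro homogeneous_diff homogeneous_scale l1 l2)
  have "hf (adjoin (adjoin I 1 ?l) 1 l2) d \<le> line_hf d" for d
    unfolding adjoin_change_generator using line_hf by (simp add: I_def)
  from hilbert_functions_of_curve[OF f g l l2, folded I_def, OF this]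
  show "hf I d = curve_hf d" "hf (adjoin I 1 ?l) d = plane_hf d" "nonzerodivisor I 1 ?l"
    "nonzerodivisor (adjoin I 1 ?l) 1 l2" .
qed

end

lemma poly_eval_homogenize: "poly_eval (homogenize x l N P) v = (\<Sum>n\<le>N. poly.coeff P n * (poly_eval x v ^ n * poly_eval l v ^ (N - n)))"
  by (simp add: homogenize_def poly_eval_sum)

lemma homogeneous_homogenize_pencil: "homogeneous N (homogenize l1 l2 N P)"
proof -
  have "homogeneous N (l1 ^ i * l2 ^ (N - i))" if "i \<le> N" for i
    using homogeneous_mult[OF homogeneous_power1[OF l1, of i] homogeneous_power1[OF l2, of "N - i"]] that by simp
  then show ?thesis unfolding homogenize_def by (intro homogeneous_sum homogeneous_scale) auto
qed

text \<open>Counting shows that the powers of \<open>h\<close> satisfy a polynomial relation modulo the pencil over the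
  binary forms in \<open>l1\<close> and \<open>l2\<close>. After division by a power of \<open>h\<close>, which irreducibility allows, its
  lowest coefficient confines the zeros of \<open>h\<close> on the curve to finitely many planes through the line
  \<open>l1 = l2 = 0\<close>.\<close>

lemma relation_over_pencil:
  assumes h: "homogeneous e h" "0 < e"
  shows "\<exists>P. (\<Sum>i\<le>18. h ^ i * homogenize l1 l2 (e * (18 - i)) (P i)) \<in> I (18 * e)
    \<and> (\<forall>i\<le>18. degree (P i) \<le> e * (18 - i)) \<and> (\<exists>i\<le>18. P i \<noteq> 0)"
proof -
  let ?T = "SIGMA i:{..18}. {..e * (18 - i)}"
  let ?u = "\<lambda>(i, j). h ^ i * (l1 ^ j * l2 ^ (e * (18 - i) - j))"
  \<comment> \<open>Exponents up to N give \<open>e * N * (N + 1) / 2 + N + 1\<close> products,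
    quadratic in N, against \<open>9 * N * e - 9\<close> for the Hilbert function; N = 18 is large
    enough.\<close>
  have "card ?T = (\<Sum>i\<le>18. e * (18 - i) + 1)" by (simp add: card_SigmaI)
  also have "\<dots> = 171 * e + 19" by (simp add: numeral_eq_Suc)
  finally have card: "card ?T = 171 * e + 19" .
  have "\<exists>c. (\<Sum>t\<in>?T. poly_scale (c t) (?u t)) \<in> I (18 * e) \<and> (\<exists>t\<in>?T. c t \<noteq> 0)"
  proof (rule relation_modulo_ideal[OF I])
    fix t assume "t \<in> ?T"
    then obtain i j where t: "t = (i, j)" "i \<le> 18" "j \<le> e * (18 - i)" by auto
    have "homogeneous (i * e + (j + (e * (18 - i) - j))) (?u t)"
      unfolding t(1) prod.case
      by (intro homogeneous_mult homogeneous_power homogeneous_power1 h l1 l2)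
    moreover have "i * e + (j + (e * (18 - i) - j)) = 18 * e"
      using t(2,3) by (simp add: mult.commute[of _ e] add_mult_distrib2[symmetric])
    ultimately show "homogeneous (18 * e) (?u t)" by simp
  next
    show "hf I (18 * e) < card ?T"
      using h(2) plane_section(1)[of "18 * e"] card by (simp add: curve_hf_def)
  qed simp
  then obtain c where c: "(\<Sum>t\<in>?T. poly_scale (c t) (?u t)) \<in> I (18 * e)" "\<exists>t\<in>?T. c t \<noteq> 0" by blast
  define P where "P i = (\<Sum>j\<le>e * (18 - i). Polynomial.monom (c (i, j)) j)" for i
  have coeff: "poly.coeff (P i) j = (if j \<le> e * (18 - i) then c (i, j) else 0)" for i j
    by (simp add: P_def coeff_sum)
  have "(\<Sum>t\<in>?T. poly_scale (c t) (?u t))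
      = (\<Sum>i\<le>18. \<Sum>j\<le>e * (18 - i). poly_scale (c (i, j)) (h ^ i * (l1 ^ j * l2 ^ (e * (18 - i) - j))))"
    by (subst sum.Sigma) (auto intro!: sum.cong)
  also have "\<dots> = (\<Sum>i\<le>18. h ^ i * homogenize l1 l2 (e * (18 - i)) (P i))"
    unfolding homogenize_def sum_distrib_left
    by (intro sum.cong refl) (simp add: coeff mult_poly_scale)
  finally have "(\<Sum>i\<le>18. h ^ i * homogenize l1 l2 (e * (18 - i)) (P i)) \<in> I (18 * e)" using c(1) by simp
  moreover have "degree (P i) \<le> e * (18 - i)" for i by (rule degree_le) (simp add: coeff)
  moreover have "\<exists>i\<le>18. P i \<noteq> 0"
  proof -
    obtain i j where "i \<le> 18" "j \<le> e * (18 - i)" "c (i, j) \<noteq> 0" using c(2) by auto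
    then have "poly.coeff (P i) j \<noteq> 0" by (simp add: coeff)
    then show ?thesis using \<open>i \<le> 18\<close> by (intro exI[of _ i]) auto
  qed
  ultimately show ?thesis by blast
qed

lemma cancel_power:
  assumes h: "homogeneous e h" "h \<notin> point_ideal C e" and G: "homogeneous d G"
  shows "h ^ k * G \<in> point_ideal C (k * e + d) \<Longrightarrow> G \<in> point_ideal C d"
proof (induction k)
  case (Suc k)
  have hk: "homogeneous (k * e + d) (h ^ k * G)" by (intro homogeneous_mult homogeneous_power h(1) G)
  have "h * (h ^ k * G) \<in> point_ideal C (e + (k * e + d))" using Suc.prems by (simp add: ac_simps)
  then show ?case using irreducible[OF h(1) hk] h(2) Suc.IH by blast
qed simp

lemma good_plane:
  assumes h: "homogeneous e h" "0 < e" "h \<notin> point_ideal C e"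
  shows "\<exists>c. nonzerodivisor (adjoin I 1 (l1 - poly_scale c l2)) e h"
proof -
  obtain P where P: "(\<Sum>i\<le>18. h ^ i * homogenize l1 l2 (e * (18 - i)) (P i)) \<in> I (18 * e)"
    "\<forall>i\<le>18. degree (P i) \<le> e * (18 - i)" "\<exists>i\<le>18. P i \<noteq> 0"
    using relation_over_pencil[OF h(1,2)] by blast
  define k where "k = (LEAST i. i \<le> 18 \<and> P i \<noteq> 0)"
  have k: "k \<le> 18" "P k \<noteq> 0" using LeastI_ex[OF P(3)] by (auto simp: k_def)
  have least: "P i = 0" if "i < k" for i
    using not_less_Least[of i "\<lambda>i. i \<le> 18 \<and> P i \<noteq> 0"] that k(1) by (auto simp: k_def)
  let ?H = "\<lambda>i. homogenize l1 l2 (e * (18 - i)) (P i)"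
  define G where "G = (\<Sum>i\<in>{k..18}. h ^ (i - k) * ?H i)"
  define R where "R = (\<Sum>i\<in>{k<..18}. h ^ (i - k - 1) * ?H i)"
  have "(\<Sum>i\<le>18. h ^ i * ?H i) = (\<Sum>i\<in>{k..18}. h ^ i * ?H i)"
    using least by (intro sum.mono_neutral_right) (auto simp: homogenize_def)
  also have "\<dots> = h ^ k * G"
    unfolding G_def sum_distrib_left
    by (intro sum.cong refl) (simp add: mult.assoc[symmetric] power_add[symmetric])
  finally have hG: "h ^ k * G \<in> I (18 * e)" using P(1) by simp
  have homG: "homogeneous (e * (18 - k)) G"
    unfolding G_def
  proof (rule homogeneous_sum)
    fix i assume i: "i \<in> {k..18}"
    have "homogeneous ((i - k) * e + e * (18 - i)) (h ^ (i - k) * ?H i)"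
      by (intro homogeneous_mult homogeneous_power h(1) homogeneous_homogenize_pencil)
    moreover have "(i - k) * e + e * (18 - i) = e * (18 - k)"
      using i by (simp add: mult.commute[of _ e] add_mult_distrib2[symmetric])
    ultimately show "homogeneous (e * (18 - k)) (h ^ (i - k) * ?H i)" by simp
  qed
  have "k * e + e * (18 - k) = 18 * e"
    using k(1) by (simp add: mult.commute[of _ e] add_mult_distrib2[symmetric])
  then have GC: "G \<in> point_ideal C (e * (18 - k))"
    using cancel_power[OF h(1,3) homG, of k] hG I_subset_C by auto
  have G: "G = ?H k + h * R"
  proof -
    have "G = h ^ (k - k) * ?H k + (\<Sum>i\<in>{k<..18}. h ^ (i - k) * ?H i)"
      unfolding G_def using k(1) by (rule sum.head)
    also have "(\<Sum>i\<in>{k<..18}. h ^ (i - k) * ?H i) = h * R"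
      unfolding R_def sum_distrib_left
    proof (intro sum.cong refl)
      fix i assume "i \<in> {k<..18}"
      then have "i - k = Suc (i - k - 1)" by auto
      then show "h ^ (i - k) * ?H i = h * (h ^ (i - k - 1) * ?H i)"
        by (metis mult.assoc power_Suc)
    qed
    finally show ?thesis by simp
  qed
  \<comment> \<open>At a point of C in the plane \<open>l1 = c l2\<close>, normalized by
    \<open>l2 = 1\<close>, the vanishing of \<open>G\<close> says that \<open>poly (P k) c\<close>
    plus a multiple of the value of \<open>h\<close> is 0. A non-root \<open>c\<close> thus forces
    \<open>h\<close> to be nonzero there.\<close>
  obtain c where c: "poly (P k) c \<noteq> 0" using k(2) poly_all_0_iff_0 by blast
  let ?l = "l1 - poly_scale c l2"
  have l: "homogeneous 1 ?l" by (intro homogeneous_diff homogeneous_scale l1 l2)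
  have "nonzerodivisor (adjoin I 1 ?l) e h"
  proof (rule nonzerodivisor_if_no_common_zero[OF graded_ideal_adjoin[OF I l] l2 h(1) plane_section(4)])
    show "hf (adjoin I 1 ?l) d = 9" if "4 \<le> d" for d
      using plane_section(2)[of c d] that by (simp add: plane_hf_def)
  next
    fix v assume v: "poly_eval l2 v = 1" and z: "\<And>d p. p \<in> adjoin I 1 ?l d \<Longrightarrow> poly_eval p v = 0"
    have v0: "v \<noteq> 0"
    proof
      assume "v = 0"
      then have "v = 0 *s v" by simp
      then show False using poly_eval_scale_vec[OF l2, of 0 v] v by simp
    qed
    have "poly_eval ?l v = 0" using z[OF generator_in_adjoin[OF I]] .
    then have l1v: "poly_eval l1 v = c" using v by simp
    have "poly_eval f v = 0" "poly_eval g v = 0"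
      using z subset_adjoin[OF I] generators_in_I by blast+
    then have "abs_proj v \<in> C"
      using C_iff vanishes_at_abs_proj[OF f(1) v0] vanishes_at_abs_proj[OF g v0] by blast
    then have "poly_eval G v = 0"
      using GC vanishes_at_abs_proj[OF homG v0] by (auto simp: forms_through_def)
    moreover have "poly_eval (?H k) v = poly (P k) c"
      unfolding poly_eval_homogenize l1v v
      using poly_altdef[of "P k" c] P(2) k(1)
      by (auto intro!: sum.mono_neutral_right intro: le_degree)
    ultimately show "poly_eval h v \<noteq> 0" using c unfolding G by auto
  qed
  then show ?thesis by blast
qed

text \<open>The plane of \<open>good_plane\<close> followed by \<open>h\<close> is a regular
  sequence on \<open>I\<close>, and it is permuted. So a zerodivisor of positive degree modulo
  \<open>I\<close> vanishes on C, although \<open>I\<close> need not be radical.\<close>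

lemma nonzerodivisor_if_not_vanishing:
  assumes h: "homogeneous e h" "0 < e" "h \<notin> point_ideal C e"
  shows "nonzerodivisor I e h" "\<exists>l. homogeneous 1 l \<and> nonzerodivisor (adjoin I e h) 1 l"
proof -
  obtain c where c: "nonzerodivisor (adjoin I 1 (l1 - poly_scale c l2)) e h" using good_plane[OF h] by blast
  have l: "homogeneous 1 (l1 - poly_scale c l2)" by (intro homogeneous_diff homogeneous_scale l1 l2)
  show "nonzerodivisor I e h" "\<exists>l. homogeneous 1 l \<and> nonzerodivisor (adjoin I e h) 1 l"
    using nonzerodivisor_lift[OF I l h(1) plane_section(3) c] l by blast+
qed

text \<open>A form \<open>a\<close> not vanishing on C could be cancelled from \<open>a * q\<close>,
  putting \<open>q\<close> into \<open>I\<close>. Constants are cancelled directly, since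
  \<open>nonzerodivisor_if_not_vanishing\<close> asks for positive degree.\<close>

lemma colon_subset_C:
  assumes q: "homogeneous e q" "q \<notin> I e"
  shows "colon I e q d \<subseteq> point_ideal C d"
proof
  fix a assume "a \<in> colon I e q d"
  then have a: "homogeneous d a" "a * q \<in> I (d + e)" by (auto simp: colon_def)
  show "a \<in> point_ideal C d"
  proof (rule ccontr)
    assume aC: "a \<notin> point_ideal C d"
    have qa: "q * a \<in> I (e + d)" using a(2) by (simp add: ac_simps)
    show False
    proof (cases "d = 0")
      case True
      then obtain c where c: "a = Poly_Mapping.single 0 c" using homogeneous_0_const a(1) by blast
      have "0 \<in> point_ideal C d" by (rule gi_zero[OF graded_ideal_forms_through])
      then have "c \<noteq> 0" using aC c by auto
      then have "q \<in> I e" using a(2) True gi_scale_iff[OF I] by (simp add: c poly_scale_def)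
      then show False using q(2) by simp
    next
      case False
      then show False
        using nonzerodivisorD[OF nonzerodivisor_if_not_vanishing(1)[OF a(1) _ aC] q(1) qa] q(2) by simp
    qed
  qed
qed

lemma hf_adjoin_I:
  assumes h: "homogeneous e h" "0 < e" "h \<notin> point_ideal C e" and d: "3 \<le> d"
  shows "hf (adjoin I e h) (d + e) = 9 * e"
  using hf_adjoin_nonzerodivisor[OF I h(1) nonzerodivisor_if_not_vanishing(1)[OF h], of d] plane_section(1) d
  by (simp add: curve_hf_def)

text \<open>For \<open>q\<close> outside \<open>I\<close> both \<open>(I, q)\<close> and
  \<open>(I : q)\<close> lie in the ideal of C, so twice the degree of C is at most 9. The 17
  conditions imposed by \<open>X\<close> on the zeros of the cubic \<open>h\<close> force degree at
  least 6.\<close>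

lemma quartic_vanishing_on_C:
  assumes X: "X \<subseteq> C" "\<And>d. 3 \<le> d \<Longrightarrow> 17 \<le> hf (point_ideal X) d"
    and h: "h \<in> point_ideal X 3" "h \<notin> point_ideal C 3"
    and q: "q \<in> point_ideal C 4"
  shows "q \<in> I 4"
proof (rule ccontr)
  assume qI: "q \<notin> I 4"
  let ?C = "point_ideal C"
  note giC = graded_ideal_forms_through[of C]
  have hh: "homogeneous 3 h" and hq: "homogeneous 4 q" using h(1) q by (auto simp: forms_through_def)
  have step: "17 + hf ?C d \<le> hf ?C (d + 3)" for d
  proof -
    have "adjoin ?C 3 h (d + 3) \<subseteq> point_ideal X (d + 3)"
      using point_ideal_antimono[OF X(1)] by (intro adjoin_subset[OF giC graded_ideal_forms_through] h(1))
    then have "hf (point_ideal X) (d + 3) \<le> hf (adjoin ?C 3 h) (d + 3)"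
      by (rule hf_antimono[OF graded_ideal_adjoin[OF giC hh] graded_ideal_forms_through])
    then have "17 \<le> hf (adjoin ?C 3 h) (d + 3)" using X(2)[of "d + 3"] by simp
    moreover have "colon ?C 3 h d \<subseteq> ?C d"
      using irreducible[OF _ hh] h(2) by (auto simp: colon_def)
    then have "hf ?C d \<le> hf (colon ?C 3 h) d"
      by (rule hf_antimono[OF graded_ideal_colon[OF giC hh] giC])
    ultimately show ?thesis using hf_split[OF giC hh, of d] by simp
  qed
  have "hf ?C 12 \<le> hf (adjoin I 4 q) 12"
    using adjoin_subset[OF I giC I_subset_C q] by (intro hf_antimono[OF graded_ideal_adjoin[OF I hq] giC])
  moreover have "hf ?C 8 \<le> hf (colon I 4 q) 8"
    using colon_subset_C[OF hq qI] by (intro hf_antimono[OF graded_ideal_colon[OF I hq] giC])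
  moreover have "hf I 12 = hf (adjoin I 4 q) 12 + hf (colon I 4 q) 8"
    using hf_split[OF I hq, of 8] by simp
  moreover have "hf I 12 = 99" using plane_section(1)[of 12] by (simp add: curve_hf_def)
  \<comment> \<open>Steps of 17 add up to at least 68 in degree 12 and 34 in degree 8, together 102,
    which exceeds 99.\<close>
  ultimately show False using step[of 0] step[of 3] step[of 6] step[of 9] step[of 2] step[of 5] by simp
qed

text \<open>Past degree \<open>e + 3\<close> the ideal \<open>(I, h, l)\<close> contains all forms,
  hence so does the ideal of \<open>Z\<close> together with \<open>l\<close>, and the Hilbert
  function of \<open>Z\<close> cannot grow any more. It reaches \<open>card Z\<close> eventually, so
  it has done so already.\<close>

lemma hf_points_stable:
  assumes h: "homogeneous e h" "0 < e" "h \<notin> point_ideal C e"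
    and Z: "finite Z" "\<And>d. adjoin I e h d \<subseteq> point_ideal Z d" and d: "e + 3 \<le> d"
  shows "hf (point_ideal Z) d = card Z"
proof -
  let ?J = "adjoin I e h"
  have J: "graded_ideal ?J" by (rule graded_ideal_adjoin[OF I h(1)])
  note giZ = graded_ideal_forms_through[of Z]
  obtain l where l: "homogeneous 1 l" "nonzerodivisor ?J 1 l" using nonzerodivisor_if_not_vanishing(2)[OF h] by blast
  have hfJ: "hf ?J d = 9 * e" if "e + 3 \<le> d" for d
    using hf_adjoin_I[OF h, of "d - e"] that by simp
  have step: "hf (point_ideal Z) (d + 1) \<le> hf (point_ideal Z) d" if "e + 3 \<le> d" for d
  proof -
    have "hf (adjoin ?J 1 l) (d + 1) = 0"
      using hf_adjoin_nonzerodivisor[OF J l, of d] hfJ that by simp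
    moreover have "adjoin ?J 1 l (d + 1) \<subseteq> adjoin (point_ideal Z) 1 l (d + 1)"
      by (rule adjoin_mono[where J = ?J and K = "point_ideal Z", OF Z(2)])
    then have "hf (adjoin (point_ideal Z) 1 l) (d + 1) \<le> hf (adjoin ?J 1 l) (d + 1)"
      by (rule hf_antimono[OF graded_ideal_adjoin[OF J l(1)] graded_ideal_adjoin[OF giZ l(1)]])
    ultimately show ?thesis using hf_adjoin_le[OF giZ l(1), of d] by simp
  qed
  have "hf (point_ideal Z) (d + k) \<le> hf (point_ideal Z) d" for k
  proof (induction k)
    case (Suc k)
    then show ?case using step[of "d + k"] d by simp
  qed simp
  from this[of "card Z"] have "card Z \<le> hf (point_ideal Z) d"
    using hf_points_ge[OF Z(1), of "d + card Z"] by simp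
  then show ?thesis using hf_points_le[OF Z(1), of d] by simp
qed

text \<open>Both ideals have Hilbert function \<open>9 * e\<close> in high degrees and agree there;
  a power of the linear nonzerodivisor carries the equality down to low degrees.\<close>

lemma point_ideal_eq_adjoin:
  assumes h: "homogeneous e h" "0 < e" "h \<notin> point_ideal C e"
    and Z: "finite Z" "\<And>d. adjoin I e h d \<subseteq> point_ideal Z d" "card Z = 9 * e"
  shows "point_ideal Z d = adjoin I e h d"
proof -
  let ?J = "adjoin I e h"
  have J: "graded_ideal ?J" by (rule graded_ideal_adjoin[OF I h(1)])
  obtain l where l: "homogeneous 1 l" "nonzerodivisor ?J 1 l" using nonzerodivisor_if_not_vanishing(2)[OF h] by blast
  have big: "?J k = point_ideal Z k" if "e + 3 \<le> k" for k
    using hf_points_stable[OF h Z(1,2) that] hf_adjoin_I[OF h, of "k - e"] that Z(3)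
    by (intro hf_le_imp_eq[OF J graded_ideal_forms_through Z(2)]) simp
  have "p \<in> ?J d" if p: "p \<in> point_ideal Z d" for p
  proof -
    have "l ^ (e + 3) * p \<in> point_ideal Z (d + (e + 3))"
      by (rule gi_mult[OF graded_ideal_forms_through p homogeneous_power1[OF l(1)]])
    then have "l ^ (e + 3) * p \<in> ?J (d + (e + 3))" using big[of "d + (e + 3)"] by simp
    then show ?thesis
      using nonzerodivisor_power[OF l(2,1) gi_homogeneous[OF graded_ideal_forms_through p]] by blast
  qed
  then show ?thesis using Z(2) by blast
qed

end

section \<open>Points in general position\<close>

lemma base_locus_iff: "x \<in> base_locus d Z \<longleftrightarrow> (\<forall>p\<in>forms_through d Z. vanishes_at p x)"
  by (simp add: base_locus_def zero_locus_def)

lemma subset_base_locus: "Z \<subseteq> base_locus d Z"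
  by (auto simp: base_locus_iff forms_through_def)

lemma irreducible_vanishing:
  assumes C: "zariski_irreducible C" and p: "homogeneous d p" and q: "homogeneous e q"
    and pq: "p * q \<in> point_ideal C (d + e)"
  shows "p \<in> point_ideal C d \<or> q \<in> point_ideal C e"
proof -
  have closed: "zariski_closed (zero_locus {r})" if "homogeneous k r" for k r
    unfolding zariski_closed_def using that by (intro exI[of _ "{r}"]) auto
  have "C \<subseteq> zero_locus {p} \<union> zero_locus {q}"
    using pq vanishes_at_mult[OF p q] by (auto simp: zero_locus_def forms_through_def)
  then have "C \<subseteq> zero_locus {p} \<or> C \<subseteq> zero_locus {q}"
    using C closed[OF p] closed[OF q] unfolding zariski_irreducible_def by blast
  then show ?thesis using p q by (auto simp: zero_locus_def forms_through_def)
qed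

lemma choose_three_ge: "k \<le> d \<Longrightarrow> (k + 3) choose 3 \<le> (d + 3) choose 3"
proof -
  assume "k \<le> d"
  then have "(k + 3) * (k + 2) * (k + 1) \<le> (d + 3) * (d + 2) * (d + 1)" by (intro mult_le_mono) simp_all
  then have "6 * ((k + 3) choose 3) \<le> 6 * ((d + 3) choose 3)" unfolding six_choose_three .
  then show ?thesis by simp
qed

locale general_points =
  fixes A :: "4 proj set"
  assumes gp: "general_position A" and card_A: "card A = 18"
begin

lemma finite_A: "finite A"
  by (rule card_ge_0_finite) (simp add: card_A)

lemma hf_general: "X \<subseteq> A \<Longrightarrow> hf (point_ideal X) i = min (card X) ((i + 3) choose 3)"
  using gp unfolding general_position_def hilbert_function_eq_hf by blast

lemma hf_general_cubic:
  assumes "X \<subseteq> A" "3 \<le> d"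
  shows "hf (point_ideal X) d = card X"
proof -
  have "card X \<le> 18" using card_mono[OF finite_A assms(1)] card_A by simp
  moreover have "20 \<le> (d + 3) choose 3"
    using choose_three_ge[OF assms(2)] by (simp add: numeral_eq_Suc)
  ultimately show ?thesis using hf_general[OF assms(1)] by simp
qed

text \<open>Otherwise the zeros in A would impose as many independent conditions as there are
  independent forms of degree \<open>k\<close>, leaving only the zero form.\<close>

lemma card_zeros_less:
  assumes q: "homogeneous k q" "q \<noteq> 0"
  shows "card {x \<in> A. poly_eval q (rep_proj x) = 0} < (k + 3) choose 3"
proof (rule ccontr)
  assume "\<not> ?thesis"
  then have "(k + 3) choose 3 \<le> card {x \<in> A. poly_eval q (rep_proj x) = 0}" by simp
  then obtain X where X: "X \<subseteq> {x \<in> A. poly_eval q (rep_proj x) = 0}" "card X = (k + 3) choose 3"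
    by (rule obtain_subset_with_card_n)
  then have "hf (point_ideal X) k = (k + 3) choose 3"
    using hf_general[of X k] by auto
  then have "cpoly.dim (point_ideal X k) \<le> cpoly.dim {0 :: 4 cpoly}"
    using dim_add_hf[OF graded_ideal_forms_through, of k X] by (simp add: dim_forms)
  then have "{0} = point_ideal X k"
    using gi_fin_dim[OF graded_ideal_forms_through, of k X] gi_zero[OF graded_ideal_forms_through, of k X]
    by (intro cpoly.fin_dim_subspace_eq) auto
  moreover have "q \<in> point_ideal X k" using X(1) q(1) by (auto simp: forms_through_iff)
  ultimately show False using q(2) by blast
qed

text \<open>The 18 points impose independent conditions on a space of cubics of dimension
  20.\<close>

lemma cubic_pencil:
  "\<exists>f g. point_ideal A 3 = {poly_scale a f + poly_scale b g |a b. True} \<and>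
    (\<forall>a b. poly_scale a f + poly_scale b g = 0 \<longrightarrow> a = 0 \<and> b = 0)"
proof -
  have "cpoly.dim (point_ideal A 3) = 2"
    using dim_add_hf[OF graded_ideal_forms_through, of 3 A] hf_general_cubic[of A 3] card_A
    by (simp add: dim_forms numeral_eq_Suc)
  then obtain B where B: "B \<subseteq> point_ideal A 3" "cpoly.independent B" "point_ideal A 3 \<subseteq> cpoly.span B" "card B = 2"
    using cpoly.fin_dim_basis[OF gi_fin_dim[OF graded_ideal_forms_through, of 3 A]] by metis
  then obtain f g where fg: "B = {f, g}" "f \<noteq> g" by (auto simp: card_2_iff)
  have span: "cpoly.span B = point_ideal A 3"
    using cpoly.span_minimal[OF B(1) gi_subspace[OF graded_ideal_forms_through]] B(3) by blast
  have sums: "(\<Sum>v\<in>B. poly_scale (u v) v) = poly_scale (u f) f + poly_scale (u g) g" for u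
    using fg by simp
  have "point_ideal A 3 = range (\<lambda>u. \<Sum>v\<in>B. poly_scale (u v) v)"
    unfolding span[symmetric] using fg by (intro cpoly.span_finite) simp
  also have "\<dots> = {poly_scale a f + poly_scale b g |a b. True}"
  proof (intro subset_antisym subsetI)
    fix p assume "p \<in> {poly_scale a f + poly_scale b g |a b. True}"
    then obtain a b where "p = poly_scale a f + poly_scale b g" by blast
    then have "p = (\<Sum>v\<in>B. poly_scale ((\<lambda>v. if v = f then a else b) v) v)"
      unfolding sums using fg(2) by simp
    then show "p \<in> range (\<lambda>u. \<Sum>v\<in>B. poly_scale (u v) v)" by (rule range_eqI[of _ _ "\<lambda>v. if v = f then a else b"])
  qed (auto simp: sums)
  finally have "point_ideal A 3 = {poly_scale a f + poly_scale b g |a b. True}" .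
  moreover have "a = 0 \<and> b = 0" if "poly_scale a f + poly_scale b g = 0" for a b
  proof -
    have "(\<Sum>v\<in>B. poly_scale ((\<lambda>v. if v = f then a else b) v) v) = 0"
      unfolding sums using that fg(2) by simp
    moreover have "finite B" using fg(1) by simp
    ultimately have "(\<lambda>v. if v = f then a else b) v = 0" if "v \<in> B" for v
      using cpoly.independent_explicit_finite_subsets[THEN iffD1, OF B(2), rule_format, OF subset_refl, of "\<lambda>v. if v = f then a else b" v] that
      by simp
    from this[of f] this[of g] show ?thesis using fg by auto
  qed
  ultimately show ?thesis by blast
qed

text \<open>A common factor of degree 3 makes \<open>f\<close> and \<open>g\<close> proportional. In
  degree 1 or 2 the cubic \<open>f\<close> splits into a plane and a quadric, which contain at most
  3 and 9 of the 18 points.\<close>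

lemma no_common_factor:
  assumes pencil: "f \<in> point_ideal A 3" "g \<in> point_ideal A 3"
    and indep: "\<And>a b. poly_scale a f + poly_scale b g = 0 \<Longrightarrow> a = 0 \<and> b = 0"
    and f: "f = p * a" and g: "g = p * b"
  shows "homogeneous 0 p"
proof (rule ccontr)
  assume "\<not> homogeneous 0 p"
  then have deg: "total_degree p \<noteq> 0" using total_degree_0 by blast
  let ?p = "hom_component (total_degree p) p"
  have hom: "homogeneous 3 f" "homogeneous 3 g" using pencil by (simp_all add: forms_through_iff)
  have f0: "f \<noteq> 0" using indep[of 1 0] by auto
  have g0: "g \<noteq> 0" using indep[of 0 1] by auto
  obtain n a' where a': "total_degree p + n = 3" "homogeneous n a'" "f = ?p * a'"
    using homogeneous_factor[of 3 p a] hom f0 f by blast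
  obtain n' b' where b': "total_degree p + n' = 3" "homogeneous n' b'" "g = ?p * b'"
    using homogeneous_factor[of 3 p b] hom g0 g by blast
  have p0: "?p \<noteq> 0" "a' \<noteq> 0" using f0 a'(3) by auto
  have "total_degree p = 3 \<or> total_degree p = 2 \<or> total_degree p = 1" using deg a'(1) by arith
  then show False
  proof (elim disjE)
    assume "total_degree p = 3"
    then have "homogeneous 0 a'" "homogeneous 0 b'" using a' b' by simp_all
    then obtain \<alpha> \<beta> where ab: "a' = Poly_Mapping.single 0 \<alpha>" "b' = Poly_Mapping.single 0 \<beta>"
      using homogeneous_0_const by metis
    have "f = poly_scale \<alpha> ?p" "g = poly_scale \<beta> ?p" using a'(3) b'(3) ab by (simp_all add: poly_scale_def mult.commute)
    then have "poly_scale \<beta> f + poly_scale (- \<alpha>) g = 0" by (simp add: mult.commute flip: cpoly.scale_left_distrib)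
    then have "\<alpha> = 0" using indep by fastforce
    then show False using p0(2) ab by simp
  next
    have hp: "homogeneous (total_degree p) ?p" by (rule homogeneous_hom_component)
    have "A \<subseteq> {x \<in> A. poly_eval ?p (rep_proj x) = 0} \<union> {x \<in> A. poly_eval a' (rep_proj x) = 0}"
      using pencil(1) a'(3) by (auto simp: forms_through_iff)
    then have "card A \<le> card ({x \<in> A. poly_eval ?p (rep_proj x) = 0} \<union> {x \<in> A. poly_eval a' (rep_proj x) = 0})"
      using finite_A by (intro card_mono) auto
    also have "\<dots> \<le> card {x \<in> A. poly_eval ?p (rep_proj x) = 0} + card {x \<in> A. poly_eval a' (rep_proj x) = 0}"
      by (rule card_Un_le)
    finally have le: "18 \<le> card {x \<in> A. poly_eval ?p (rep_proj x) = 0} + card {x \<in> A. poly_eval a' (rep_proj x) = 0}"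
      using card_A by simp
    have num: "(2 + 3) choose 3 = (10 :: nat)" "(1 + 3) choose 3 = (4 :: nat)" by (simp_all add: numeral_eq_Suc)
    {
      assume "total_degree p = 2"
      then show False
        using le card_zeros_less[OF hp p0(1)] card_zeros_less[OF a'(2) p0(2)] a'(1) num by simp
    next
      assume "total_degree p = 1"
      moreover from this have "n = 2" using a'(1) by simp
      ultimately show False
        using le card_zeros_less[OF hp p0(1)] card_zeros_less[OF a'(2) p0(2)] num by simp
    }
  qed
qed

lemma irreducible_pencil_exists:
  assumes C: "zariski_irreducible (base_locus 3 A)"
  shows "\<exists>f g l1 l2. irreducible_pencil f g l1 l2 (base_locus 3 A) \<and> f \<in> point_ideal A 3 \<and> g \<in> point_ideal A 3 \<and> g \<noteq> 0"
proof -
  obtain f g where fg: "point_ideal A 3 = {poly_scale a f + poly_scale b g |a b. True}"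
    "\<And>a b. poly_scale a f + poly_scale b g = 0 \<Longrightarrow> a = 0 \<and> b = 0"
    using cubic_pencil by blast
  have "f = poly_scale 1 f + poly_scale 0 g" "g = poly_scale 0 f + poly_scale 1 g" by simp_all
  then have mem: "f \<in> point_ideal A 3" "g \<in> point_ideal A 3" unfolding fg(1) by blast+
  then have hom: "homogeneous 3 f" "homogeneous 3 g" by (simp_all add: forms_through_iff)
  have f0: "f \<noteq> 0" using fg(2)[of 1 0] by auto
  have g0: "g \<noteq> 0" using fg(2)[of 0 1] by auto
  obtain P Q x y l1 l2 where L: "line_coordinates P Q x y l1 l2" "poly_eval f P \<noteq> 0"
    "coprime (line_coordinates.restrict P Q f) (line_coordinates.restrict P Q g)"
    using exists_line_coordinates[OF hom(1) f0 hom(2)] no_common_factor[OF mem fg(2)] by blast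
  interpret L: line_coordinates P Q x y l1 l2 by (rule L)
  have "irreducible_pencil f g l1 l2 (base_locus 3 A)"
  proof
    show "hf (adjoin (adjoin (adjoin (adjoin zero_ideal 3 f) 3 g) 1 l1) 1 l2) d = line_hf d" for d
    proof -
      have "adjoin (adjoin (adjoin (adjoin zero_ideal 3 f) 3 g) 1 l1) 1 l2 = adjoin (adjoin L.line_ideal 3 f) 3 g"
        unfolding L.line_ideal_def
        by (metis adjoin_commute)
      then show ?thesis using L.hf_line_ideal_adjoin_coprime[OF hom(1) L(2) hom(2) L(3)] by simp
    qed
    show "x \<in> base_locus 3 A \<longleftrightarrow> vanishes_at f x \<and> vanishes_at g x" for x
      unfolding base_locus_iff
    proof
      assume "vanishes_at f x \<and> vanishes_at g x"
      then show "\<forall>p\<in>point_ideal A 3. vanishes_at p x"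
        unfolding fg(1) by (auto simp: vanishes_at_def)
    qed (use mem in blast)
  qed (use hom f0 L.linear irreducible_vanishing[OF C] in auto)
  then show ?thesis using mem g0 by blast
qed

section \<open>The relation between two decompositions\<close>

lemma decomposition_comparison:
  fixes F :: "4 cpoly"
  assumes A: "nonredundant_decomposition 6 F A" and B: "decomposition 6 F B"
  shows "\<exists>c. (\<forall>p. homogeneous 6 p \<longrightarrow> (\<Sum>x\<in>A \<union> B. c x * poly_eval p (rep_proj x)) = 0)
    \<and> (\<forall>x\<in>A - B. c x \<noteq> 0) \<and> 18 \<le> card B \<and>
    (card B = 18 \<longrightarrow> point_ideal (B - A) 3 = point_ideal (A - B) 3 \<and> (\<forall>x\<in>A \<inter> B. c x = 0))"
proof -
  obtain a where a: "\<And>x. x \<in> A \<Longrightarrow> a x \<noteq> 0" "F = (\<Sum>x\<in>A. poly_scale (a x) (veronese 6 x))"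
    using A unfolding nonredundant_decomposition_def by blast
  obtain b where b: "finite B" "F = (\<Sum>x\<in>B. poly_scale (b x) (veronese 6 x))"
    using B unfolding decomposition_def by blast
  define c where "c x = (if x \<in> A then a x else 0) - (if x \<in> B then b x else 0)" for x
  have "(\<Sum>x\<in>A \<union> B. poly_scale (if x \<in> A then a x else 0) (veronese 6 x)) = F"
    unfolding a(2) using finite_A b(1) by (intro sum.mono_neutral_cong_right) auto
  moreover have "(\<Sum>x\<in>A \<union> B. poly_scale (if x \<in> B then b x else 0) (veronese 6 x)) = F"
    unfolding b(2) using finite_A b(1) by (intro sum.mono_neutral_cong_right) auto
  ultimately have "(\<Sum>x\<in>A \<union> B. poly_scale (c x) (veronese 6 x)) = 0"
    by (simp add: c_def cpoly.scale_left_diff_distrib sum_subtractf)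
  then have rel: "(\<Sum>x\<in>A \<union> B. c x * poly_eval p (rep_proj x)) = 0" if "homogeneous 6 p" for p
    using that by (rule power_sum_relation)
  \<comment> \<open>Besides \<open>A - B\<close>, the set \<open>X\<close> holds the common points
    at which the two coefficients differ. For \<open>card B = 18\<close> the count forces
    \<open>X = A - B\<close>, so the coefficients agree on the intersection.\<close>
  define X where "X = {x \<in> A. c x \<noteq> 0}"
  have X: "X \<subseteq> A" "A - B \<subseteq> X" by (auto simp: X_def c_def a(1))
  have fin: "finite X" "finite (B - A)" using X(1) finite_A b(1) by (auto intro: finite_subset)
  have sub: "point_ideal (B - A) 3 \<subseteq> point_ideal X 3"
  proof
    fix p assume p: "p \<in> point_ideal (B - A) 3"
    show "p \<in> point_ideal X 3"
    proof (rule vanishing_transfer[where W = "A \<union> B" and i = 3 and c = c])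
      show "hf (point_ideal X) 3 = card X" using hf_general_cubic[OF X(1)] by simp
    qed (use rel p finite_A b(1) X(1) in \<open>auto simp: X_def forms_through_iff\<close>)
  qed
  have "card X \<le> hf (point_ideal (B - A)) 3"
    using hf_antimono[OF graded_ideal_forms_through graded_ideal_forms_through sub] hf_general_cubic[OF X(1)] by simp
  then have XB: "card X \<le> card (B - A)" using hf_points_le[OF fin(2), of 3] by simp
  have AB: "card (A - B) \<le> card X" using card_mono[OF fin(1) X(2)] .
  have cA: "card A = card (A - B) + card (A \<inter> B)"
    using finite_A by (metis Int_Diff_Un Int_Diff_disjoint add.commute card_Un_disjoint finite_Diff finite_Int)
  have cB: "card B = card (B - A) + card (A \<inter> B)"
    using b(1) by (metis Int_Diff_Un Int_Diff_disjoint Int_commute add.commute card_Un_disjoint finite_Diff finite_Int)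
  have "point_ideal (B - A) 3 = point_ideal (A - B) 3 \<and> (\<forall>x\<in>A \<inter> B. c x = 0)" if "card B = 18"
  proof -
    have eq: "card X = card (A - B)" "card X = card (B - A)" using that card_A cA cB XB AB by simp_all
    have XAB: "X = A - B" using card_subset_eq[OF fin(1) X(2)] eq(1) by simp
    have "hf (point_ideal (B - A)) 3 \<le> hf (point_ideal X) 3"
      using hf_points_le[OF fin(2), of 3] eq(2) hf_general_cubic[OF X(1), of 3] by simp
    then have "point_ideal (B - A) 3 = point_ideal X 3"
      by (rule hf_le_imp_eq[OF graded_ideal_forms_through graded_ideal_forms_through sub])
    then show ?thesis using XAB by (auto simp: X_def)
  qed
  moreover have "c x \<noteq> 0" if "x \<in> A - B" for x using X(2) that by (auto simp: X_def)
  moreover have "18 \<le> card B" using card_A cA cB XB AB by simp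
  ultimately show ?thesis using rel by blast
qed

end

text \<open>Members of the vanishing ideal are expressed by the generators one homogeneous component
  at a time. A finite nonempty set has codimension 3, the number of generators.\<close>

lemma complete_intersection_of_point_ideal:
  assumes Z: "finite Z" "Z \<noteq> {}" and q: "q \<noteq> 0" "homogeneous 4 q" and g: "g \<noteq> 0"
    and P: "irreducible_pencil f g l1 l2 C"
    and eq: "\<And>d. point_ideal Z d = adjoin (irreducible_pencil.I f g) 4 q d"
  shows "complete_intersection Z [3, 3, 4]"
proof -
  interpret P: irreducible_pencil f g l1 l2 C by (rule P)
  interpret M: module "(*) :: 4 cpoly \<Rightarrow> 4 cpoly \<Rightarrow> 4 cpoly"
    by unfold_locales (simp_all add: algebra_simps)
  have "vanishing_ideal Z = M.span {f, g, q}"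
  proof
    show "vanishing_ideal Z \<subseteq> M.span {f, g, q}"
    proof
      fix p assume p: "p \<in> vanishing_ideal Z"
      have "hom_component d p \<in> M.span {f, g, q}" for d
      proof -
        have "hom_component d p \<in> point_ideal Z d"
          using p vanishes_at_hom_component homogeneous_hom_component
          by (auto simp: vanishing_ideal_def forms_through_iff)
        then obtain j t where jt: "hom_component d p = j + t * q" "j \<in> P.I d"
          unfolding eq by (elim adjoinE) blast
        obtain r s where "j = r * f + s * g" using jt(2) by (rule P.I_cases)
        then show ?thesis
          unfolding jt(1) by (auto intro!: M.span_add M.span_scale intro: M.span_base)
      qed
      then have "(\<Sum>e\<in>mdeg ` Poly_Mapping.keys p. hom_component e p) \<in> M.span {f, g, q}"
        by (intro M.span_sum)
      then show "p \<in> M.span {f, g, q}" by (simp flip: sum_hom_components)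
    qed
    have "f \<in> P.I 3" "g \<in> P.I 3" by (rule P.generators_in_I)+
    then have "f \<in> point_ideal Z 3" "g \<in> point_ideal Z 3" "q \<in> point_ideal Z 4"
      unfolding eq using subset_adjoin[OF P.I] generator_in_adjoin[OF P.I] by blast+
    then have "{f, g, q} \<subseteq> vanishing_ideal Z"
      by (auto simp: vanishing_ideal_def forms_through_def)
    moreover have "M.subspace (vanishing_ideal Z)"
      by (rule M.subspaceI) (auto simp: vanishing_ideal_def vanishes_at_def)
    ultimately show "M.span {f, g, q} \<subseteq> vanishing_ideal Z" by (rule M.span_minimal)
  qed
  then show ?thesis
    unfolding complete_intersection_def
    using has_dimension_finite[OF Z] P.f P.g g q
    by (intro conjI exI[of _ "0::nat"] exI[of _ "[f, g, q]"]) simp_all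
qed

theorem theorem5p5:
  fixes F :: "4 cpoly" and A :: "4 proj set"
  assumes form: "homogeneous 6 F"
    and decomp: "nonredundant_decomposition 6 F A"
    and length: "card A = 18"
    and gp: "general_position A"
    and sub17: "\<And>A'. A' \<subseteq> A \<Longrightarrow> card A' = 17 \<Longrightarrow> has_dimension (base_locus 3 A') 0"
    and curve: "irreducible_curve (base_locus 3 A)"
  shows "minimal_decomposition 6 F A \<and> waring_rank 6 F = 18 \<and>
    (\<forall>B. decomposition 6 F B \<and> card B = 18 \<and> B \<noteq> A \<longrightarrow>
       A \<inter> B = {} \<and> complete_intersection (A \<union> B) [3, 3, 4])"
proof -
  interpret general_points A by unfold_locales (rule gp length)+
  define C where "C = base_locus 3 A"
  have C_irr: "zariski_irreducible C" using curve by (simp add: C_def irreducible_curve_def)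
  obtain f g l1 l2 where P: "irreducible_pencil f g l1 l2 C" and fg: "f \<in> point_ideal A 3" "g \<in> point_ideal A 3" "g \<noteq> 0"
    using irreducible_pencil_exists C_irr unfolding C_def by blast
  interpret P: irreducible_pencil f g l1 l2 C by (rule P)
  have AC: "A \<subseteq> C" unfolding C_def by (rule subset_base_locus)
  have decA: "decomposition 6 F A"
    using decomp unfolding decomposition_def nonredundant_decomposition_def by blast
  have rank: "waring_rank 6 F = 18"
    unfolding waring_rank_def
  proof (rule Least_equality)
    show "\<exists>A. decomposition 6 F A \<and> card A = 18" using decA length by blast
  next
    fix r assume "\<exists>B. decomposition 6 F B \<and> card B = r"
    then show "18 \<le> r" using decomposition_comparison[OF decomp] by blast
  qed
  \<comment> \<open>Cubics separate the points of A, so this cubic is nonzero at \<open>a\<close>, a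
    point of C.\<close>
  have cubic: "\<exists>h. h \<in> point_ideal (A - {a}) 3 \<and> h \<notin> point_ideal C 3" if "a \<in> A" for a
    using separating_form_if_hf[OF finite_A _ that, of 3] hf_general_cubic[of A 3] AC that
    by (auto simp: forms_through_iff)
  have "A \<inter> B = {} \<and> complete_intersection (A \<union> B) [3, 3, 4]"
    if B: "decomposition 6 F B" "card B = 18" "B \<noteq> A" for B
  proof -
    have finB: "finite B" using B(1) by (simp add: decomposition_def)
    obtain c where rel: "\<And>p. homogeneous 6 p \<Longrightarrow> (\<Sum>x\<in>A \<union> B. c x * poly_eval p (rep_proj x)) = 0"
      and c: "\<And>x. x \<in> A - B \<Longrightarrow> c x \<noteq> 0" "\<And>x. x \<in> A \<inter> B \<Longrightarrow> c x = 0"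
      and same: "point_ideal (B - A) 3 = point_ideal (A - B) 3"
      using decomposition_comparison[OF decomp B(1)] B(2) by blast
    define Z where "Z = (A - B) \<union> (B - A)"
    have finZ: "finite Z" using finite_A finB by (simp add: Z_def)
    have Z3: "point_ideal Z 3 = point_ideal (A - B) 3"
      using same by (auto simp: Z_def forms_through_def)
    have IZ: "P.I d \<subseteq> point_ideal Z d" for d
      using fg point_ideal_antimono[of "A - B" A 3]
      by (intro P.I_subset[OF graded_ideal_forms_through]) (auto simp: Z3)
    have disjoint: "A \<inter> B = {}"
    proof (rule ccontr)
      assume "A \<inter> B \<noteq> {}"
      then obtain a where a: "a \<in> A" "a \<in> B" by blast
      obtain h where h: "h \<in> point_ideal (A - {a}) 3" "h \<notin> point_ideal C 3" using cubic[OF a(1)] by blast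
      have hom: "homogeneous 3 h" using h(1) by (simp add: forms_through_iff)
      \<comment> \<open>The omitted point \<open>a\<close> is common to both sets, so
        \<open>h\<close> passes through \<open>A - B\<close> and therefore through
        \<open>B - A\<close>.\<close>
      have "h \<in> point_ideal Z 3" unfolding Z3 using h(1) a(2) by (auto simp: forms_through_def)
      then have "adjoin P.I 3 h d \<subseteq> point_ideal Z d" for d
        by (intro adjoin_subset[OF P.I graded_ideal_forms_through IZ])
      \<comment> \<open>Points on a complete intersection of type (3, 3, 3) are separated from
        degree \<open>e + 3 = 6\<close> on, exactly the degree of the relation.\<close>
      then have hf6: "hf (point_ideal Z) 6 = card Z"
        using P.hf_points_stable[OF hom _ h(2) finZ, of 6] by simp
      have "\<not> A \<subseteq> B" using card_subset_eq[OF finB, of A] B(2,3) length by auto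
      then obtain x where x: "x \<in> A - B" by blast
      then obtain p where p: "p \<in> point_ideal (Z - {x}) 6" "poly_eval p (rep_proj x) \<noteq> 0"
        using separating_form_if_hf[OF finZ hf6, of x] by (auto simp: Z_def)
      have "0 = (\<Sum>y\<in>A \<union> B. c y * poly_eval p (rep_proj y))"
        using p(1) by (intro rel[symmetric]) (simp add: forms_through_iff)
      \<comment> \<open>Apart from \<open>x\<close>, the form \<open>p\<close> vanishes on
        \<open>Z\<close>, and on the common points \<open>c\<close> vanishes.\<close>
      also have "\<dots> = (\<Sum>y\<in>A \<union> B. if y = x then c x * poly_eval p (rep_proj x) else 0)"
        using p(1) c(2) by (intro sum.cong) (auto simp: forms_through_iff Z_def)
      also have "\<dots> = c x * poly_eval p (rep_proj x)" using x finite_A finB by simp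
      finally show False using p(2) c(1)[OF x] by simp
    qed
    have Z: "Z = A \<union> B" using disjoint by (auto simp: Z_def)
    have cardZ: "card Z = 36" using card_Un_disjoint[OF finite_A finB disjoint] length B(2) Z by simp
    \<comment> \<open>10 is the dimension of the space of quadrics, the largest number of points
      that quadrics can separate. A quartic through the other 26 points then passes through these as
      well.\<close>
    have "10 \<le> card A" using length by simp
    then obtain X where X: "X \<subseteq> A" "card X = 10" by (rule obtain_subset_with_card_n)
    have "hf (point_ideal X) 2 = card X" using hf_general[OF X(1), of 2] X(2) by (simp add: numeral_eq_Suc)
    then have "p \<in> point_ideal X 4" if "p \<in> point_ideal (Z - X) 4" for p
      using that X(1) c(1) rel finite_A finB disjoint
      by (intro vanishing_transfer[of "A \<union> B" 2 4 c]) (auto simp: forms_through_iff Z)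
    then have "point_ideal (Z - X) 4 \<subseteq> point_ideal Z 4" by (auto simp: forms_through_def)
    then have "hf (point_ideal Z) 4 \<le> hf (point_ideal (Z - X)) 4"
      by (rule hf_antimono[OF graded_ideal_forms_through graded_ideal_forms_through])
    also have "\<dots> \<le> card (Z - X)" using finZ by (intro hf_points_le) simp
    also have "\<dots> = 26"
      using X Z cardZ finite_A by (subst card_Diff_subset) (auto intro: finite_subset)
    \<comment> \<open>At most 26 against 27, so some quartic through \<open>Z\<close> lies outside
      \<open>(f, g)\<close>.\<close>
    finally have "hf (point_ideal Z) 4 < hf P.I 4" using P.plane_section(1)[of 4] by (simp add: curve_hf_def)
    then have "P.I 4 \<noteq> point_ideal Z 4" by (auto simp: hf_def)
    then obtain q where q: "q \<in> point_ideal Z 4" "q \<notin> P.I 4" using IZ by blast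
    have homq: "homogeneous 4 q" using q(1) by (simp add: forms_through_iff)
    have q0: "q \<noteq> 0" using q(2) gi_zero[OF P.I] by auto
    obtain a where a: "a \<in> A" using length by fastforce
    obtain h where h: "h \<in> point_ideal (A - {a}) 3" "h \<notin> point_ideal C 3" using cubic[OF a] by blast
    have qC: "q \<notin> point_ideal C 4"
    proof
      assume "q \<in> point_ideal C 4"
      moreover have "17 \<le> hf (point_ideal (A - {a})) d" if "3 \<le> d" for d
        using hf_general_cubic[of "A - {a}" d] that a length finite_A by auto
      ultimately show False using P.quartic_vanishing_on_C[of "A - {a}" h q] AC h q(2) by auto
    qed
    have "adjoin P.I 4 q d \<subseteq> point_ideal Z d" for d
      by (intro adjoin_subset[OF P.I graded_ideal_forms_through IZ q(1)])
    then have "point_ideal Z d = adjoin P.I 4 q d" for d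
      using cardZ by (intro P.point_ideal_eq_adjoin[OF homq _ qC finZ]) simp_all
    moreover have "Z \<noteq> {}" using cardZ by auto
    ultimately have "complete_intersection Z [3, 3, 4]"
      by (intro complete_intersection_of_point_ideal[OF finZ _ q0 homq fg(3) P])
    then show ?thesis using disjoint Z by simp
  qed
  then show ?thesis
    unfolding minimal_decomposition_def using decA length rank by auto
qed

end
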